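(* Let $p$ be an odd prime with $p\nmid D$ and let $k\geq 1$. There is a subset $\hat C_0(p^k)\subset \hat C(p^k)$ of the group of characters of $C(p^k)$, satisfying $\lim_{p\to\infty}\frac{|\hat C_0(p^k)|}{p^k}=1$ (for fixed $k$), together with a fixed character $\chi_0$ of $C(p^k)$ and a sign $\epsilon_{p,k}\in\{\pm1\}$ depending only on $p$ and $k$ (not on the eigenfunction), such that: (1) for every $\chi\in\hat C_0(p^k)$ there is a unique (up to multiplication by a scalar of modulus one) normalized Hecke eigenfunction $\psi\in\mathcal H_{p^k}$ whose joint eigenvalue character is $\chi$, i.e. $U_{p^k}(\iota(\beta))\psi=\chi(\beta)\psi$ for all $\beta\in C(p^k)$; (2) for this eigenfunction $\psi$ and every $n=(n_1,n_2)\in\mathbb Z^2$ with $Q(n)\not\equiv 0\pmod p$, the elementary observable $f_n(x)=e^{2\pi i n\cdot x}$ satisfies \[\langle \operatorname{Op}_{p^k}(f_n)\psi,\psi\rangle=\epsilon_{p,k}\frac{(-1)^{n_1n_2}}{\# C(p^k)}\,E_{p^k}\!\left(\tfrac{Q(n)}{2},\chi\chi_0\right),\] where $\tfrac{Q(n)}{2}$ denotes $Q(n)\cdot 2^{-1}\bmod p^k$.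
   Context: Let $A\in \mathrm{SL}(2,\mathbb Z)$ be hyperbolic ($|\mathrm{Tr}(A)|>2$), let $D=\mathrm{Tr}(A)^2-4>0$, let $\alpha$ be an eigenvalue of $A$ (in the real quadratic field $K=\mathbb Q(\alpha)$), $\mathfrak O=\mathbb Z[\alpha]$, and $\iota:\mathfrak O\to \mathrm{Mat}(2,\mathbb Z)$ the ring homomorphism $n+m\alpha\mapsto nI+mA$. Note $\sqrt D=\alpha-\alpha^{-1}\in\mathfrak O$. For an integer $N$ the norm $K^*\to\mathbb Q^*$ induces $\mathcal N_N:(\mathfrak O/N\mathfrak O)^*\to(\mathbb Z/N\mathbb Z)^*$ and $C(N)=\ker\mathcal N_N$; $\iota(C(N))$ is a commutative subgroup of $\mathrm{SL}(2,\mathbb Z/N\mathbb Z)$ commuting with $A$ mod $N$. Notation: $e(x)=e^{2\pi i x}$, $e_N(x)=e(x/N)$, and $e_N(a/b)$ means $e_N(ab^{-1})$ with $b^{-1}$ the inverse of $b$ mod $N$. The Hilbert space is $\mathcal H_N=L^2(\mathbb Z/N\mathbb Z)$ with $\langle\phi,\psi\rangle=\frac1N\sum_{y}\phi(y)\overline{\psi(y)}$. For $n\in\mathbb Z^2$, $T_N(n)\psi(y)=e_{2N}(n_1n_2)e_N(n_2y)\psi(y+n_1)$, and for $f\in C^\infty(\mathbb T^2)$ with Fourier coefficients $\hat f(n)$, $\operatorname{Op}_N(f)=\sum_n\hat f(n)T_N(n)$. For odd $N$, $B\mapsto U_N(B)$ is the quantum-propagator (Weil) unitary representation of $\mathrm{SL}(2,\mathbb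 Z/N\mathbb Z)$ on $\mathcal H_N$ (Hannay–Berry / Kurlberg–Rudnick quantization), characterized by $U_N(B)^*\tilde T_N(n)U_N(B)=\tilde T_N(nB)$ where $\tilde T_N(n)=(-1)^{n_1n_2}T_N(n)$. Hecke operators are $U_N(\iota(\beta))$, $\beta\in C(N)$; a Hecke eigenfunction is a joint eigenfunction of $U_N(A)$ and all Hecke operators, and its eigenvalues define a character $\chi$ of $C(N)$. Let $\omega(n,m)=n_1m_2-n_2m_1$ and $Q(n)=\omega(nA,n)$ (row vectors). Let $X(p^k)=\{x\in\mathbb Z/p^k\mathbb Z: Dx^2\not\equiv1\pmod p\}$ and $\beta(x)=\frac{\sqrt Dx+1}{\sqrt Dx-1}\in C(p^k)$ for $x\in X(p^k)$. For $\nu\in\mathbb Z/p^k\mathbb Z$ and a character $\chi$ of $C(p^k)$, $E_{p^k}(\nu,\chi)=\sum_{x\in X(p^k)}e_{p^k}(\nu x)\chi(\beta(x))$. *)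

theory Defs
  imports
    "HOL-Analysis.Analysis"
    "HOL-Number_Theory.Number_Theory"
    "HOL-Algebra.QuotRing"
    "Jordan_Normal_Form.Schur_Decomposition"
begin

text \<open>
  Two-dimensional objects over the integers and the reals (the matrix \<open>A\<close>, frequencies
  \<open>n\<close>, points of the torus) are the Cartesian vectors and matrices of HOL-Analysis.
  States and operators on \<open>L\<^sup>2(\<int>/N\<int>)\<close> are vectors and matrices of
  Jordan_Normal_Form of dimension \<open>N\<close>, position \<open>y < N\<close> standing for the residue
  class of \<open>y\<close>. Below, the symbol \<open>$\<close> is reserved for the former.
\<close>

no_notation Matrix.vec_index (infixl "$" 100)

subsection \<open>Exponentials and Fourier coefficients\<close>

definition e_fun :: "real \<Rightarrow> complex" where
  "e_fun x = exp (2 * of_real pi * \<i> * of_real x)"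

definition e_mod :: "nat \<Rightarrow> int \<Rightarrow> complex" where
  "e_mod N a = e_fun (real_of_int a / real N)"

definition freq_dot :: "int^2 \<Rightarrow> real^2 \<Rightarrow> real" where
  "freq_dot n x = (\<Sum>i\<in>UNIV. real_of_int (n $ i) * x $ i)"

text \<open>Functions on the torus are \<open>\<int>\<^sup>2\<close>-periodic functions on the plane.\<close>

definition elementary_observable :: "int^2 \<Rightarrow> real^2 \<Rightarrow> complex" where
  "elementary_observable n x = e_fun (freq_dot n x)"

definition fourier_coeff :: "(real^2 \<Rightarrow> complex) \<Rightarrow> int^2 \<Rightarrow> complex" where
  "fourier_coeff f n = integral (cbox 0 1) (\<lambda>x. f x * e_fun (- freq_dot n x))"

subsection \<open>Quantum observables\<close>

definition state_inner :: "nat \<Rightarrow> complex Matrix.vec \<Rightarrow> complex Matrix.vec \<Rightarrow> complex" where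
  "state_inner N \<phi> \<psi> = (\<phi> \<bullet>c \<psi>) / of_nat N"

definition T_op :: "nat \<Rightarrow> int^2 \<Rightarrow> complex Matrix.mat" where
  "T_op N n = Matrix.mat N N (\<lambda>(y, z).
     if int z = (int y + n $ 1) mod int N
     then e_mod (2 * N) (n $ 1 * n $ 2) * e_mod N (n $ 2 * int y) else 0)"

lemma T_op_apply:
  assumes "\<psi> \<in> carrier_vec N" and "y < N"
  shows "vec_index (T_op N n *\<^sub>v \<psi>) y =
    e_mod (2 * N) (n $ 1 * n $ 2) * e_mod N (n $ 2 * int y)
      * vec_index \<psi> (nat ((int y + n $ 1) mod int N))"
proof -
  let ?z = "nat ((int y + n $ 1) mod int N)"
  let ?c = "e_mod (2 * N) (n $ 1 * n $ 2) * e_mod N (n $ 2 * int y)"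
  have z: "?z < N" "\<And>z. int z = (int y + n $ 1) mod int N \<longleftrightarrow> z = ?z"
  proof -
    have "0 \<le> (int y + n $ 1) mod int N" "(int y + n $ 1) mod int N < int N"
      using assms(2) by simp_all
    then show "?z < N" "\<And>z. int z = (int y + n $ 1) mod int N \<longleftrightarrow> z = ?z"
      by linarith+
  qed
  have "vec_index (T_op N n *\<^sub>v \<psi>) y =
      (\<Sum>z = 0..<N. (if z = ?z then ?c else 0) * vec_index \<psi> z)"
    using assms by (simp add: T_op_def scalar_prod_def z(2))
  also have "\<dots> = (\<Sum>z = 0..<N. if z = ?z then ?c * vec_index \<psi> z else 0)"
    by (rule sum.cong) auto
  also have "\<dots> = ?c * vec_index \<psi> ?z"
    using z(1) by (subst sum.delta) auto
  finally show ?thesis .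
qed

definition T_tilde :: "nat \<Rightarrow> int^2 \<Rightarrow> complex Matrix.mat" where
  "T_tilde N n = ((-1) powi (n $ 1 * n $ 2)) \<cdot>\<^sub>m T_op N n"

definition Op :: "nat \<Rightarrow> (real^2 \<Rightarrow> complex) \<Rightarrow> complex Matrix.mat" where
  "Op N f = Matrix.mat N N (\<lambda>ij. \<Sum>\<^sub>\<infinity>n\<in>UNIV. fourier_coeff f n * (T_op N n $$ ij))"

subsection \<open>The quantum propagator\<close>

definition reduce_mat :: "nat \<Rightarrow> int^2^2 \<Rightarrow> int^2^2" where
  "reduce_mat N = map_matrix (\<lambda>a. a mod int N)"

definition SL2 :: "nat \<Rightarrow> (int^2^2) monoid" where
  "SL2 N = \<lparr>carrier = {B. reduce_mat N B = B \<and> [Determinants.det B = 1] (mod int N)},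
            monoid.mult = (\<lambda>B C. reduce_mat N (B ** C)),
            one = reduce_mat N (Finite_Cartesian_Product.mat 1)\<rparr>"

text \<open>The normalisation of the inner product does not affect adjoints.\<close>

definition unitary_group :: "nat \<Rightarrow> complex Matrix.mat monoid" where
  "unitary_group N = \<lparr>carrier = {M \<in> carrier_mat N N. mat_adjoint M * M = 1\<^sub>m N},
                      monoid.mult = (*), one = 1\<^sub>m N\<rparr>"

text \<open>
  For odd \<open>N\<close> this determines \<open>\<rho>\<close> on \<open>SL2 N\<close> up to a character of that
  group, hence uniquely if \<open>3\<close> does not divide \<open>N\<close>.
\<close>

definition quantum_propagator :: "nat \<Rightarrow> (int^2^2 \<Rightarrow> complex Matrix.mat) \<Rightarrow> bool" where
  "quantum_propagator N \<rho> \<longleftrightarrow> \<rho> \<in> hom (SL2 N) (unitary_group N) \<and>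
     (\<forall>B\<in>carrier (SL2 N). \<forall>n.
        mat_adjoint (\<rho> B) * T_tilde N n * \<rho> B = T_tilde N (n v* B))"

subsection \<open>The order \<open>\<int>[\<alpha>]\<close> and the Hecke group\<close>

definition eigenvalue_of :: "int^2^2 \<Rightarrow> real \<Rightarrow> bool" where
  "eigenvalue_of A \<alpha> \<longleftrightarrow> (\<exists>v. v \<noteq> 0 \<and> map_matrix real_of_int A *v v = \<alpha> *s v)"

definition discr :: "int^2^2 \<Rightarrow> int" where
  "discr A = (trace A)\<^sup>2 - 4"

definition order_ring :: "real \<Rightarrow> real ring" where
  "order_ring \<alpha> = \<lparr>carrier = {of_int n + of_int m * \<alpha> | n m. True},
     monoid.mult = (*), one = 1, ring.zero = 0, add = (+)\<rparr>"

definition iota :: "int^2^2 \<Rightarrow> real \<Rightarrow> real \<Rightarrow> int^2^2" where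
  "iota A \<alpha> x = (THE M. \<exists>n m. x = of_int n + of_int m * \<alpha> \<and>
     M = Finite_Cartesian_Product.mat n + map_matrix ((*) m) A)"

text \<open>The norm from \<open>\<rat>(\<alpha>)\<close> to \<open>\<rat>\<close>; since \<open>det A = 1\<close>,
  the Galois conjugate of \<open>\<alpha>\<close> is \<open>\<alpha>\<^sup>-\<^sup>1\<close>.\<close>

definition field_norm :: "real \<Rightarrow> real \<Rightarrow> real" where
  "field_norm \<alpha> x = (THE r. \<exists>a b. x = of_rat a + of_rat b * \<alpha> \<and>
     r = (of_rat a + of_rat b * \<alpha>) * (of_rat a + of_rat b * inverse \<alpha>))"

definition level_ideal :: "real \<Rightarrow> nat \<Rightarrow> real set" where
  "level_ideal \<alpha> N = PIdl\<^bsub>order_ring \<alpha>\<^esub> (real N)"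

definition order_mod :: "real \<Rightarrow> nat \<Rightarrow> real set ring" where
  "order_mod \<alpha> N = order_ring \<alpha> Quot level_ideal \<alpha> N"

text \<open>
  The maps induced on residue classes; by \<open>the_elem\<close> they take the common value on all
  representatives.
\<close>

definition norm_mod :: "real \<Rightarrow> nat \<Rightarrow> real set \<Rightarrow> int" where
  "norm_mod \<alpha> N S = the_elem ((\<lambda>x. floor (field_norm \<alpha> x) mod int N) ` S)"

definition iota_mod :: "int^2^2 \<Rightarrow> real \<Rightarrow> nat \<Rightarrow> real set \<Rightarrow> int^2^2" where
  "iota_mod A \<alpha> N S = the_elem ((\<lambda>x. reduce_mat N (iota A \<alpha> x)) ` S)"

definition hecke_group :: "real \<Rightarrow> nat \<Rightarrow> real set monoid" where
  "hecke_group \<alpha> N = (units_of (order_mod \<alpha> N))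
     \<lparr>carrier := kernel (units_of (order_mod \<alpha> N)) (units_of (residue_ring (int N)))
                  (norm_mod \<alpha> N)\<rparr>"

definition circle_group :: "complex monoid" where
  "circle_group = \<lparr>carrier = {z. cmod z = 1}, monoid.mult = (*), one = 1\<rparr>"

text \<open>Extensionality makes distinct elements distinct as characters, so that sets of
  characters can be counted.\<close>

definition characters :: "'a monoid \<Rightarrow> ('a \<Rightarrow> complex) set" where
  "characters G = hom G circle_group \<inter> extensional (carrier G)"

definition hecke_eigenfunction ::
  "int^2^2 \<Rightarrow> real \<Rightarrow> nat \<Rightarrow> (int^2^2 \<Rightarrow> complex Matrix.mat) \<Rightarrow> (real set \<Rightarrow> complex)
     \<Rightarrow> complex Matrix.vec \<Rightarrow> bool" where
  "hecke_eigenfunction A \<alpha> N \<rho> \<theta> \<psi> \<longleftrightarrow>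
     \<psi> \<in> carrier_vec N \<and> \<psi> \<noteq> 0\<^sub>v N \<and>
     (\<exists>c. \<rho> (reduce_mat N A) *\<^sub>v \<psi> = c \<cdot>\<^sub>v \<psi>) \<and>
     (\<forall>\<beta>\<in>carrier (hecke_group \<alpha> N). \<rho> (iota_mod A \<alpha> N \<beta>) *\<^sub>v \<psi> = \<theta> \<beta> \<cdot>\<^sub>v \<psi>)"

subsection \<open>The exponential sums\<close>

definition omega :: "int^2 \<Rightarrow> int^2 \<Rightarrow> int" where
  "omega n m = n $ 1 * m $ 2 - n $ 2 * m $ 1"

definition Q_form :: "int^2^2 \<Rightarrow> int^2 \<Rightarrow> int" where
  "Q_form A n = omega (n v* A) n"

text \<open>As an element of \<open>\<int>[\<alpha>]\<close>; this is the negative square root of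
  \<open>discr A\<close> if \<open>\<alpha> < \<alpha>\<^sup>-\<^sup>1\<close>.\<close>

definition sqrt_D :: "real \<Rightarrow> real" where
  "sqrt_D \<alpha> = \<alpha> - inverse \<alpha>"

definition X_set :: "int^2^2 \<Rightarrow> nat \<Rightarrow> nat \<Rightarrow> int set" where
  "X_set A p k = {x \<in> {0..<int (p ^ k)}. \<not> [discr A * x\<^sup>2 = 1] (mod int p)}"

definition residue_class :: "real \<Rightarrow> nat \<Rightarrow> real \<Rightarrow> real set" where
  "residue_class \<alpha> N y = level_ideal \<alpha> N +>\<^bsub>order_ring \<alpha>\<^esub> y"

definition cayley :: "real \<Rightarrow> nat \<Rightarrow> int \<Rightarrow> real set" where
  "cayley \<alpha> N x =
     residue_class \<alpha> N (sqrt_D \<alpha> * of_int x + 1) \<otimes>\<^bsub>order_mod \<alpha> N\<^esub>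
     inv\<^bsub>order_mod \<alpha> N\<^esub> residue_class \<alpha> N (sqrt_D \<alpha> * of_int x - 1)"

definition E_sum ::
  "int^2^2 \<Rightarrow> real \<Rightarrow> nat \<Rightarrow> nat \<Rightarrow> int \<Rightarrow> (real set \<Rightarrow> complex) \<Rightarrow> complex" where
  "E_sum A \<alpha> p k \<nu> \<theta> =
     (\<Sum>x\<in>X_set A p k. e_mod (p ^ k) (\<nu> * x) * \<theta> (cayley \<alpha> (p ^ k) x))"

end

theory Submission
  imports Defs
begin

text \<open>
  Write \<open>f(\<beta>)\<close> for the trace of \<open>U(\<iota>(\<beta>))\<close>, \<open>\<beta> \<in> C(p\<^sup>k)\<close>. Conjugating by the Heisenberg operators
  \<open>T(m)\<close>, one finds that the trace of \<open>T(n) U(\<iota>(\<beta>))\<close> equals \<open>e(- Q(n) x / 2) f(\<beta>)\<close> if \<open>\<beta> = \<beta>(x)\<close>, and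
  vanishes if \<open>\<beta> \<equiv> 1\<close> modulo \<open>p\<close> and \<open>n \<noteq> 0\<close> modulo \<open>p\<close>. Schur orthogonality of the \<open>T(m)\<close> shows
  that \<open>\<bar>f(\<beta>)\<bar>\<^sup>2\<close> is the number of fixed points of \<open>\<iota>(\<beta>)\<close> on \<open>(\<int>/p\<^sup>k)\<^sup>2\<close>, and that
  \<open>f(\<beta>) f(\<gamma>) = \<epsilon> f(\<beta>\<gamma>)\<close> whenever none of \<open>\<beta>\<close>, \<open>\<gamma>\<close>, \<open>\<beta>\<gamma>\<close> is \<open>1\<close> modulo \<open>p\<close>; here
  \<open>\<epsilon> = (D/p)\<^sup>k\<close> is the normalised Gauss sum of the form \<open>Q\<close>. Hence \<open>\<epsilon> f\<close> agrees with a character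
  of \<open>C(p\<^sup>k)\<close> away from the classes that are \<open>1\<close> modulo \<open>p\<close>; its conjugate is \<open>\<chi>\<^sub>0\<close>.

  The multiplicity \<open>m(\<chi>)\<close> of \<open>\<chi>\<close> in \<open>L\<^sup>2(\<int>/p\<^sup>k)\<close> is a Fourier coefficient of \<open>f\<close>. By Parseval and
  the count of fixed points the sum of \<open>(m(\<chi>) - 1)\<^sup>2\<close> over all \<open>\<chi>\<close> is \<open>O(p\<^sup>k\<^sup>-\<^sup>1)\<close>, so that almost all
  multiplicities are \<open>1\<close>. If \<open>m(\<chi>) = 1\<close>, then the projection to the \<open>\<chi>\<close>-isotypic part is the
  projection to the line of \<open>\<psi>\<close>, and the trace of its product with \<open>T(n)\<close> is the matrix element.
\<close>

section \<open>Characters of finite abelian groups\<close>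

text \<open>The propagator enters only through its homomorphism property and its intertwining
  relation with \<open>T_tilde\<close>. Instead of explicit matrices, everything is extracted from
  traces, which conjugation by \<open>T_tilde\<close> transports or annihilates.

  The obstacle is the subgroup of classes congruent to 1 modulo p. There 1 - \<beta> is not
  invertible, the Cayley transform does not reach it, and traces may be as large as p^k. But it has
  only p^(k-1) elements, and the shift by -1 brings it to Cayley parameters x divisible by p, where
  the fixed points to be counted satisfy x m = 0; this bounds its traces in mean square.

  The bound for the sum of (m(\<chi>) - 1)^2 rests on a cancellation. The group has order p^k +
  O(p^(k-1)), the multiplicities add up to f(1) = p^k, and their squares add up to at most p^k +
  O(p^(k-1)), the leading term being the contribution |f(1)|^2 of the identity divided by the order
  of the group. The terms of order p^k cancel. The implied constants depend on k alone, which gives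
  the limit in p for fixed k.\<close>

definition partial_character :: "('a, 'b) monoid_scheme \<Rightarrow> 'a set \<Rightarrow> ('a \<Rightarrow> complex) \<Rightarrow> bool" where
  "partial_character G K \<theta> \<longleftrightarrow> subgroup K G \<and> (\<forall>x\<in>K. cmod (\<theta> x) = 1) \<and>
     (\<forall>x\<in>K. \<forall>y\<in>K. \<theta> (x \<otimes>\<^bsub>G\<^esub> y) = \<theta> x * \<theta> y)"

lemma partial_character_int_pow:
  assumes "comm_group G" "partial_character G K \<theta>" "x \<in> K"
  shows "\<theta> (x [^]\<^bsub>G\<^esub> (i::int)) = \<theta> x powi i"
proof -
  interpret comm_group G by fact
  have K: "subgroup K G" and mult: "\<And>x y. x \<in> K \<Longrightarrow> y \<in> K \<Longrightarrow> \<theta> (x \<otimes>\<^bsub>G\<^esub> y) = \<theta> x * \<theta> y"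
    and nz: "\<And>x. x \<in> K \<Longrightarrow> \<theta> x \<noteq> 0"
    using assms(2) by (auto simp: partial_character_def)
  have xG: "x \<in> carrier G" using K assms(3) subgroup.mem_carrier by metis
  have one: "\<theta> \<one>\<^bsub>G\<^esub> = 1"
    using mult[of "\<one>\<^bsub>G\<^esub>" "\<one>\<^bsub>G\<^esub>"] nz[of "\<one>\<^bsub>G\<^esub>"] subgroup.one_closed[OF K] by simp
  have nat: "\<theta> (x [^]\<^bsub>G\<^esub> (int n)) = \<theta> x ^ n" for n
  proof (induction n)
    case (Suc n)
    have "x [^]\<^bsub>G\<^esub> int (Suc n) = x [^]\<^bsub>G\<^esub> int n \<otimes>\<^bsub>G\<^esub> x"
      using xG by (metis int_pow_int nat_pow_Suc)
    then show ?case
      using Suc mult[OF subgroup_int_pow_closed[OF K assms(3)] assms(3)] by simp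
  qed (simp add: one int_pow_int)
  show ?thesis
  proof (cases "i \<ge> 0")
    case True
    then show ?thesis using nat[of "nat i"] by (simp add: power_int_def)
  next
    case False
    have "x [^]\<^bsub>G\<^esub> i \<otimes>\<^bsub>G\<^esub> x [^]\<^bsub>G\<^esub> (- i) = \<one>\<^bsub>G\<^esub>"
      using xG by (simp flip: int_pow_mult)
    then have "\<theta> (x [^]\<^bsub>G\<^esub> i) * \<theta> (x [^]\<^bsub>G\<^esub> (- i)) = 1"
      using mult subgroup_int_pow_closed[OF K assms(3)] one by metis
    then show ?thesis using False nat[of "nat (- i)"] nz[OF assms(3)]
      by (simp add: power_int_def field_simps)
  qed
qed

text \<open>One cyclic step: \<open>k\<close> times the \<open>i\<close>-th power of
  \<open>g\<close> is sent to \<open>\<theta> k * z powi i\<close>. This is consistent because the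
  powers of \<open>g\<close> lying in \<open>K\<close> are powers of its \<open>d\<close>-th power,
  where \<open>z ^ d\<close> already agrees with \<open>\<theta>\<close>. The root \<open>z\<close>
  is left to choice, since different roots yield characters that separate points.\<close>

lemma partial_character_adjoin:
  assumes "comm_group G" "finite (carrier G)" "partial_character G K \<theta>" "g \<in> carrier G"
    and d: "d > 0" "g [^]\<^bsub>G\<^esub> (int d) \<in> K" "\<And>i. 0 < i \<Longrightarrow> i < d \<Longrightarrow> g [^]\<^bsub>G\<^esub> (int i) \<notin> K"
    and z: "z ^ d = \<theta> (g [^]\<^bsub>G\<^esub> (int d))"
  shows "\<exists>K' \<theta>'. partial_character G K' \<theta>' \<and> K \<subseteq> K' \<and> g \<in> K' \<and> (\<forall>x\<in>K. \<theta>' x = \<theta> x) \<and> \<theta>' g = z"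
proof -
  interpret comm_group G by fact
  have K: "subgroup K G" and mult: "\<And>x y. x \<in> K \<Longrightarrow> y \<in> K \<Longrightarrow> \<theta> (x \<otimes>\<^bsub>G\<^esub> y) = \<theta> x * \<theta> y"
    and n1: "\<And>x. x \<in> K \<Longrightarrow> cmod (\<theta> x) = 1"
    using assms(3) by (auto simp: partial_character_def)
  have nz: "\<And>x. x \<in> K \<Longrightarrow> \<theta> x \<noteq> 0" using n1 by force
  have KG: "\<And>x. x \<in> K \<Longrightarrow> x \<in> carrier G" using K subgroup.mem_carrier by metis
  have one: "\<theta> \<one>\<^bsub>G\<^esub> = 1"
    using mult[of "\<one>\<^bsub>G\<^esub>" "\<one>\<^bsub>G\<^esub>"] nz[of "\<one>\<^bsub>G\<^esub>"] subgroup.one_closed[OF K] by simp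
  have "cmod z ^ d = 1" using z n1[OF d(2)] by (metis norm_power)
  then have nz1: "cmod z = 1" using d(1) by (metis norm_ge_zero power_eq_1_iff real_norm_def zero_less_iff_neq_zero abs_of_nonneg)
  then have z0: "z \<noteq> 0" by force
  \<comment> \<open>Division of \<open>i\<close> by \<open>d\<close>: the remainder is again an
    exponent landing in \<open>K\<close>, hence 0 by minimality of \<open>d\<close>.\<close>
  have dvd: "int d dvd i \<and> \<theta> (g [^]\<^bsub>G\<^esub> i) = z powi i" if i: "g [^]\<^bsub>G\<^esub> i \<in> K" for i :: int
  proof -
    have e: "g [^]\<^bsub>G\<^esub> i = g [^]\<^bsub>G\<^esub> (i mod int d) \<otimes>\<^bsub>G\<^esub> (g [^]\<^bsub>G\<^esub> int d) [^]\<^bsub>G\<^esub> (i div int d)"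
      using assms(4) by (simp add: int_pow_pow int_pow_mult[symmetric])
    have kd: "(g [^]\<^bsub>G\<^esub> int d) [^]\<^bsub>G\<^esub> (i div int d) \<in> K" using subgroup_int_pow_closed[OF K d(2)] .
    have "g [^]\<^bsub>G\<^esub> (i mod int d) = g [^]\<^bsub>G\<^esub> i \<otimes>\<^bsub>G\<^esub> inv\<^bsub>G\<^esub> ((g [^]\<^bsub>G\<^esub> int d) [^]\<^bsub>G\<^esub> (i div int d))"
      unfolding e using assms(4) by (simp add: m_assoc)
    also have "\<dots> \<in> K" using i kd K by (simp add: subgroup.m_closed subgroup.m_inv_closed)
    finally have "g [^]\<^bsub>G\<^esub> int (nat (i mod int d)) \<in> K" using d(1) by simp
    moreover have "nat (i mod int d) < d" using d(1) by (simp add: nat_less_iff)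
    ultimately have "nat (i mod int d) = 0" using d(3) by blast
    moreover have "i mod int d \<ge> 0" using d(1) by simp
    ultimately have m0: "i mod int d = 0" by linarith
    then have "int d dvd i" by auto
    then obtain q where q: "i = int d * q" by blast
    have "g [^]\<^bsub>G\<^esub> i = (g [^]\<^bsub>G\<^esub> int d) [^]\<^bsub>G\<^esub> q" using assms(4) q by (simp add: int_pow_pow)
    then have "\<theta> (g [^]\<^bsub>G\<^esub> i) = (z ^ d) powi q"
      using partial_character_int_pow[OF assms(1,3) d(2)] z by simp
    then show ?thesis using q by (simp add: power_int_mult)
  qed
  define K' where "K' = {k \<otimes>\<^bsub>G\<^esub> g [^]\<^bsub>G\<^esub> i | k (i::int). k \<in> K}"
  define \<theta>' where "\<theta>' x = (THE c. \<exists>k i. k \<in> K \<and> x = k \<otimes>\<^bsub>G\<^esub> g [^]\<^bsub>G\<^esub> (i::int) \<and> c = \<theta> k * z powi i)" for x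
  have uniq: "\<theta> k * z powi i = \<theta> l * z powi j"
    if "k \<in> K" "l \<in> K" "k \<otimes>\<^bsub>G\<^esub> g [^]\<^bsub>G\<^esub> i = l \<otimes>\<^bsub>G\<^esub> g [^]\<^bsub>G\<^esub> j" for k l and i j :: int
  proof -
    have "inv\<^bsub>G\<^esub> l \<otimes>\<^bsub>G\<^esub> (k \<otimes>\<^bsub>G\<^esub> g [^]\<^bsub>G\<^esub> i) \<otimes>\<^bsub>G\<^esub> g [^]\<^bsub>G\<^esub> (-i) = inv\<^bsub>G\<^esub> l \<otimes>\<^bsub>G\<^esub> (l \<otimes>\<^bsub>G\<^esub> g [^]\<^bsub>G\<^esub> j) \<otimes>\<^bsub>G\<^esub> g [^]\<^bsub>G\<^esub> (-i)"
      using that by simp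
    moreover have "inv\<^bsub>G\<^esub> l \<otimes>\<^bsub>G\<^esub> (k \<otimes>\<^bsub>G\<^esub> g [^]\<^bsub>G\<^esub> i) \<otimes>\<^bsub>G\<^esub> g [^]\<^bsub>G\<^esub> (-i) = inv\<^bsub>G\<^esub> l \<otimes>\<^bsub>G\<^esub> k"
      using that(1,2) KG assms(4) by (simp add: m_assoc int_pow_mult[symmetric])
    moreover have "inv\<^bsub>G\<^esub> l \<otimes>\<^bsub>G\<^esub> (l \<otimes>\<^bsub>G\<^esub> g [^]\<^bsub>G\<^esub> j) \<otimes>\<^bsub>G\<^esub> g [^]\<^bsub>G\<^esub> (-i) = g [^]\<^bsub>G\<^esub> (j - i)"
      using that(1,2) KG assms(4) by (simp add: m_assoc[symmetric] int_pow_mult[symmetric])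
    ultimately have e: "inv\<^bsub>G\<^esub> l \<otimes>\<^bsub>G\<^esub> k = g [^]\<^bsub>G\<^esub> (j - i)" by simp
    have ilK: "inv\<^bsub>G\<^esub> l \<otimes>\<^bsub>G\<^esub> k \<in> K" using that K by (simp add: subgroup.m_closed subgroup.m_inv_closed)
    have "k = l \<otimes>\<^bsub>G\<^esub> (inv\<^bsub>G\<^esub> l \<otimes>\<^bsub>G\<^esub> k)" using that KG by (simp add: m_assoc[symmetric])
    then have "\<theta> k = \<theta> l * \<theta> (g [^]\<^bsub>G\<^esub> (j - i))" using mult[OF that(2) ilK] e by simp
    also have "\<theta> (g [^]\<^bsub>G\<^esub> (j - i)) = z powi (j - i)" using dvd[of "j - i"] ilK e by simp
    finally show ?thesis using z0 by (simp add: power_int_diff)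
  qed
  have chi': "\<theta>' (k \<otimes>\<^bsub>G\<^esub> g [^]\<^bsub>G\<^esub> i) = \<theta> k * z powi i" if "k \<in> K" for k and i :: int
    unfolding \<theta>'_def proof (rule the_equality)
    show "\<exists>l j. l \<in> K \<and> k \<otimes>\<^bsub>G\<^esub> g [^]\<^bsub>G\<^esub> i = l \<otimes>\<^bsub>G\<^esub> g [^]\<^bsub>G\<^esub> (j::int) \<and> \<theta> k * z powi i = \<theta> l * z powi j"
      using that by blast
    show "c = \<theta> k * z powi i"
      if "\<exists>l j. l \<in> K \<and> k \<otimes>\<^bsub>G\<^esub> g [^]\<^bsub>G\<^esub> i = l \<otimes>\<^bsub>G\<^esub> g [^]\<^bsub>G\<^esub> (j::int) \<and> c = \<theta> l * z powi j" for c
      using that uniq[OF \<open>k \<in> K\<close>] by metis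
  qed
  have prod: "(k \<otimes>\<^bsub>G\<^esub> g [^]\<^bsub>G\<^esub> i) \<otimes>\<^bsub>G\<^esub> (l \<otimes>\<^bsub>G\<^esub> g [^]\<^bsub>G\<^esub> j) = (k \<otimes>\<^bsub>G\<^esub> l) \<otimes>\<^bsub>G\<^esub> g [^]\<^bsub>G\<^esub> (i + j)"
    if "k \<in> K" "l \<in> K" for k l and i j :: int
    using that KG assms(4) by (simp add: int_pow_mult m_ac)
  have sub: "subgroup K' G"
  proof (rule subgroupI)
    show "K' \<subseteq> carrier G" using KG assms(4) by (auto simp: K'_def)
    show "K' \<noteq> {}" using subgroup.one_closed[OF K] by (auto simp: K'_def)
    show "inv\<^bsub>G\<^esub> a \<in> K'" if aK: "a \<in> K'" for a
    proof -
      obtain k and i :: int where a: "k \<in> K" "a = k \<otimes>\<^bsub>G\<^esub> g [^]\<^bsub>G\<^esub> i" using aK unfolding K'_def by blast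
      then have "inv\<^bsub>G\<^esub> a = inv\<^bsub>G\<^esub> k \<otimes>\<^bsub>G\<^esub> g [^]\<^bsub>G\<^esub> (-i)"
        using KG assms(4) by (simp add: inv_mult int_pow_neg)
      then show ?thesis using a subgroup.m_inv_closed[OF K] unfolding K'_def by blast
    qed
    show "a \<otimes>\<^bsub>G\<^esub> b \<in> K'" if ab: "a \<in> K'" "b \<in> K'" for a b
    proof -
      obtain k l and i j :: int where "k \<in> K" "a = k \<otimes>\<^bsub>G\<^esub> g [^]\<^bsub>G\<^esub> i" "l \<in> K" "b = l \<otimes>\<^bsub>G\<^esub> g [^]\<^bsub>G\<^esub> j"
        using ab by (auto simp: K'_def)
      then show ?thesis using prod[of k l i j] subgroup.m_closed[OF K] unfolding K'_def by auto
    qed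
  qed
  have old: "\<theta>' x = \<theta> x" "x \<in> K'" if "x \<in> K" for x
  proof -
    have x: "x = x \<otimes>\<^bsub>G\<^esub> g [^]\<^bsub>G\<^esub> (0::int)" using KG[OF that] by simp
    show "\<theta>' x = \<theta> x" using chi'[OF that, of 0] x by simp
    show "x \<in> K'" unfolding K'_def using x that by blast
  qed
  have new: "\<theta>' g = z" "g \<in> K'"
  proof -
    have x: "g = \<one>\<^bsub>G\<^esub> \<otimes>\<^bsub>G\<^esub> g [^]\<^bsub>G\<^esub> (1::int)" using assms(4) by (simp add: int_pow_1)
    show "\<theta>' g = z" using chi'[OF subgroup.one_closed[OF K], of 1] x one by simp
    show "g \<in> K'" unfolding K'_def using x subgroup.one_closed[OF K] by blast
  qed
  have "partial_character G K' \<theta>'"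
    unfolding partial_character_def
  proof (intro conjI ballI sub)
    show "cmod (\<theta>' x) = 1" if "x \<in> K'" for x
      using that n1 nz1 unfolding K'_def by (auto simp: chi' norm_mult norm_power_int)
    show "\<theta>' (x \<otimes>\<^bsub>G\<^esub> y) = \<theta>' x * \<theta>' y" if xy: "x \<in> K'" "y \<in> K'" for x y
    proof -
      obtain k l and i j :: int where o: "k \<in> K" "x = k \<otimes>\<^bsub>G\<^esub> g [^]\<^bsub>G\<^esub> i" "l \<in> K" "y = l \<otimes>\<^bsub>G\<^esub> g [^]\<^bsub>G\<^esub> j"
        using xy by (auto simp: K'_def)
      show ?thesis unfolding o(2,4) prod[OF o(1,3)] chi'[OF subgroup.m_closed[OF K o(1,3)]] chi'[OF o(1)] chi'[OF o(3)] mult[OF o(1,3)]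
        using z0 by (simp add: power_int_add)
    qed
  qed
  then show ?thesis using old new by blast
qed

lemma exists_root_of_unit:
  assumes "cmod w = 1" "d > 0"
  shows "\<exists>z. z ^ d = w"
proof -
  have "(cis (Arg w / d)) ^ d = cis (real d * (Arg w / d))" by (rule Complex.DeMoivre)
  also have "real d * (Arg w / d) = Arg w" using assms(2) by simp
  also have "cis (Arg w) = w" using assms(1) by (metis cis_Arg mult_1 of_real_1 rcis_cmod_Arg rcis_def norm_zero zero_neq_one sgn_eq div_by_1)
  finally show ?thesis by blast
qed

lemma least_power_in_subgroup:
  assumes "comm_group G" "finite (carrier G)" "subgroup K G" "g \<in> carrier G"
  shows "\<exists>d>0. g [^]\<^bsub>G\<^esub> (int d) \<in> K \<and> (\<forall>i. 0 < i \<longrightarrow> i < d \<longrightarrow> g [^]\<^bsub>G\<^esub> (int i) \<notin> K)"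
proof -
  interpret comm_group G by fact
  have "order G > 0" using assms(2) order_gt_0_iff_finite by blast
  moreover have "g [^]\<^bsub>G\<^esub> (int (order G)) \<in> K"
    using pow_order_eq_1[OF assms(4)] subgroup.one_closed[OF assms(3)] by (simp add: int_pow_int)
  ultimately have ex: "\<exists>d. d > 0 \<and> g [^]\<^bsub>G\<^esub> (int d) \<in> K" by blast
  define d where "d = (LEAST d. d > 0 \<and> g [^]\<^bsub>G\<^esub> (int d) \<in> K)"
  have "d > 0 \<and> g [^]\<^bsub>G\<^esub> (int d) \<in> K" unfolding d_def by (rule LeastI_ex[OF ex])
  moreover have "\<not> (i > 0 \<and> g [^]\<^bsub>G\<^esub> (int i) \<in> K)" if "i < d" for i
    using that not_less_Least unfolding d_def by blast
  ultimately show ?thesis by blast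
qed

text \<open>The circle group is divisible: the root required by an adjunction always exists, so the
  domain grows until it is the whole group. The induction is on the number of missing
  elements.\<close>

lemma partial_character_extends:
  assumes "comm_group G" "finite (carrier G)" "partial_character G K \<theta>"
  shows "\<exists>\<theta>'. partial_character G (carrier G) \<theta>' \<and> (\<forall>x\<in>K. \<theta>' x = \<theta> x)"
  using assms(3)
proof (induction "card (carrier G) - card K" arbitrary: K \<theta> rule: less_induct)
  case less
  interpret comm_group G by fact
  have K: "subgroup K G" and n1: "\<And>x. x \<in> K \<Longrightarrow> cmod (\<theta> x) = 1"
    using less.prems by (auto simp: partial_character_def)
  have KG: "K \<subseteq> carrier G" using K by (simp add: subgroup.subset)
  show ?case
  proof (cases "K = carrier G")
    case True
    then show ?thesis using less.prems by blast
  next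
    case False
    then obtain g where g: "g \<in> carrier G" "g \<notin> K" using KG by blast
    obtain d where d: "d > 0" "g [^]\<^bsub>G\<^esub> (int d) \<in> K" "\<And>i. 0 < i \<Longrightarrow> i < d \<Longrightarrow> g [^]\<^bsub>G\<^esub> (int i) \<notin> K"
      using least_power_in_subgroup[OF assms(1,2) K g(1)] by blast
    obtain z where z: "z ^ d = \<theta> (g [^]\<^bsub>G\<^esub> (int d))" using exists_root_of_unit[OF n1[OF d(2)] d(1)] by blast
    obtain K' \<theta>' where K': "partial_character G K' \<theta>'" "K \<subseteq> K'" "g \<in> K'" "\<forall>x\<in>K. \<theta>' x = \<theta> x"
      using partial_character_adjoin[OF assms(1,2) less.prems g(1) d z] by blast
    have K'G: "K' \<subseteq> carrier G" using K'(1) by (simp add: partial_character_def subgroup.subset)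
    have "card K < card K'" using K' g finite_subset[OF K'G assms(2)] by (intro psubset_card_mono) auto
    moreover have "card K' \<le> card (carrier G)" using K'G assms(2) card_mono by blast
    ultimately have "card (carrier G) - card K' < card (carrier G) - card K" by linarith
    from less.hyps[OF this K'(1)] K'(2,4) show ?thesis by (metis subsetD)
  qed
qed

section \<open>The dual of a finite abelian group and its orthogonality relations\<close>

lemma characters_memI:
  assumes "comm_group G" "partial_character G (carrier G) \<theta>"
  shows "restrict \<theta> (carrier G) \<in> characters G"
proof -
  interpret comm_group G by fact
  show ?thesis
  using assms(2) by (auto simp: characters_def hom_def circle_group_def partial_character_def)
qed

lemma characters_D:
  assumes "\<theta> \<in> characters G"
  shows "\<And>x. x \<in> carrier G \<Longrightarrow> cmod (\<theta> x) = 1"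
    and "\<And>x y. x \<in> carrier G \<Longrightarrow> y \<in> carrier G \<Longrightarrow> \<theta> (x \<otimes>\<^bsub>G\<^esub> y) = \<theta> x * \<theta> y"
  using assms by (auto simp: characters_def hom_def circle_group_def)

text \<open>With \<open>K\<close> trivial, \<open>d\<close> is the order of \<open>a\<close>, and a
  primitive \<open>d\<close>-th root of unity is an admissible value at \<open>a\<close> other than
  1.\<close>

lemma characters_separate:
  assumes "comm_group G" "finite (carrier G)" "a \<in> carrier G" "a \<noteq> \<one>\<^bsub>G\<^esub>"
  shows "\<exists>\<theta>\<in>characters G. \<theta> a \<noteq> 1"
proof -
  interpret comm_group G by fact
  have triv: "partial_character G {\<one>\<^bsub>G\<^esub>} (\<lambda>_. 1)"
    by (auto simp: partial_character_def triv_subgroup)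
  obtain d where d: "d > 0" "a [^]\<^bsub>G\<^esub> (int d) \<in> {\<one>\<^bsub>G\<^esub>}" "\<And>i. 0 < i \<Longrightarrow> i < d \<Longrightarrow> a [^]\<^bsub>G\<^esub> (int i) \<notin> {\<one>\<^bsub>G\<^esub>}"
    using least_power_in_subgroup[OF assms(1,2) triv_subgroup assms(3)] by blast
  have "d \<noteq> 1" using d(2) assms(3,4) by (auto simp: int_pow_1)
  then have "d > 1" using d(1) by linarith
  define z where "z = cis (2 * pi / d)"
  have "z ^ d = 1" using d(1) by (simp add: z_def Complex.DeMoivre)
  have "z \<noteq> 1"
  proof
    assume "z = 1"
    then have "cos (2 * pi / d) = 1" by (simp add: z_def complex_eq_iff)
    then obtain i :: int where "2 * pi / d = of_int i * 2 * pi" using cos_one_2pi_int by blast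
    then have "1 = real_of_int (i * int d)" using d(1) by (simp add: field_simps)
    then have "i * int d = 1" by linarith
    then have "int d dvd 1" by (metis dvd_triv_right)
    then show False using \<open>d > 1\<close> by simp
  qed
  obtain K \<theta> where K: "partial_character G K \<theta>" "a \<in> K" "\<theta> a = z"
    using partial_character_adjoin[OF assms(1,2) triv assms(3) d, of z] \<open>z ^ d = 1\<close> by auto
  obtain \<theta>' where "partial_character G (carrier G) \<theta>'" "\<theta>' a = z"
    using partial_character_extends[OF assms(1,2) K(1)] K(2,3) by auto
  then show ?thesis using characters_memI[OF assms(1)] \<open>z \<noteq> 1\<close> assms(3) by (metis restrict_apply')
qed

lemma
  assumes "comm_group G" "\<theta> \<in> characters G"
  shows character_one: "\<theta> \<one>\<^bsub>G\<^esub> = 1"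
    and character_inv: "x \<in> carrier G \<Longrightarrow> \<theta> (inv\<^bsub>G\<^esub> x) = cnj (\<theta> x)"
proof -
  interpret comm_group G by fact
  show one: "\<theta> \<one>\<^bsub>G\<^esub> = 1"
    using characters_D[OF assms(2)] by (metis l_one mult_cancel_right1 norm_zero one_closed zero_neq_one)
  show "\<theta> (inv\<^bsub>G\<^esub> x) = cnj (\<theta> x)" if x: "x \<in> carrier G"
  proof -
    have "\<theta> (inv\<^bsub>G\<^esub> x) * \<theta> x = 1" using characters_D(2)[OF assms(2) inv_closed[OF x] x] x one by simp
    moreover have "cnj (\<theta> x) * \<theta> x = 1" using characters_D(1)[OF assms(2) x]
      by (metis complex_norm_square mult.commute of_real_1 one_power2)
    ultimately show ?thesis by (metis mult_cancel_right mult_zero_right zero_neq_one)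
  qed
qed

text \<open>All values are roots of unity of exponent \<open>order G\<close>, and extensionality
  removes the freedom outside the carrier.\<close>

lemma finite_characters:
  assumes "comm_group G" "finite (carrier G)"
  shows "finite (characters G)"
proof -
  interpret comm_group G by fact
  have o: "order G > 0" using assms(2) order_gt_0_iff_finite by blast
  have "characters G \<subseteq> PiE (carrier G) (\<lambda>_. {z. z ^ order G = 1})"
  proof
    fix \<theta> assume chi: "\<theta> \<in> characters G"
    have pc: "partial_character G (carrier G) \<theta>"
      using characters_D[OF chi] by (auto simp: partial_character_def subgroup_self)
    have "\<theta> x ^ order G = 1" if "x \<in> carrier G" for x
      using partial_character_int_pow[OF assms(1) pc that, of "int (order G)"] pow_order_eq_1[OF that] character_one[OF assms(1) chi]
      by (simp add: int_pow_int)
    then show "\<theta> \<in> PiE (carrier G) (\<lambda>_. {z. z ^ order G = 1})" using chi by (auto simp: characters_def PiE_iff)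
  qed
  moreover have "finite {z::complex. z ^ order G = 1}" using o finite_roots_unity[of "order G"] by simp
  ultimately show ?thesis using assms(2) finite_PiE finite_subset by (metis (no_types, lifting))
qed

lemma restrict_one_character:
  assumes "comm_group G"
  shows "(\<lambda>_\<in>carrier G. 1) \<in> characters G"
proof -
  interpret comm_group G by fact
  show ?thesis by (rule characters_memI[OF assms]) (auto simp: partial_character_def subgroup_self)
qed

lemma character_mult_closed:
  assumes "comm_group G" "\<theta> \<in> characters G" "\<phi> \<in> characters G"
  shows "(\<lambda>x\<in>carrier G. \<theta> x * \<phi> x) \<in> characters G" "(\<lambda>x\<in>carrier G. cnj (\<theta> x)) \<in> characters G"
proof -
  interpret comm_group G by fact
  show "(\<lambda>x\<in>carrier G. \<theta> x * \<phi> x) \<in> characters G"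
    by (rule characters_memI[OF assms(1)])
      (use characters_D[OF assms(2)] characters_D[OF assms(3)] in \<open>auto simp: partial_character_def subgroup_self norm_mult\<close>)
  show "(\<lambda>x\<in>carrier G. cnj (\<theta> x)) \<in> characters G"
    by (rule characters_memI[OF assms(1)])
      (use characters_D[OF assms(2)] in \<open>auto simp: partial_character_def subgroup_self\<close>)
qed

text \<open>Multiplication by a character \<open>\<phi>\<close> with
  \<open>\<phi> a \<noteq> 1\<close> permutes the characters and scales the sum by
  \<open>\<phi> a\<close>.\<close>

lemma sum_over_characters_eq_0:
  assumes "comm_group G" "finite (carrier G)" "a \<in> carrier G" "a \<noteq> \<one>\<^bsub>G\<^esub>"
  shows "(\<Sum>\<theta>\<in>characters G. \<theta> a) = 0"
proof -
  interpret comm_group G by fact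
  obtain \<phi> where phi: "\<phi> \<in> characters G" "\<phi> a \<noteq> 1" using characters_separate[OF assms] by blast
  define F where "F \<theta> = (\<lambda>x\<in>carrier G. \<phi> x * \<theta> x)" for \<theta> :: "'a \<Rightarrow> complex"
  have inj: "inj_on F (characters G)"
  proof (rule inj_onI)
    fix \<theta> \<psi> assume a: "\<theta> \<in> characters G" "\<psi> \<in> characters G" "F \<theta> = F \<psi>"
    have "\<theta> x = \<psi> x" if "x \<in> carrier G" for x
      using fun_cong[OF a(3), of x] that characters_D(1)[OF phi(1) that] by (auto simp: F_def)
    moreover have "\<theta> \<in> extensional (carrier G)" "\<psi> \<in> extensional (carrier G)" using a by (auto simp: characters_def)
    ultimately show "\<theta> = \<psi>" by (meson extensionalityI)
  qed
  have "F ` characters G \<subseteq> characters G" using character_mult_closed(1)[OF assms(1) phi(1)] by (auto simp: F_def)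
  then have bij: "bij_betw F (characters G) (characters G)"
    using inj finite_characters[OF assms(1,2)] by (simp add: bij_betw_def endo_inj_surj)
  have "(\<Sum>\<theta>\<in>characters G. \<theta> a) = (\<Sum>\<theta>\<in>characters G. F \<theta> a)"
    using sum.reindex_bij_betw[OF bij, of "\<lambda>\<theta>. \<theta> a"] by simp
  also have "\<dots> = \<phi> a * (\<Sum>\<theta>\<in>characters G. \<theta> a)" using assms(3) by (simp add: F_def sum_distrib_left)
  finally show ?thesis using phi(2) by (metis mult_cancel_right1)
qed

lemma sum_character_eq_0:
  assumes "comm_group G" "finite (carrier G)" "\<theta> \<in> characters G" "a \<in> carrier G" "\<theta> a \<noteq> 1"
  shows "(\<Sum>x\<in>carrier G. \<theta> x) = 0"
proof -
  interpret comm_group G by fact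
  have bij: "bij_betw (\<lambda>x. a \<otimes>\<^bsub>G\<^esub> x) (carrier G) (carrier G)"
    by (rule bij_betwI[of _ _ _ "\<lambda>x. inv\<^bsub>G\<^esub> a \<otimes>\<^bsub>G\<^esub> x"]) (use assms(4) in \<open>auto simp: m_assoc[symmetric]\<close>)
  have "(\<Sum>x\<in>carrier G. \<theta> x) = (\<Sum>x\<in>carrier G. \<theta> (a \<otimes>\<^bsub>G\<^esub> x))"
    using sum.reindex_bij_betw[OF bij, of \<theta>] by simp
  also have "\<dots> = \<theta> a * (\<Sum>x\<in>carrier G. \<theta> x)" using assms(4) characters_D(2)[OF assms(3)] by (simp add: sum_distrib_left)
  finally show ?thesis using assms(5) by (metis mult_cancel_right1)
qed

text \<open>The double sum of \<open>\<theta> x\<close> is evaluated in both orders. Each time a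
  single inner sum survives, that of the identity or that of the trivial character.\<close>

lemma card_characters:
  assumes "comm_group G" "finite (carrier G)"
  shows "card (characters G) = card (carrier G)"
proof -
  interpret comm_group G by fact
  let ?S = "\<Sum>x\<in>carrier G. \<Sum>\<theta>\<in>characters G. \<theta> x"
  have "?S = (\<Sum>x\<in>carrier G. if x = \<one>\<^bsub>G\<^esub> then of_nat (card (characters G)) else 0)"
    by (rule sum.cong) (auto simp: sum_over_characters_eq_0[OF assms] character_one[OF assms(1)])
  also have "\<dots> = of_nat (card (characters G))" using assms(2) by (subst sum.delta) auto
  finally have 1: "?S = of_nat (card (characters G))" .
  let ?e = "(\<lambda>_\<in>carrier G. 1) :: 'a \<Rightarrow> complex"
  have "?S = (\<Sum>\<theta>\<in>characters G. \<Sum>x\<in>carrier G. \<theta> x)" by (rule sum.swap)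
  also have "\<dots> = (\<Sum>\<theta>\<in>characters G. if \<theta> = ?e then of_nat (card (carrier G)) else 0)"
  proof (rule sum.cong[OF refl])
    fix \<theta> assume chi: "\<theta> \<in> characters G"
    show "(\<Sum>x\<in>carrier G. \<theta> x) = (if \<theta> = ?e then of_nat (card (carrier G)) else 0)"
    proof (cases "\<theta> = ?e")
      case False
      have "\<exists>a\<in>carrier G. \<theta> a \<noteq> 1"
      proof (rule ccontr)
        assume "\<not> ?thesis"
        then have "\<And>x. x \<in> carrier G \<Longrightarrow> \<theta> x = ?e x" by auto
        moreover have "\<theta> \<in> extensional (carrier G)" using chi by (auto simp: characters_def)
        ultimately have "\<theta> = ?e" by (meson extensionalityI restrict_extensional)
        then show False using False by blast
      qed
      then show ?thesis using sum_character_eq_0[OF assms chi] False by auto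
    qed auto
  qed
  also have "\<dots> = of_nat (card (carrier G))"
    using finite_characters[OF assms] restrict_one_character[OF assms(1)] by (subst sum.delta) auto
  finally show ?thesis using 1 by (metis of_nat_eq_iff)
qed

section \<open>Fourier coefficients on a finite abelian group\<close>

definition char_coeff :: "('a, 'b) monoid_scheme \<Rightarrow> ('a \<Rightarrow> complex) \<Rightarrow> ('a \<Rightarrow> complex) \<Rightarrow> complex" where
  "char_coeff G f \<theta> = (\<Sum>x\<in>carrier G. cnj (\<theta> x) * f x) / of_nat (card (carrier G))"

lemma sum_characters_diff:
  assumes "comm_group G" "finite (carrier G)" "x \<in> carrier G" "y \<in> carrier G"
  shows "(\<Sum>\<theta>\<in>characters G. \<theta> x * cnj (\<theta> y)) = (if x = y then of_nat (card (carrier G)) else 0)"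
proof -
  interpret comm_group G by fact
  have "(\<Sum>\<theta>\<in>characters G. \<theta> x * cnj (\<theta> y)) = (\<Sum>\<theta>\<in>characters G. \<theta> (x \<otimes>\<^bsub>G\<^esub> inv\<^bsub>G\<^esub> y))"
    using assms(3,4) by (intro sum.cong refl) (simp add: characters_D(2) character_inv[OF assms(1)])
  moreover have "x \<otimes>\<^bsub>G\<^esub> inv\<^bsub>G\<^esub> y = \<one>\<^bsub>G\<^esub> \<longleftrightarrow> x = y"
    using assms(3,4) by (metis inv_closed inv_equality inv_inv r_inv)
  ultimately show ?thesis
    using sum_over_characters_eq_0[OF assms(1,2), of "x \<otimes>\<^bsub>G\<^esub> inv\<^bsub>G\<^esub> y"] assms(3,4) card_characters[OF assms(1,2)]
    by (auto simp: character_one[OF assms(1)])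
qed

text \<open>Fourier inversion at the identity. For the trace of a representation it says that the
  multiplicities add up to the dimension.\<close>

lemma sum_char_coeff:
  assumes "comm_group G" "finite (carrier G)"
  shows "(\<Sum>\<theta>\<in>characters G. char_coeff G f \<theta>) = f \<one>\<^bsub>G\<^esub>"
proof -
  interpret comm_group G by fact
  let ?c = "of_nat (card (carrier G)) :: complex"
  have c0: "?c \<noteq> 0" using assms(2) by auto
  have "(\<Sum>\<theta>\<in>characters G. char_coeff G f \<theta>) = (\<Sum>\<theta>\<in>characters G. \<Sum>x\<in>carrier G. f x * (\<theta> \<one>\<^bsub>G\<^esub> * cnj (\<theta> x))) / ?c"
    unfolding char_coeff_def sum_divide_distrib[symmetric]
    by (intro arg_cong2[of _ _ _ _ "(/)"] sum.cong refl) (simp add: character_one[OF assms(1)] mult_ac)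
  also have "(\<Sum>\<theta>\<in>characters G. \<Sum>x\<in>carrier G. f x * (\<theta> \<one>\<^bsub>G\<^esub> * cnj (\<theta> x)))
      = (\<Sum>x\<in>carrier G. f x * (\<Sum>\<theta>\<in>characters G. \<theta> \<one>\<^bsub>G\<^esub> * cnj (\<theta> x)))"
    by (subst sum.swap) (simp add: sum_distrib_left)
  also have "\<dots> = (\<Sum>x\<in>carrier G. if x = \<one>\<^bsub>G\<^esub> then f x * ?c else 0)"
    by (intro sum.cong refl) (simp add: sum_characters_diff[OF assms])
  also have "\<dots> = f \<one>\<^bsub>G\<^esub> * ?c" using assms(2) by (subst sum.delta) auto
  finally show ?thesis using c0 by simp
qed

text \<open>For the trace of a representation the left side is the sum of the squared
  multiplicities, so mean square bounds on traces control how far multiplicities can exceed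
  1.\<close>

lemma parseval_char_coeff:
  assumes "comm_group G" "finite (carrier G)"
  shows "(\<Sum>\<theta>\<in>characters G. (cmod (char_coeff G f \<theta>))\<^sup>2) = (\<Sum>x\<in>carrier G. (cmod (f x))\<^sup>2) / card (carrier G)"
proof -
  interpret comm_group G by fact
  let ?c = "of_nat (card (carrier G)) :: complex"
  have c0: "?c \<noteq> 0" using assms(2) by auto
  have "(\<Sum>\<theta>\<in>characters G. char_coeff G f \<theta> * cnj (char_coeff G f \<theta>))
    = (\<Sum>\<theta>\<in>characters G. (\<Sum>x\<in>carrier G. \<Sum>y\<in>carrier G. f x * cnj (f y) * (\<theta> y * cnj (\<theta> x))) / ?c\<^sup>2)"
  proof (rule sum.cong[OF refl])
    fix \<theta>
    have "char_coeff G f \<theta> * cnj (char_coeff G f \<theta>)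
      = (\<Sum>x\<in>carrier G. cnj (\<theta> x) * f x) * (\<Sum>y\<in>carrier G. \<theta> y * cnj (f y)) / ?c\<^sup>2"
      by (simp add: char_coeff_def power2_eq_square)
    also have "(\<Sum>x\<in>carrier G. cnj (\<theta> x) * f x) * (\<Sum>y\<in>carrier G. \<theta> y * cnj (f y))
      = (\<Sum>x\<in>carrier G. \<Sum>y\<in>carrier G. f x * cnj (f y) * (\<theta> y * cnj (\<theta> x)))"
      unfolding sum_product by (intro sum.cong refl) (simp add: mult_ac)
    finally show "char_coeff G f \<theta> * cnj (char_coeff G f \<theta>)
      = (\<Sum>x\<in>carrier G. (\<Sum>y\<in>carrier G. f x * cnj (f y) * (\<theta> y * cnj (\<theta> x)))) / ?c\<^sup>2" .
  qed
  also have "\<dots> = (\<Sum>\<theta>\<in>characters G. \<Sum>x\<in>carrier G. \<Sum>y\<in>carrier G. f x * cnj (f y) * (\<theta> y * cnj (\<theta> x))) / ?c\<^sup>2"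
    by (rule sum_divide_distrib[symmetric])
  also have "(\<Sum>\<theta>\<in>characters G. \<Sum>x\<in>carrier G. \<Sum>y\<in>carrier G. f x * cnj (f y) * (\<theta> y * cnj (\<theta> x)))
    = (\<Sum>x\<in>carrier G. \<Sum>\<theta>\<in>characters G. \<Sum>y\<in>carrier G. f x * cnj (f y) * (\<theta> y * cnj (\<theta> x)))"
    by (rule sum.swap)
  also have "\<dots> = (\<Sum>x\<in>carrier G. \<Sum>y\<in>carrier G. f x * cnj (f y) * (\<Sum>\<theta>\<in>characters G. \<theta> y * cnj (\<theta> x)))"
    by (intro sum.cong refl, subst sum.swap) (simp add: sum_distrib_left)
  also have "\<dots> = (\<Sum>x\<in>carrier G. \<Sum>y\<in>carrier G. if y = x then f x * cnj (f y) * ?c else 0)"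
    by (intro sum.cong refl) (simp add: sum_characters_diff[OF assms])
  also have "\<dots> = (\<Sum>x\<in>carrier G. f x * cnj (f x) * ?c)"
    using assms(2) by (intro sum.cong refl, subst sum.delta) auto
  also have "\<dots> / ?c\<^sup>2 = (\<Sum>x\<in>carrier G. f x * cnj (f x)) / ?c"
    using c0 by (simp add: sum_distrib_right[symmetric] power2_eq_square)
  finally have "(\<Sum>\<theta>\<in>characters G. complex_of_real ((cmod (char_coeff G f \<theta>))\<^sup>2)) = (\<Sum>x\<in>carrier G. of_real ((cmod (f x))\<^sup>2)) / ?c"
    by (simp only: complex_norm_square)
  then have "complex_of_real (\<Sum>\<theta>\<in>characters G. (cmod (char_coeff G f \<theta>))\<^sup>2) = of_real ((\<Sum>x\<in>carrier G. (cmod (f x))\<^sup>2) / card (carrier G))"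
    by simp
  then show ?thesis by (simp only: of_real_eq_iff)
qed

text \<open>A function that is multiplicative off a thin subgroup \<open>H\<close> is extended by
  \<open>\<eta> \<mapsto> h (\<eta> \<otimes> \<delta>) / h \<delta>\<close>, where \<open>\<delta>\<close> is
  any element with \<open>\<delta>\<close> and \<open>\<eta> \<otimes> \<delta>\<close> outside \<open>H\<close>.\<close>

lemma character_of_almost_multiplicative:
  assumes "comm_group G" "finite (carrier G)" "subgroup H G" "4 * card H < card (carrier G)"
    and nrm: "\<And>x. x \<in> carrier G \<Longrightarrow> x \<notin> H \<Longrightarrow> cmod (h x) = 1"
    and mult: "\<And>x y. x \<in> carrier G \<Longrightarrow> x \<notin> H \<Longrightarrow> y \<in> carrier G \<Longrightarrow> y \<notin> H \<Longrightarrow> x \<otimes>\<^bsub>G\<^esub> y \<notin> H \<Longrightarrow>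
      h (x \<otimes>\<^bsub>G\<^esub> y) = h x * h y"
  shows "\<exists>\<theta>\<in>characters G. \<forall>x\<in>carrier G. x \<notin> H \<longrightarrow> \<theta> x = h x"
proof -
  interpret comm_group G by fact
  have HG: "H \<subseteq> carrier G" using assms(3) by (simp add: subgroup.subset)
  have nz: "\<And>x. x \<in> carrier G \<Longrightarrow> x \<notin> H \<Longrightarrow> h x \<noteq> 0" using nrm by force
  have finH: "finite H" using HG assms(2) finite_subset by blast
  \<comment> \<open>Each condition excludes one translate of \<open>H\<close>, so four of them can
    be met together if \<open>4 * card H\<close> is less than the order of the group. All four are
    used in \<open>indep\<close>.\<close>
  have avoid: "\<exists>d\<in>carrier G. a1 \<otimes>\<^bsub>G\<^esub> d \<notin> H \<and> a2 \<otimes>\<^bsub>G\<^esub> d \<notin> H \<and> a3 \<otimes>\<^bsub>G\<^esub> d \<notin> H \<and> a4 \<otimes>\<^bsub>G\<^esub> d \<notin> H"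
    if a: "a1 \<in> carrier G" "a2 \<in> carrier G" "a3 \<in> carrier G" "a4 \<in> carrier G" for a1 a2 a3 a4
  proof (rule ccontr)
    assume none: "\<not> ?thesis"
    let ?B = "\<lambda>a. (\<lambda>y. inv\<^bsub>G\<^esub> a \<otimes>\<^bsub>G\<^esub> y) ` H"
    have m: "d \<in> ?B a" if "d \<in> carrier G" "a \<in> carrier G" "a \<otimes>\<^bsub>G\<^esub> d \<in> H" for a d
    proof -
      have "d = inv\<^bsub>G\<^esub> a \<otimes>\<^bsub>G\<^esub> (a \<otimes>\<^bsub>G\<^esub> d)" using that by (simp add: m_assoc[symmetric])
      then show ?thesis using that(3) by blast
    qed
    have "carrier G \<subseteq> ?B a1 \<union> ?B a2 \<union> ?B a3 \<union> ?B a4"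
      using none m a by blast
    then have "card (carrier G) \<le> card (?B a1 \<union> ?B a2 \<union> ?B a3 \<union> ?B a4)"
      using finH by (intro card_mono) auto
    also have "\<dots> \<le> card (?B a1) + card (?B a2) + card (?B a3) + card (?B a4)"
      by (meson add_le_cancel_right card_Un_le le_trans)
    also have "\<dots> \<le> 4 * card H"
      using card_image_le[OF finH, of "\<lambda>y. inv\<^bsub>G\<^esub> a1 \<otimes>\<^bsub>G\<^esub> y"] card_image_le[OF finH, of "\<lambda>y. inv\<^bsub>G\<^esub> a2 \<otimes>\<^bsub>G\<^esub> y"]
        card_image_le[OF finH, of "\<lambda>y. inv\<^bsub>G\<^esub> a3 \<otimes>\<^bsub>G\<^esub> y"] card_image_le[OF finH, of "\<lambda>y. inv\<^bsub>G\<^esub> a4 \<otimes>\<^bsub>G\<^esub> y"] by linarith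
    finally show False using assms(4) by linarith
  qed
  define good where "good \<eta> d \<longleftrightarrow> d \<in> carrier G \<and> d \<notin> H \<and> \<eta> \<otimes>\<^bsub>G\<^esub> d \<notin> H" for \<eta> d
  have indep: "h (\<eta> \<otimes>\<^bsub>G\<^esub> b) / h b = h (\<eta> \<otimes>\<^bsub>G\<^esub> c) / h c"
    if eta: "\<eta> \<in> carrier G" and b: "good \<eta> b" and c: "good \<eta> c" for \<eta> b c
  proof -
    have bG: "b \<in> carrier G" and cG: "c \<in> carrier G" using b c by (auto simp: good_def)
    have ib: "inv\<^bsub>G\<^esub> b \<in> carrier G" and ic: "inv\<^bsub>G\<^esub> c \<in> carrier G" using bG cG by auto
    \<comment> \<open>Both \<open>b\<close> and \<open>c\<close> are compared with a third element
      \<open>d\<close>: replacing \<open>x\<close> by \<open>d\<close> multiplies numerator and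
      denominator by the same value of \<open>h\<close> at the quotient of \<open>d\<close> by
      \<open>x\<close>.\<close>
    obtain d where d: "d \<in> carrier G" "d \<notin> H" "\<eta> \<otimes>\<^bsub>G\<^esub> d \<notin> H" "inv\<^bsub>G\<^esub> b \<otimes>\<^bsub>G\<^esub> d \<notin> H" "inv\<^bsub>G\<^esub> c \<otimes>\<^bsub>G\<^esub> d \<notin> H"
      using avoid[OF one_closed eta ib ic] by auto
    have *: "h (\<eta> \<otimes>\<^bsub>G\<^esub> x) / h x = h (\<eta> \<otimes>\<^bsub>G\<^esub> d) / h d"
      if x: "good \<eta> x" "inv\<^bsub>G\<^esub> x \<otimes>\<^bsub>G\<^esub> d \<notin> H" for x
    proof -
      have xG: "x \<in> carrier G" "x \<notin> H" "\<eta> \<otimes>\<^bsub>G\<^esub> x \<notin> H" using x by (auto simp: good_def)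
      let ?y = "inv\<^bsub>G\<^esub> x \<otimes>\<^bsub>G\<^esub> d"
      have e1: "x \<otimes>\<^bsub>G\<^esub> ?y = d" using xG d(1) by (simp add: m_assoc[symmetric])
      have e2: "\<eta> \<otimes>\<^bsub>G\<^esub> x \<otimes>\<^bsub>G\<^esub> ?y = \<eta> \<otimes>\<^bsub>G\<^esub> d" using xG d(1) eta e1 by (simp add: m_assoc)
      have "h d = h x * h ?y" using mult[of x ?y] xG d x(2) e1 by simp
      moreover have "h (\<eta> \<otimes>\<^bsub>G\<^esub> d) = h (\<eta> \<otimes>\<^bsub>G\<^esub> x) * h ?y"
        using mult[of "\<eta> \<otimes>\<^bsub>G\<^esub> x" ?y] xG d x(2) e2 eta by simp
      moreover have "h ?y \<noteq> 0" using nz[of ?y] xG d x(2) by simp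
      ultimately show ?thesis by simp
    qed
    show ?thesis using *[OF b d(4)] *[OF c d(5)] by simp
  qed
  have ex: "\<exists>d. good \<eta> d" if "\<eta> \<in> carrier G" for \<eta>
    using avoid[OF one_closed that one_closed one_closed] by (auto simp: good_def)
  define \<theta> where "\<theta> \<eta> = h (\<eta> \<otimes>\<^bsub>G\<^esub> (SOME d. good \<eta> d)) / h (SOME d. good \<eta> d)" for \<eta>
  have chi: "\<theta> \<eta> = h (\<eta> \<otimes>\<^bsub>G\<^esub> d) / h d" if "\<eta> \<in> carrier G" "good \<eta> d" for \<eta> d
    unfolding \<theta>_def by (rule indep[OF that(1) _ that(2)]) (rule someI_ex[OF ex[OF that(1)]])
  have "partial_character G (carrier G) \<theta>"
    unfolding partial_character_def
  proof (intro conjI ballI subgroup_self)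
    show "cmod (\<theta> x) = 1" if "x \<in> carrier G" for x
      using ex[OF that] chi[OF that] nrm that by (auto simp: good_def norm_divide)
    show "\<theta> (x \<otimes>\<^bsub>G\<^esub> y) = \<theta> x * \<theta> y" if x: "x \<in> carrier G" and y: "y \<in> carrier G" for x y
    proof -
      obtain d where d: "d \<in> carrier G" "d \<notin> H" "y \<otimes>\<^bsub>G\<^esub> d \<notin> H" "x \<otimes>\<^bsub>G\<^esub> y \<otimes>\<^bsub>G\<^esub> d \<notin> H"
        using avoid[OF one_closed y m_closed[OF x y] one_closed] by auto
      have "\<theta> (x \<otimes>\<^bsub>G\<^esub> y) = h (x \<otimes>\<^bsub>G\<^esub> y \<otimes>\<^bsub>G\<^esub> d) / h d" using chi[of "x \<otimes>\<^bsub>G\<^esub> y" d] x y d by (auto simp: good_def)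
      moreover have "\<theta> x = h (x \<otimes>\<^bsub>G\<^esub> y \<otimes>\<^bsub>G\<^esub> d) / h (y \<otimes>\<^bsub>G\<^esub> d)"
        using chi[of x "y \<otimes>\<^bsub>G\<^esub> d"] x y d by (auto simp: good_def m_assoc)
      moreover have "\<theta> y = h (y \<otimes>\<^bsub>G\<^esub> d) / h d" using chi[of y d] x y d by (auto simp: good_def)
      ultimately show ?thesis using nz[of "y \<otimes>\<^bsub>G\<^esub> d"] y d by simp
    qed
  qed
  then have "restrict \<theta> (carrier G) \<in> characters G" by (rule characters_memI[OF assms(1)])
  moreover have "\<theta> x = h x" if x: "x \<in> carrier G" "x \<notin> H" for x
  proof -
    obtain d where d: "good x d" using ex[OF x(1)] by blast
    then have "h (x \<otimes>\<^bsub>G\<^esub> d) = h x * h d" "h d \<noteq> 0" using mult[of x d] x nz[of d] by (auto simp: good_def)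
    then show ?thesis using chi[OF x(1) d] by simp
  qed
  ultimately show ?thesis by (intro bexI[of _ "restrict \<theta> (carrier G)"]) auto
qed

section \<open>Additive characters\<close>

lemma e_fun_cis: "e_fun x = cis (2 * pi * x)"
  by (simp add: e_fun_def cis_conv_exp mult_ac)

lemma e_mod_0 [simp]: "e_mod N 0 = 1"
  by (simp add: e_mod_def e_fun_cis)

lemma e_mod_add: "e_mod N (a + b) = e_mod N a * e_mod N b"
  by (simp add: e_mod_def e_fun_cis cis_mult add_divide_distrib ring_distribs)

lemma e_mod_norm [simp]: "cmod (e_mod N a) = 1"
  by (simp add: e_mod_def e_fun_cis)

lemma e_mod_minus: "e_mod N (- a) = cnj (e_mod N a)"
  by (simp add: e_mod_def e_fun_cis cis_cnj)

lemma e_mod_eq_1_iff: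
  assumes "N > 0"
  shows "e_mod N a = 1 \<longleftrightarrow> int N dvd a"
proof
  assume "e_mod N a = 1"
  then have "cos (2 * pi * (real_of_int a / real N)) = 1"
    by (simp add: e_mod_def e_fun_cis complex_eq_iff)
  then obtain i :: int where "2 * pi * (real_of_int a / real N) = of_int i * 2 * pi"
    using cos_one_2pi_int by blast
  then have "real_of_int a = of_int (i * int N)" using assms by (simp add: field_simps)
  then have "a = i * int N" by linarith
  then show "int N dvd a" by simp
next
  assume "int N dvd a"
  then obtain i where "a = int N * i" by blast
  then have "e_mod N a = cis (2 * pi * of_int i)" using assms by (simp add: e_mod_def e_fun_cis)
  then show "e_mod N a = 1" by (simp add: cis_multiple_2pi)
qed

lemma e_mod_cong:
  assumes "N > 0" "[a = b] (mod int N)"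
  shows "e_mod N a = e_mod N b"
proof -
  have "e_mod N (a - b) = 1"
    using assms by (simp add: e_mod_eq_1_iff cong_iff_dvd_diff)
  then show ?thesis by (metis e_mod_add diff_add_cancel mult_1)
qed

lemma e_mod_mult_right: "k > 0 \<Longrightarrow> e_mod (N * k) (a * int k) = e_mod N a"
  by (simp add: e_mod_def)

lemma e_mod_power: "e_mod N (a * int n) = e_mod N a ^ n"
  by (induction n) (simp_all add: e_mod_add ring_distribs)

lemma sum_int_nat: "(\<Sum>x\<in>{0..<int N}. F x) = (\<Sum>y<N. F (int y))"
  by (rule sum.reindex_bij_witness[of _ int nat]) auto

lemma sum_e_mod:
  assumes "N > 0"
  shows "(\<Sum>y\<in>{0..<int N}. e_mod N (a * y)) = (if int N dvd a then of_nat N else 0)"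
proof (cases "int N dvd a")
  case True
  then have "e_mod N (a * y) = 1" for y using assms by (simp add: e_mod_eq_1_iff)
  then show ?thesis using True by simp
next
  case False
  then have ne: "e_mod N a \<noteq> 1" using assms by (simp add: e_mod_eq_1_iff)
  have "(\<Sum>y\<in>{0..<int N}. e_mod N (a * y)) = (\<Sum>y<N. e_mod N a ^ y)"
    by (simp add: sum_int_nat e_mod_power)
  also have "\<dots> = (e_mod N a ^ N - 1) / (e_mod N a - 1)" using ne by (rule geometric_sum)
  also have "e_mod N a ^ N = 1" using assms by (simp add: e_mod_power[symmetric] e_mod_eq_1_iff)
  finally show ?thesis using False by simp
qed

text \<open>Reduced modulo \<open>N\<close>, the map \<open>\<phi>\<close> is an injective self-map
  of a finite set, hence a permutation. Translations and multiplications by units are both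
  instances.\<close>

lemma sum_periodic_reindex:
  fixes F :: "int \<Rightarrow> complex"
  assumes "N > 0" and F: "\<And>x y. [x = y] (mod int N) \<Longrightarrow> F x = F y"
    and inj: "\<And>x y. [\<phi> x = \<phi> y] (mod int N) \<Longrightarrow> [x = y] (mod int N)"
  shows "(\<Sum>x\<in>{0..<int N}. F (\<phi> x)) = (\<Sum>x\<in>{0..<int N}. F x)"
proof -
  let ?g = "\<lambda>x. \<phi> x mod int N"
  have "inj_on ?g {0..<int N}"
  proof (rule inj_onI)
    fix x y assume "x \<in> {0..<int N}" "y \<in> {0..<int N}" "?g x = ?g y"
    then show "x = y" using inj[of x y] by (auto simp: Cong.cong_def)
  qed
  moreover have "?g ` {0..<int N} \<subseteq> {0..<int N}" using assms(1) by auto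
  ultimately have "bij_betw ?g {0..<int N} {0..<int N}" by (simp add: bij_betw_def endo_inj_surj)
  from sum.reindex_bij_betw[OF this, of F] show ?thesis
    using F[of "\<phi> _ mod int N" "\<phi> _"] by (simp add: Cong.cong_def)
qed

section \<open>Quadratic Gauss sums\<close>

definition gauss_sum :: "nat \<Rightarrow> int \<Rightarrow> complex" where
  "gauss_sum N c = (\<Sum>x\<in>{0..<int N}. e_mod N (c * x\<^sup>2))"

lemma gauss_sum_cong:
  assumes "N > 0" "[c = d] (mod int N)"
  shows "gauss_sum N c = gauss_sum N d"
  unfolding gauss_sum_def using assms by (intro sum.cong refl e_mod_cong cong_mult) auto

lemma gauss_sum_mult_square:
  assumes "N > 0" "coprime d (int N)"
  shows "gauss_sum N (c * d\<^sup>2) = gauss_sum N c"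
proof -
  have "(\<Sum>x\<in>{0..<int N}. e_mod N (c * (d * x)\<^sup>2)) = (\<Sum>x\<in>{0..<int N}. e_mod N (c * x\<^sup>2))"
    using assms by (intro sum_periodic_reindex[where F = "\<lambda>x. e_mod N (c * x\<^sup>2)"])
      (auto intro!: e_mod_cong cong_mult cong_pow simp: cong_mult_lcancel)
  then show ?thesis by (simp add: gauss_sum_def power_mult_distrib mult_ac)
qed

lemma gauss_sum_minus: "gauss_sum N (- c) = cnj (gauss_sum N c)"
  by (simp add: gauss_sum_def e_mod_minus)

text \<open>Substituting \<open>x = z + y\<close> makes the phase linear in \<open>y\<close> with
  slope \<open>2 * c * z\<close>. As \<open>2 * c\<close> is a unit, the sum over \<open>y\<close>
  leaves only \<open>z = 0\<close>.\<close>

lemma gauss_sum_norm: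
  assumes "odd N" "coprime c (int N)"
  shows "gauss_sum N c * cnj (gauss_sum N c) = of_nat N"
proof -
  have N: "N > 0" using assms(1) by (cases N) auto
  have "gauss_sum N c * cnj (gauss_sum N c)
    = (\<Sum>y\<in>{0..<int N}. \<Sum>x\<in>{0..<int N}. e_mod N (c * x\<^sup>2 - c * y\<^sup>2))"
    unfolding gauss_sum_def cnj_sum sum_product
    by (subst sum.swap) (simp add: e_mod_minus[symmetric] e_mod_add[symmetric])
  also have "\<dots> = (\<Sum>y\<in>{0..<int N}. \<Sum>z\<in>{0..<int N}. e_mod N (c * (z + y)\<^sup>2 - c * y\<^sup>2))"
    using N by (intro sum.cong refl
        sum_periodic_reindex[where F = "\<lambda>x. e_mod N (c * x\<^sup>2 - c * _\<^sup>2)" and \<phi> = "\<lambda>z. z + _", symmetric])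
      (auto intro!: e_mod_cong cong_diff cong_mult cong_pow simp: cong_add_rcancel)
  also have "\<dots> = (\<Sum>y\<in>{0..<int N}. \<Sum>z\<in>{0..<int N}. e_mod N (c * z\<^sup>2) * e_mod N (2 * c * z * y))"
    by (intro sum.cong refl) (simp add: e_mod_add[symmetric] power2_eq_square algebra_simps)
  also have "\<dots> = (\<Sum>z\<in>{0..<int N}. e_mod N (c * z\<^sup>2) * (\<Sum>y\<in>{0..<int N}. e_mod N (2 * c * z * y)))"
    by (subst sum.swap) (simp add: sum_distrib_left)
  also have "\<dots> = (\<Sum>z\<in>{0..<int N}. if z = 0 then of_nat N else 0)"
  proof (rule sum.cong[OF refl])
    fix z assume z: "z \<in> {0..<int N}"
    have "coprime (2 * c) (int N)" using assms by simp
    then have "int N dvd 2 * c * z \<longleftrightarrow> int N dvd z"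
      by (metis coprime_commute coprime_dvd_mult_right_iff)
    also have "\<dots> \<longleftrightarrow> z = 0" using z zdvd_not_zless[of z "int N"] by (cases "z = 0") auto
    finally show "e_mod N (c * z\<^sup>2) * (\<Sum>y\<in>{0..<int N}. e_mod N (2 * c * z * y)) = (if z = 0 then of_nat N else 0)"
      using sum_e_mod[OF N, of "2 * c * z"] by simp
  qed
  also have "\<dots> = of_nat N" using N by (subst sum.delta) auto
  finally show ?thesis .
qed

lemma sum_int_split:
  fixes F :: "int \<Rightarrow> complex"
  assumes "M > 0"
  shows "(\<Sum>x\<in>{0..<int (M * q)}. F x) = (\<Sum>y\<in>{0..<int M}. \<Sum>z\<in>{0..<int q}. F (y + int M * z))"
proof -
  have "(\<Sum>y\<in>{0..<int M}. \<Sum>z\<in>{0..<int q}. F (y + int M * z))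
    = (\<Sum>(y, z)\<in>{0..<int M} \<times> {0..<int q}. F (y + int M * z))" by (rule sum.cartesian_product)
  also have "\<dots> = (\<Sum>x\<in>{0..<int (M * q)}. F x)"
  proof (rule sum.reindex_bij_witness[of _ "\<lambda>x. (x mod int M, x div int M)" "\<lambda>(y, z). y + int M * z"])
    fix x assume x: "x \<in> {0..<int (M * q)}"
    have "x div int M < int q"
    proof (rule ccontr)
      assume "\<not> ?thesis"
      then have "int q * int M \<le> x div int M * int M" using assms by (intro mult_right_mono) auto
      also have "\<dots> \<le> x" using assms div_mult_mod_eq[of x "int M"] pos_mod_sign[of "int M" x] by linarith
      finally show False using x by (simp add: mult.commute)
    qed
    then show "(x mod int M, x div int M) \<in> {0..<int M} \<times> {0..<int q}"
      using x assms by (auto simp: pos_imp_zdiv_nonneg_iff)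
  next
    fix a assume a: "a \<in> {0..<int M} \<times> {0..<int q}"
    then obtain y z where yz: "a = (y, z)" "0 \<le> y" "y < int M" "0 \<le> z" "z + 1 \<le> int q" by auto
    have "y + int M * z < int M * (z + 1)" using yz by (simp add: algebra_simps)
    also have "\<dots> \<le> int M * int q" using yz by (intro mult_left_mono) auto
    finally show "(case a of (y, z) \<Rightarrow> y + int M * z) \<in> {0..<int (M * q)}" using yz by auto
    show "((case a of (y, z) \<Rightarrow> y + int M * z) mod int M, (case a of (y, z) \<Rightarrow> y + int M * z) div int M) = a"
      using yz assms by simp
  qed (use assms in auto)
  finally show ?thesis by simp
qed

text \<open>Write x as y plus p^(k+1) z. The term quadratic in z vanishes modulo p^(k+2) because
  2(k+1) is at least k+2, and the sum over z of the linear term forces p to divide y. Putting y = p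
  w takes a factor p^2 out of both phase and modulus.\<close>

lemma gauss_sum_rec:
  assumes p: "Factorial_Ring.prime p" "odd p" and c: "\<not> int p dvd c"
  shows "gauss_sum (p ^ (k + 2)) c = of_nat p * gauss_sum (p ^ k) c"
proof -
  have p0: "p > 0" using p(1) prime_gt_0_nat by blast
  let ?N = "p ^ (k + 2)" and ?M = "p ^ (k + 1)"
  have NM: "?N = ?M * p" by simp
  have M0: "?M > 0" "?N > 0" using p0 by simp_all
  have dv: "int p dvd c * 2 * y \<longleftrightarrow> int p dvd y" for y
  proof -
    have pi: "Factorial_Ring.prime (int p)" using p(1) by simp
    have "\<not> int p dvd 2" using p by (metis even_of_nat prime_nat_int_transfer primes_dvd_imp_eq two_is_prime_nat int_dvd_int_iff of_nat_numeral even_numeral)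
    then show ?thesis using c pi by (simp add: prime_dvd_mult_iff)
  qed
  have "gauss_sum ?N c = (\<Sum>y\<in>{0..<int ?M}. \<Sum>z\<in>{0..<int p}. e_mod ?N (c * (y + int ?M * z)\<^sup>2))"
    unfolding gauss_sum_def NM using sum_int_split[OF M0(1), where q = p] by blast
  also have "\<dots> = (\<Sum>y\<in>{0..<int ?M}. \<Sum>z\<in>{0..<int p}. e_mod ?N (c * y\<^sup>2) * e_mod p (c * 2 * y * z))"
  proof (intro sum.cong refl)
    fix y z :: int
    have "int ?N dvd int ?M * int ?M"
    proof -
      have "p ^ (k + 2) dvd p ^ (2 * k + 2)" by (rule le_imp_power_dvd) simp
      also have "p ^ (2 * k + 2) = ?M * ?M" by (simp add: power_add[symmetric] mult_2)
      finally show ?thesis by (metis of_nat_dvd_iff of_nat_mult)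
    qed
    then have "int ?N dvd (int ?M * int ?M) * (c * z\<^sup>2)" by (rule dvd_mult2)
    moreover have "c * (y + int ?M * z)\<^sup>2 - (c * y\<^sup>2 + (c * 2 * y * z) * int ?M) = (int ?M * int ?M) * (c * z\<^sup>2)"
      by (simp add: power2_eq_square algebra_simps)
    ultimately have "[c * (y + int ?M * z)\<^sup>2 = c * y\<^sup>2 + (c * 2 * y * z) * int ?M] (mod int ?N)"
      by (metis cong_iff_dvd_diff)
    then have "e_mod ?N (c * (y + int ?M * z)\<^sup>2) = e_mod ?N (c * y\<^sup>2) * e_mod ?N ((c * 2 * y * z) * int ?M)"
      using e_mod_cong[OF M0(2)] e_mod_add by metis
    moreover have "e_mod ?N ((c * 2 * y * z) * int ?M) = e_mod p (c * 2 * y * z)"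
      using e_mod_mult_right[OF M0(1), of p "c * 2 * y * z"] by (simp add: mult.commute)
    ultimately show "e_mod ?N (c * (y + int ?M * z)\<^sup>2) = e_mod ?N (c * y\<^sup>2) * e_mod p (c * 2 * y * z)" by simp
  qed
  also have "\<dots> = (\<Sum>y\<in>{0..<int ?M}. if int p dvd y then e_mod ?N (c * y\<^sup>2) * of_nat p else 0)"
    by (intro sum.cong refl) (simp add: sum_distrib_left[symmetric] sum_e_mod[OF p0] dv)
  also have "\<dots> = (\<Sum>y\<in>{y\<in>{0..<int ?M}. int p dvd y}. e_mod ?N (c * y\<^sup>2) * of_nat p)"
    by (rule sum.inter_filter[symmetric]) simp
  also have "\<dots> = (\<Sum>w\<in>{0..<int (p ^ k)}. e_mod (p ^ k) (c * w\<^sup>2) * of_nat p)"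
  proof (rule sum.reindex_bij_witness[of _ "\<lambda>w. int p * w" "\<lambda>y. y div int p"])
    fix y assume y: "y \<in> {y\<in>{0..<int ?M}. int p dvd y}"
    then obtain w where w: "y = int p * w" by blast
    have e: "y div int p = w" using w p0 by simp
    show "int p * (y div int p) = y" using e w by simp
    show "y div int p \<in> {0..<int (p ^ k)}" using y w e p0 by (auto simp: zero_le_mult_iff)
    have "c * y\<^sup>2 = (c * w\<^sup>2) * int (p\<^sup>2)" by (simp add: w power2_eq_square)
    moreover have "e_mod (p ^ k * p\<^sup>2) ((c * w\<^sup>2) * int (p\<^sup>2)) = e_mod (p ^ k) (c * w\<^sup>2)"
      using p0 by (intro e_mod_mult_right) simp
    moreover have "?N = p ^ k * p\<^sup>2" by (rule power_add)
    ultimately show "e_mod (p ^ k) (c * (y div int p)\<^sup>2) * of_nat p = e_mod ?N (c * y\<^sup>2) * of_nat p"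
      by (simp only: e)
  next
    fix w assume "w \<in> {0..<int (p ^ k)}"
    then show "int p * w \<in> {y\<in>{0..<int ?M}. int p dvd y}" "int p * w div int p = w" using p0 by auto
  qed
  also have "\<dots> = of_nat p * gauss_sum (p ^ k) c" by (simp add: gauss_sum_def sum_distrib_left mult_ac)
  finally show ?thesis .
qed

text \<open>Multiplication by a unit \<open>a\<close> either preserves or interchanges the square
  classes of \<open>c\<close> and \<open>c * D\<close>, so the sum of the two Gauss sums is the same
  for all twists by \<open>a\<close>. Summed over all units it vanishes, because the Gauss sums over
  all residues add up to p, which is already the value at 0. Hence the two sums are
  opposite.\<close>

lemma gauss_sum_nonresidue:
  assumes p: "Factorial_Ring.prime p" "odd p" and c: "\<not> int p dvd c" and D: "\<not> int p dvd D" "\<not> QuadRes (int p) D"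
  shows "gauss_sum p (D * c) = - gauss_sum p c"
proof -
  have p0: "p > 0" using p(1) prime_gt_0_nat by blast
  have p2: "p > 2" using p prime_ge_2_nat[of p] by (metis even_numeral le_neq_implies_less)
  have pi: "Factorial_Ring.prime (int p)" using p(1) by simp
  have cop: "coprime a (int p) \<longleftrightarrow> \<not> int p dvd a" for a
    using pi by (metis coprime_commute prime_imp_coprime coprime_absorb_left not_prime_unit)
  have leg: "[Legendre a (int p) = a ^ ((p - 1) div 2)] (mod int p)" for a
    using euler_criterion[of p a] p(1) p2 by auto
  \<comment> \<open>The product of two nonresidues is a residue, by multiplicativity of Euler's
    criterion.\<close>
  have nres: "QuadRes (int p) (D * a)" if a: "\<not> int p dvd a" "\<not> QuadRes (int p) a" for a
  proof (rule ccontr)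
    assume n: "\<not> ?thesis"
    have da: "\<not> int p dvd D * a" using a(1) D(1) pi by (simp add: prime_dvd_mult_iff)
    have "Legendre D (int p) = -1" "Legendre a (int p) = -1" "Legendre (D * a) (int p) = -1"
      using a D n da by (auto simp: Legendre_def cong_0_iff)
    moreover have "[Legendre D (int p) * Legendre a (int p) = (D * a) ^ ((p - 1) div 2)] (mod int p)"
      using cong_mult[OF leg[of D] leg[of a]] by (simp only: power_mult_distrib)
    then have "[Legendre D (int p) * Legendre a (int p) = Legendre (D * a) (int p)] (mod int p)"
      using leg[of "D * a"] cong_sym cong_trans by blast
    ultimately have "[1 = -1] (mod int p)" by simp
    then have "int p dvd 2" by (simp add: cong_iff_dvd_diff)
    then show False using p2 by (auto dest: zdvd_imp_le)
  qed
  have sq: "gauss_sum p (b * a) = gauss_sum p b" if a: "\<not> int p dvd a" "QuadRes (int p) a" for a b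
  proof -
    obtain y where y: "[y\<^sup>2 = a] (mod int p)" using a(2) by (auto simp: QuadRes_def)
    then have "\<not> int p dvd y\<^sup>2" using a(1) cong_dvd_iff by blast
    then have "coprime y (int p)" by (metis cop dvd_mult power2_eq_square)
    then have "gauss_sum p (b * y\<^sup>2) = gauss_sum p b" by (rule gauss_sum_mult_square[OF p0])
    then show ?thesis using gauss_sum_cong[OF p0 cong_mult[OF cong_refl y], of b] by simp
  qed
  let ?I = "{0..<int p} - {0}"
  have nd: "\<not> int p dvd a" if "a \<in> ?I" for a using that by (auto dest: zdvd_imp_le)
  have pair: "gauss_sum p (c * a) + gauss_sum p (c * D * a) = gauss_sum p c + gauss_sum p (c * D)" if "a \<in> ?I" for a
  proof (cases "QuadRes (int p) a")
    case True
    then show ?thesis using sq[OF nd[OF that] True] by simp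
  next
    case False
    have Da: "QuadRes (int p) (D * a)" "\<not> int p dvd D * a"
      using nres[OF nd[OF that] False] nd[OF that] D(1) pi by (simp_all add: prime_dvd_mult_iff)
    have "gauss_sum p (c * a) = gauss_sum p (c * a * D\<^sup>2)"
      using gauss_sum_mult_square[OF p0] D(1) cop by metis
    also have "c * a * D\<^sup>2 = (c * D) * (D * a)" by (simp add: power2_eq_square)
    also have "gauss_sum p \<dots> = gauss_sum p (c * D)" using sq[OF Da(2,1)] .
    finally show ?thesis using sq[OF Da(2,1), of c] by (simp add: mult_ac)
  qed
  have tot: "(\<Sum>a\<in>?I. gauss_sum p (b * a)) = 0" if b: "\<not> int p dvd b" for b
  proof -
    have "(\<Sum>a\<in>?I. gauss_sum p (b * a)) = (\<Sum>a\<in>{0..<int p}. gauss_sum p (b * a)) - gauss_sum p 0"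
      using p0 by (subst sum_diff1) auto
    also have "(\<Sum>a\<in>{0..<int p}. gauss_sum p (b * a)) = (\<Sum>x\<in>{0..<int p}. \<Sum>a\<in>{0..<int p}. e_mod p (b * x\<^sup>2 * a))"
      unfolding gauss_sum_def by (subst sum.swap) (simp add: mult_ac)
    also have "\<dots> = (\<Sum>x\<in>{0..<int p}. if x = 0 then of_nat p else 0)"
    proof (rule sum.cong[OF refl])
      fix x assume x: "x \<in> {0..<int p}"
      have "int p dvd b * x\<^sup>2 \<longleftrightarrow> x = 0"
        using x b nd[of x] pi by (auto simp: prime_dvd_mult_iff power2_eq_square)
      then show "(\<Sum>a\<in>{0..<int p}. e_mod p (b * x\<^sup>2 * a)) = (if x = 0 then of_nat p else 0)"
        by (simp add: sum_e_mod[OF p0])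
    qed
    also have "\<dots> = of_nat p" using p0 by (subst sum.delta) auto
    finally show ?thesis by (simp add: gauss_sum_def)
  qed
  have cD: "\<not> int p dvd c * D" using c D(1) pi by (simp add: prime_dvd_mult_iff)
  have "0 = (\<Sum>a\<in>?I. gauss_sum p (c * a) + gauss_sum p (c * D * a))"
    using tot[OF c] tot[OF cD] by (simp add: sum.distrib)
  also have "\<dots> = (\<Sum>a\<in>?I. gauss_sum p c + gauss_sum p (c * D))" by (rule sum.cong[OF refl pair])
  also have "\<dots> = of_nat (card ?I) * (gauss_sum p c + gauss_sum p (c * D))" by simp
  finally have "gauss_sum p c + gauss_sum p (c * D) = 0" using p2 by (simp add: card_Diff_singleton)
  then show ?thesis by (simp add: mult.commute add_eq_0_iff)
qed

text \<open>The recursion lowers \<open>k\<close> by two on both sides, and the sign depends only on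
  the parity of \<open>k\<close>; the cases 0 and 1 start the induction.\<close>

lemma gauss_sum_mult_unit:
  assumes p: "Factorial_Ring.prime p" "odd p" and c: "\<not> int p dvd c" and D: "\<not> int p dvd D"
  shows "gauss_sum (p ^ k) (D * c) = of_int (Legendre D (int p) ^ k) * gauss_sum (p ^ k) c"
proof (induction k rule: less_induct)
  case (less k)
  have pi: "Factorial_Ring.prime (int p)" using p(1) by simp
  have p0: "p > 0" using p(1) prime_gt_0_nat by blast
  have cop: "coprime a (int p) \<longleftrightarrow> \<not> int p dvd a" for a
    using pi by (metis coprime_commute prime_imp_coprime coprime_absorb_left not_prime_unit)
  have L: "Legendre D (int p) = 1 \<or> Legendre D (int p) = -1" using D by (auto simp: Legendre_def cong_0_iff)
  consider "k = 0" | "k = 1" | j where "k = j + 2" by (metis One_nat_def add_2_eq_Suc' not0_implies_Suc)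
  then show ?case
  proof cases
    case 1
    have "e_mod 1 a = 1" for a by (simp add: e_mod_eq_1_iff)
    then show ?thesis using 1 by (simp add: gauss_sum_def)
  next
    case 2
    show ?thesis
    proof (cases "QuadRes (int p) D")
      case True
      then obtain y where y: "[y\<^sup>2 = D] (mod int p)" by (auto simp: QuadRes_def)
      then have "\<not> int p dvd y\<^sup>2" using D cong_dvd_iff by blast
      then have "coprime y (int p)" by (metis cop dvd_mult power2_eq_square)
      then have "gauss_sum p (c * y\<^sup>2) = gauss_sum p c" by (rule gauss_sum_mult_square[OF p0])
      then show ?thesis using gauss_sum_cong[OF p0 cong_mult[OF cong_refl y], of c] 2 True D
        by (simp add: Legendre_def cong_0_iff mult.commute)
    next
      case False
      then show ?thesis using 2 D gauss_sum_nonresidue[OF p c D False] by (simp add: Legendre_def cong_0_iff)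
    qed
  next
    case 3
    have cD: "\<not> int p dvd D * c" using c D pi by (simp add: prime_dvd_mult_iff)
    have e: "Legendre D (int p) ^ k = Legendre D (int p) ^ j" using L 3 by (auto simp: power_add)
    have "gauss_sum (p ^ k) (D * c) = of_nat p * (of_int (Legendre D (int p) ^ j) * gauss_sum (p ^ j) c)"
      using less.IH[of j] 3 gauss_sum_rec[OF p cD, of j] by simp
    moreover have "gauss_sum (p ^ k) c = of_nat p * gauss_sum (p ^ j) c" using 3 gauss_sum_rec[OF p c, of j] by simp
    ultimately show ?thesis unfolding e by simp
  qed
qed

section \<open>The Heisenberg group modulo \<open>N\<close>\<close>

text \<open>An integer representing 1/2 modulo odd \<open>N\<close>, so that half of the symplectic
  form makes sense in an exponent.\<close>

definition half :: "nat \<Rightarrow> int" where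
  "half N = (int N + 1) div 2"

lemma two_half: "odd N \<Longrightarrow> 2 * half N = int N + 1"
  by (elim oddE) (simp add: half_def)

lemma half_cong:
  assumes "odd N"
  shows "[2 * half N * a = a] (mod int N)"
proof -
  have "2 * half N * a = int N * a + a" by (simp only: two_half[OF assms] distrib_right mult_1)
  then show ?thesis by (simp add: cong_iff_dvd_diff)
qed

definition vcong :: "nat \<Rightarrow> int^2 \<Rightarrow> int^2 \<Rightarrow> bool" where
  "vcong N m n \<longleftrightarrow> (\<forall>i. [m $ i = n $ i] (mod int N))"

lemma vcong_refl [simp]: "vcong N m m"
  by (simp add: vcong_def)

lemma omega_cong: "vcong N a b \<Longrightarrow> vcong N c d \<Longrightarrow> [omega a c = omega b d] (mod int N)"
  by (simp add: omega_def vcong_def cong_diff cong_mult)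

text \<open>The sign in \<open>T_tilde\<close> turns the root of unity of order 2N in
  \<open>T_op\<close> into one of order dividing N. This is why \<open>T_tilde\<close> depends only
  on the frequency modulo \<open>N\<close>.\<close>

lemma e_mod_half:
  assumes "odd N"
  shows "(-1) powi a * e_mod (2 * N) a = e_mod N (half N * a)"
proof -
  have N: "N > 0" using assms by (cases N) auto
  have "e_mod N (half N * a) = e_mod (N * 2) (half N * a * int 2)"
    by (rule e_mod_mult_right[symmetric]) simp
  also have "half N * a * int 2 = (int N + 1) * a" using two_half[OF assms] by (simp add: algebra_simps)
  also have "e_mod (N * 2) ((int N + 1) * a) = e_mod (2 * N) (a * int N) * e_mod (2 * N) a"
    by (simp add: e_mod_add[symmetric] algebra_simps)
  also have "e_mod (2 * N) (a * int N) = e_mod 2 a" using e_mod_mult_right[OF N, of 2 a] by simp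
  also have "e_mod 2 a = (-1) powi a"
  proof (cases "even a")
    case True
    then show ?thesis using e_mod_eq_1_iff[of 2 a] by simp
  next
    case False
    then obtain b where b: "a = 1 + 2 * b" by (metis oddE add.commute)
    have "e_mod 2 a = e_mod 2 1 * e_mod 2 (2 * b)" by (simp add: b e_mod_add)
    also have "e_mod 2 (2 * b) = 1" by (simp add: e_mod_eq_1_iff)
    also have "e_mod 2 1 = -1" by (simp add: e_mod_def e_fun_cis)
    finally show ?thesis using False by simp
  qed
  finally show ?thesis by simp
qed

lemma T_tilde_carrier [simp]: "T_tilde N n \<in> carrier_mat N N"
  by (simp add: T_tilde_def T_op_def)

lemma T_tilde_dim [simp]: "dim_row (T_tilde N n) = N" "dim_col (T_tilde N n) = N"
  by (simp_all add: T_tilde_def T_op_def)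

lemma T_tilde_entry:
  assumes "odd N" "y < N" "z < N"
  shows "T_tilde N n $$ (y, z) =
    (if int z = (int y + n $ 1) mod int N then e_mod N (half N * (n $ 1 * n $ 2) + n $ 2 * int y) else 0)"
  using assms by (simp add: T_tilde_def T_op_def e_mod_add e_mod_half[symmetric])

lemma T_tilde_cong:
  assumes "odd N" "vcong N m n"
  shows "T_tilde N m = T_tilde N n"
proof (rule eq_matI)
  fix i j assume ij: "i < dim_row (T_tilde N n)" "j < dim_col (T_tilde N n)"
  have N: "N > 0" using assms by (cases N) auto
  have c: "[m $ 1 = n $ 1] (mod int N)" "[m $ 2 = n $ 2] (mod int N)" using assms(2) by (auto simp: vcong_def)
  have "(int i + m $ 1) mod int N = (int i + n $ 1) mod int N"
    using cong_add[OF cong_refl c(1)] by (simp add: Cong.cong_def)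
  moreover have "e_mod N (half N * (m $ 1 * m $ 2) + m $ 2 * int i) = e_mod N (half N * (n $ 1 * n $ 2) + n $ 2 * int i)"
    by (rule e_mod_cong[OF N]) (intro cong_add cong_mult cong_refl c)
  ultimately show "T_tilde N m $$ (i, j) = T_tilde N n $$ (i, j)"
    using ij assms(1) by (simp add: T_tilde_entry)
qed simp_all

lemma T_tilde_zero:
  assumes "odd N"
  shows "T_tilde N 0 = 1\<^sub>m N"
  by (rule eq_matI) (use assms in \<open>auto simp: T_tilde_entry\<close>)

text \<open>In this symmetric normalisation the cocycle is half the symplectic form, a quantity
  preserved by matrices of determinant 1.\<close>

lemma T_tilde_mult:
  assumes "odd N"
  shows "T_tilde N a * T_tilde N b = e_mod N (half N * omega a b) \<cdot>\<^sub>m T_tilde N (a + b)"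
proof (rule eq_matI)
  fix y z assume yz: "y < dim_row (e_mod N (half N * omega a b) \<cdot>\<^sub>m T_tilde N (a + b))"
    "z < dim_col (e_mod N (half N * omega a b) \<cdot>\<^sub>m T_tilde N (a + b))"
  then have y: "y < N" and z: "z < N" by simp_all
  have N: "N > 0" using assms by (cases N) auto
  let ?w = "nat ((int y + a $ 1) mod int N)"
  have w: "int ?w = (int y + a $ 1) mod int N" "?w < N" using N by (auto simp: nat_less_iff)
  have "(T_tilde N a * T_tilde N b) $$ (y, z) = (\<Sum>w<N. T_tilde N a $$ (y, w) * T_tilde N b $$ (w, z))"
    using y z by (simp add: scalar_prod_def atLeast0LessThan)
  also have "\<dots> = (\<Sum>w<N. if w = ?w then T_tilde N a $$ (y, w) * T_tilde N b $$ (w, z) else 0)"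
    using w y assms by (intro sum.cong refl) (auto simp: T_tilde_entry)
  also have "\<dots> = T_tilde N a $$ (y, ?w) * T_tilde N b $$ (?w, z)" using w by (subst sum.delta) auto
  also have "\<dots> = (if int z = (int y + (a + b) $ 1) mod int N
      then e_mod N (half N * (a $ 1 * a $ 2) + a $ 2 * int y) * e_mod N (half N * (b $ 1 * b $ 2) + b $ 2 * int ?w) else 0)"
    using w y z assms by (simp add: T_tilde_entry mod_add_left_eq add.assoc)
  also have "e_mod N (half N * (a $ 1 * a $ 2) + a $ 2 * int y) * e_mod N (half N * (b $ 1 * b $ 2) + b $ 2 * int ?w)
    = e_mod N (half N * omega a b) * e_mod N (half N * ((a + b) $ 1 * (a + b) $ 2) + (a + b) $ 2 * int y)"
    unfolding e_mod_add[symmetric]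
  proof (rule e_mod_cong[OF N])
    have "[int ?w = int y + a $ 1] (mod int N)" unfolding w(1) by (simp add: Cong.cong_def)
    then have 1: "[half N * (a $ 1 * a $ 2) + a $ 2 * int y + (half N * (b $ 1 * b $ 2) + b $ 2 * int ?w)
      = half N * (a $ 1 * a $ 2) + a $ 2 * int y + (half N * (b $ 1 * b $ 2) + b $ 2 * (int y + a $ 1))] (mod int N)"
      by (intro cong_add cong_mult cong_refl)
    have 2: "[half N * (a $ 1 * a $ 2) + a $ 2 * int y + (half N * (b $ 1 * b $ 2) + b $ 2 * int y) + a $ 1 * b $ 2
      = half N * (a $ 1 * a $ 2) + a $ 2 * int y + (half N * (b $ 1 * b $ 2) + b $ 2 * int y) + 2 * half N * (a $ 1 * b $ 2)] (mod int N)"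
      by (intro cong_add cong_refl cong_sym[OF half_cong[OF assms]])
    show "[half N * (a $ 1 * a $ 2) + a $ 2 * int y + (half N * (b $ 1 * b $ 2) + b $ 2 * int ?w)
      = half N * omega a b + (half N * ((a + b) $ 1 * (a + b) $ 2) + (a + b) $ 2 * int y)] (mod int N)"
      using cong_trans[OF 1] 2 by (simp add: omega_def algebra_simps)
  qed
  also have "(if int z = (int y + (a + b) $ 1) mod int N
      then e_mod N (half N * omega a b) * e_mod N (half N * ((a + b) $ 1 * (a + b) $ 2) + (a + b) $ 2 * int y) else 0)
    = (e_mod N (half N * omega a b) \<cdot>\<^sub>m T_tilde N (a + b)) $$ (y, z)"
    using y z assms by (simp add: T_tilde_entry)
  finally show "(T_tilde N a * T_tilde N b) $$ (y, z) = (e_mod N (half N * omega a b) \<cdot>\<^sub>m T_tilde N (a + b)) $$ (y, z)" .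
qed simp_all

section \<open>Traces of Heisenberg operators\<close>

definition mtr :: "complex Matrix.mat \<Rightarrow> complex" where
  "mtr M = (\<Sum>i<dim_row M. M $$ (i, i))"

lemma mtr_smult [simp]: "M \<in> carrier_mat n n \<Longrightarrow> mtr (c \<cdot>\<^sub>m M) = c * mtr M"
  by (simp add: mtr_def sum_distrib_left)

lemma mtr_mult:
  assumes "M \<in> carrier_mat n n" "K \<in> carrier_mat n n"
  shows "mtr (M * K) = (\<Sum>i<n. \<Sum>j<n. M $$ (i, j) * K $$ (j, i))"
  using assms by (auto simp: mtr_def scalar_prod_def atLeast0LessThan intro!: sum.cong)

lemma mtr_commute:
  assumes "M \<in> carrier_mat n n" "K \<in> carrier_mat n n"
  shows "mtr (M * K) = mtr (K * M)"
  unfolding mtr_mult[OF assms] mtr_mult[OF assms(2,1)] by (subst sum.swap) (simp add: mult.commute)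

lemma mtr_one: "mtr (1\<^sub>m n) = of_nat n"
  by (simp add: mtr_def)

lemma mtr_T_tilde:
  assumes "odd N"
  shows "mtr (T_tilde N n) = (if vcong N n 0 then of_nat N else 0)"
proof (cases "vcong N n 0")
  case True
  then show ?thesis using T_tilde_cong[OF assms True] T_tilde_zero[OF assms] mtr_one by simp
next
  case False
  have N: "N > 0" using assms by (cases N) auto
  show ?thesis
  proof (cases "int N dvd n $ 1")
    case True
    then have n2: "\<not> int N dvd n $ 2" using False by (auto simp: vcong_def cong_0_iff forall_2)
    have "int i = (int i + n $ 1) mod int N" if "i < N" for i
      using True that by (metis (no_types, opaque_lifting) add.right_neutral dvd_imp_mod_0 mod_add_right_eq mod_pos_pos_trivial of_nat_0_le_iff of_nat_less_iff)
    then have "mtr (T_tilde N n) = (\<Sum>i<N. e_mod N (half N * (n $ 1 * n $ 2)) * e_mod N (n $ 2 * int i))"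
      using assms by (auto simp: mtr_def T_tilde_entry e_mod_add intro!: sum.cong)
    also have "\<dots> = e_mod N (half N * (n $ 1 * n $ 2)) * (\<Sum>y\<in>{0..<int N}. e_mod N (n $ 2 * y))"
      by (simp add: sum_distrib_left[symmetric] sum_int_nat)
    finally show ?thesis using n2 sum_e_mod[OF N, of "n $ 2"] False by simp
  next
    case ndvd: False
    have "T_tilde N n $$ (i, i) = 0" if "i < N" for i
    proof -
      have "int i \<noteq> (int i + n $ 1) mod int N"
      proof
        assume "int i = (int i + n $ 1) mod int N"
        then have "[int i + n $ 1 = int i] (mod int N)" by (metis Cong.cong_def mod_mod_trivial)
        then have "[n $ 1 = 0] (mod int N)" by (simp add: cong_iff_dvd_diff)
        then show False using ndvd by (simp add: cong_0_iff)
      qed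
      then show ?thesis using that assms by (simp add: T_tilde_entry)
    qed
    then show ?thesis using False by (simp add: mtr_def)
  qed
qed

section \<open>Representatives of frequencies modulo N\<close>

definition lattice_box :: "nat \<Rightarrow> (int^2) set" where
  "lattice_box N = {m. \<forall>i. m $ i \<in> {0..<int N}}"

lemma vec2_eq [simp]: "(vector [m $ 1, m $ 2] :: int^2) = m"
  by (simp add: Finite_Cartesian_Product.vec_eq_iff forall_2)

lemma sum_box: "(\<Sum>m\<in>lattice_box N. F m) = (\<Sum>a\<in>{0..<int N}. \<Sum>b\<in>{0..<int N}. F (vector [a, b]))"
proof -
  have "(\<Sum>a\<in>{0..<int N}. \<Sum>b\<in>{0..<int N}. F (vector [a, b]))
    = (\<Sum>(a, b)\<in>{0..<int N} \<times> {0..<int N}. F (vector [a, b]))" by (rule sum.cartesian_product)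
  also have "\<dots> = (\<Sum>m\<in>lattice_box N. F m)"
    by (rule sum.reindex_bij_witness[of _ "\<lambda>m. (m $ 1, m $ 2)" "\<lambda>(a, b). vector [a, b]"])
      (auto simp: lattice_box_def forall_2)
  finally show ?thesis by simp
qed

lemma finite_box: "finite (lattice_box N)"
proof -
  have b: "bij_betw (\<lambda>(a, b). vector [a, b] :: int^2) ({0..<int N} \<times> {0..<int N}) (lattice_box N)"
    by (rule bij_betwI[of _ _ _ "\<lambda>m. (m $ 1, m $ 2)"]) (auto simp: lattice_box_def forall_2)
  show "finite (lattice_box N)" using bij_betw_finite[OF b] by simp
qed

definition vmod :: "nat \<Rightarrow> int^2 \<Rightarrow> int^2" where
  "vmod N m = (\<chi> i. m $ i mod int N)"

lemma vmod_box: "N > 0 \<Longrightarrow> vmod N m \<in> lattice_box N"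
  by (simp add: vmod_def lattice_box_def)

lemma vcong_vmod: "vcong N (vmod N m) m"
  by (simp add: vmod_def vcong_def)

lemma vcong_box_eq: "m \<in> lattice_box N \<Longrightarrow> n \<in> lattice_box N \<Longrightarrow> vcong N m n \<Longrightarrow> m = n"
  by (simp add: lattice_box_def vcong_def Cong.cong_def Finite_Cartesian_Product.vec_eq_iff)

lemma vcong_iff_vmod: "vcong N m n \<longleftrightarrow> vmod N m = vmod N n"
  by (simp add: vmod_def vcong_def Cong.cong_def Finite_Cartesian_Product.vec_eq_iff)

lemma sum_box_reindex:
  fixes F :: "int^2 \<Rightarrow> complex"
  assumes "N > 0" and F: "\<And>x y. vcong N x y \<Longrightarrow> F x = F y"
    and inj: "\<And>x y. vcong N (\<phi> x) (\<phi> y) \<Longrightarrow> vcong N x y"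
  shows "(\<Sum>x\<in>lattice_box N. F (\<phi> x)) = (\<Sum>x\<in>lattice_box N. F x)"
proof -
  let ?g = "\<lambda>x. vmod N (\<phi> x)"
  have "inj_on ?g (lattice_box N)"
  proof (rule inj_onI)
    fix x y assume "x \<in> lattice_box N" "y \<in> lattice_box N" "?g x = ?g y"
    then show "x = y" using inj[of x y] vcong_box_eq[of x N y] vcong_iff_vmod[of N "\<phi> x" "\<phi> y"] by blast
  qed
  moreover have "?g ` lattice_box N \<subseteq> lattice_box N" using assms(1) by (auto simp: vmod_box)
  ultimately have "bij_betw ?g (lattice_box N) (lattice_box N)" by (simp add: bij_betw_def endo_inj_surj finite_box)
  from sum.reindex_bij_betw[OF this, of F] show ?thesis
    using F[OF vcong_vmod] by simp
qed

lemma T_tilde_conj_entry: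
  assumes "odd N" "M \<in> carrier_mat N N" "y < N" "z < N"
  shows "(T_tilde N m * M * T_tilde N (- m)) $$ (y, z) =
    e_mod N (m $ 2 * (int y - int z)) * M $$ (nat ((int y + m $ 1) mod int N), nat ((int z + m $ 1) mod int N))"
proof -
  have N: "N > 0" using assms by (cases N) auto
  let ?y = "nat ((int y + m $ 1) mod int N)" and ?z = "nat ((int z + m $ 1) mod int N)"
  have w: "int ?y = (int y + m $ 1) mod int N" "?y < N" "int ?z = (int z + m $ 1) mod int N" "?z < N"
    using N by (auto simp: nat_less_iff)
  have TM: "(T_tilde N m * M) $$ (y, v) = T_tilde N m $$ (y, ?y) * M $$ (?y, v)" if v: "v < N" for v
  proof -
    have "(T_tilde N m * M) $$ (y, v) = (\<Sum>u<N. T_tilde N m $$ (y, u) * M $$ (u, v))"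
      using assms v by (simp add: scalar_prod_def atLeast0LessThan)
    also have "\<dots> = (\<Sum>u<N. if u = ?y then T_tilde N m $$ (y, u) * M $$ (u, v) else 0)"
      using w assms by (intro sum.cong refl) (auto simp: T_tilde_entry)
    also have "\<dots> = T_tilde N m $$ (y, ?y) * M $$ (?y, v)" using w by (subst sum.delta) auto
    finally show ?thesis .
  qed
  have zz: "int z = (int v + (- m) $ 1) mod int N \<longleftrightarrow> v = ?z" if v: "v < N" for v
  proof -
    have "int z = (int v + (- m) $ 1) mod int N \<longleftrightarrow> [int z = int v - m $ 1] (mod int N)"
      using assms(4) by (simp add: Cong.cong_def)
    also have "\<dots> \<longleftrightarrow> [int v = int z + m $ 1] (mod int N)"
      by (metis cong_add_rcancel cong_sym_eq diff_add_cancel)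
    also have "\<dots> \<longleftrightarrow> int v = int ?z" using v w(3) by (simp add: Cong.cong_def)
    finally show ?thesis by (simp only: of_nat_eq_iff)
  qed
  have "(T_tilde N m * M * T_tilde N (- m)) $$ (y, z) = (\<Sum>v<N. (T_tilde N m * M) $$ (y, v) * T_tilde N (- m) $$ (v, z))"
    using assms by (simp add: scalar_prod_def atLeast0LessThan)
  also have "\<dots> = (\<Sum>v<N. if v = ?z then (T_tilde N m * M) $$ (y, v) * T_tilde N (- m) $$ (v, z) else 0)"
  proof (rule sum.cong[OF refl])
    fix v assume "v \<in> {..<N}"
    then have v: "v < N" by simp
    have "T_tilde N (- m) $$ (v, z) = 0" if "v \<noteq> ?z"
      using zz[OF v] that by (simp only: T_tilde_entry[OF assms(1) v assms(4)] if_False)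
    then show "(T_tilde N m * M) $$ (y, v) * T_tilde N (- m) $$ (v, z) =
      (if v = ?z then (T_tilde N m * M) $$ (y, v) * T_tilde N (- m) $$ (v, z) else 0)" by auto
  qed
  also have "\<dots> = (T_tilde N m * M) $$ (y, ?z) * T_tilde N (- m) $$ (?z, z)" using w by (subst sum.delta) auto
  also have "\<dots> = e_mod N (half N * (m $ 1 * m $ 2) + m $ 2 * int y) * e_mod N (half N * (m $ 1 * m $ 2) - m $ 2 * int ?z) * M $$ (?y, ?z)"
    using TM[OF w(4)] zz[OF w(4)] w(2,4) w(1) assms by (simp add: T_tilde_entry)
  also have "e_mod N (half N * (m $ 1 * m $ 2) + m $ 2 * int y) * e_mod N (half N * (m $ 1 * m $ 2) - m $ 2 * int ?z)
      = e_mod N (m $ 2 * (int y - int z))"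
    unfolding e_mod_add[symmetric]
  proof (rule e_mod_cong[OF N])
    have "[int ?z = int z + m $ 1] (mod int N)" unfolding w(3) by (simp add: Cong.cong_def)
    then have 1: "[2 * half N * (m $ 1 * m $ 2) + m $ 2 * int y - m $ 2 * int ?z
      = m $ 1 * m $ 2 + m $ 2 * int y - m $ 2 * (int z + m $ 1)] (mod int N)"
      by (intro cong_add cong_diff cong_mult cong_refl half_cong[OF assms(1)])
    then show "[half N * (m $ 1 * m $ 2) + m $ 2 * int y + (half N * (m $ 1 * m $ 2) - m $ 2 * int ?z)
      = m $ 2 * (int y - int z)] (mod int N)" by (simp add: algebra_simps)
  qed
  finally show ?thesis .
qed

text \<open>Conjugation by \<open>T_tilde N m\<close> shifts both matrix indices by the first
  coordinate of \<open>m\<close> and multiplies by a phase linear in the second. Summing over the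
  second coordinate kills the off-diagonal entries, summing over the first averages the diagonal, so
  the conjugates of \<open>M\<close> add up to the scalar matrix \<open>of_nat N * mtr M\<close>:
  the irreducibility of the Heisenberg representation, read in traces.\<close>

lemma schur_orthogonality:
  assumes "odd N" "M \<in> carrier_mat N N" "K \<in> carrier_mat N N"
  shows "(\<Sum>m\<in>lattice_box N. mtr (T_tilde N m * M * T_tilde N (- m) * K)) = of_nat N * mtr M * mtr K"
proof -
  have N: "N > 0" using assms by (cases N) auto
  let ?s = "\<lambda>a y. nat ((int y + a) mod int N)"
  have car: "T_tilde N m * M * T_tilde N (- m) \<in> carrier_mat N N" for m
    using assms(2) by (intro mult_carrier_mat[of _ N N]) auto
  have shift: "(\<Sum>a\<in>{0..<int N}. M $$ (?s a y, ?s a y)) = mtr M" for y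
  proof -
    have "(\<Sum>a\<in>{0..<int N}. M $$ (nat ((int y + a) mod int N), nat ((int y + a) mod int N)))
      = (\<Sum>a\<in>{0..<int N}. M $$ (nat (a mod int N), nat (a mod int N)))"
      using N by (intro sum_periodic_reindex[where F = "\<lambda>x. M $$ (nat (x mod int N), nat (x mod int N))"])
        (auto simp: Cong.cong_def cong_add_lcancel[unfolded Cong.cong_def])
    also have "\<dots> = (\<Sum>y<N. M $$ (y, y))" by (simp add: sum_int_nat)
    finally show ?thesis using assms(2) by (simp add: mtr_def)
  qed
  have "(\<Sum>m\<in>lattice_box N. mtr (T_tilde N m * M * T_tilde N (- m) * K))
    = (\<Sum>a\<in>{0..<int N}. \<Sum>b\<in>{0..<int N}. \<Sum>y<N. \<Sum>z<N. e_mod N (b * (int y - int z)) * M $$ (?s a y, ?s a z) * K $$ (z, y))"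
    unfolding sum_box mtr_mult[OF car assms(3)]
    by (intro sum.cong refl) (simp only: T_tilde_conj_entry[OF assms(1,2)] lessThan_iff vector_2)
  also have "\<dots> = (\<Sum>a\<in>{0..<int N}. \<Sum>y<N. \<Sum>b\<in>{0..<int N}. \<Sum>z<N. e_mod N (b * (int y - int z)) * M $$ (?s a y, ?s a z) * K $$ (z, y))"
    by (intro sum.cong refl sum.swap)
  also have "\<dots> = (\<Sum>a\<in>{0..<int N}. \<Sum>y<N. \<Sum>z<N. \<Sum>b\<in>{0..<int N}. e_mod N (b * (int y - int z)) * M $$ (?s a y, ?s a z) * K $$ (z, y))"
    by (intro sum.cong refl sum.swap)
  also have "\<dots> = (\<Sum>a\<in>{0..<int N}. \<Sum>y<N. \<Sum>z<N. if z = y then of_nat N * M $$ (?s a y, ?s a y) * K $$ (y, y) else 0)"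
  proof (intro sum.cong refl)
    fix a y z assume yz: "y \<in> {..<N}" "z \<in> {..<N}"
    have "(\<Sum>b\<in>{0..<int N}. e_mod N (b * (int y - int z)) * M $$ (?s a y, ?s a z) * K $$ (z, y))
      = (\<Sum>b\<in>{0..<int N}. e_mod N ((int y - int z) * b)) * (M $$ (?s a y, ?s a z) * K $$ (z, y))"
      unfolding sum_distrib_right by (intro sum.cong refl) (simp add: mult_ac)
    also have "(\<Sum>b\<in>{0..<int N}. e_mod N ((int y - int z) * b)) = (if z = y then of_nat N else 0)"
    proof -
      have "int N dvd int y - int z \<longleftrightarrow> z = y"
        using yz by (metis Cong.cong_def cong_iff_dvd_diff lessThan_iff mod_less of_nat_eq_iff of_nat_mod)
      then show ?thesis using sum_e_mod[OF N] by simp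
    qed
    finally show "(\<Sum>b\<in>{0..<int N}. e_mod N (b * (int y - int z)) * M $$ (?s a y, ?s a z) * K $$ (z, y))
      = (if z = y then of_nat N * M $$ (?s a y, ?s a y) * K $$ (y, y) else 0)" by simp
  qed
  also have "\<dots> = (\<Sum>a\<in>{0..<int N}. \<Sum>y<N. of_nat N * M $$ (?s a y, ?s a y) * K $$ (y, y))"
    by (intro sum.cong refl) (subst sum.delta, auto)
  also have "\<dots> = (\<Sum>y<N. of_nat N * (\<Sum>a\<in>{0..<int N}. M $$ (?s a y, ?s a y)) * K $$ (y, y))"
    by (subst sum.swap) (simp add: sum_distrib_left sum_distrib_right)
  also have "\<dots> = (\<Sum>y<N. of_nat N * mtr M * K $$ (y, y))" by (simp only: shift)
  also have "\<dots> = of_nat N * mtr M * mtr K"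
    using assms(3) by (simp add: mtr_def sum_distrib_left)
  finally show ?thesis .
qed

section \<open>The action of the torus \<open>\<int>[\<surd>D]\<close> on frequencies\<close>

text \<open>Multiplication by sqrt D = 2 \<alpha> - t on row vectors, where t is the trace of
  \<open>A\<close>. If \<open>det A = 1\<close>, its square is multiplication by D.\<close>

definition lin :: "int^2^2 \<Rightarrow> int^2 \<Rightarrow> int^2" where
  "lin A n = 2 *s (n v* A) - trace A *s n"

definition act :: "int^2^2 \<Rightarrow> int \<Rightarrow> int \<Rightarrow> int^2 \<Rightarrow> int^2" where
  "act A a b n = a *s n + b *s lin A n"

text \<open>The matrix of a + b sqrt D, written as (a - t b) + 2 b \<alpha> with \<open>A\<close> in
  place of \<alpha>. In these coordinates the norm is the diagonal form a^2 - D b^2.\<close>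

definition Bmat :: "int^2^2 \<Rightarrow> int \<Rightarrow> int \<Rightarrow> int^2^2" where
  "Bmat A a b = Finite_Cartesian_Product.mat (a - trace A * b) + map_matrix ((*) (2 * b)) A"

lemma trace_2: "trace (A :: int^2^2) = A $ 1 $ 1 + A $ 2 $ 2"
  by (simp add: trace_def sum_2)

lemma lin_nth:
  "lin A n $ 1 = 2 * (n $ 1 * A $ 1 $ 1 + n $ 2 * A $ 2 $ 1) - (A $ 1 $ 1 + A $ 2 $ 2) * n $ 1"
  "lin A n $ 2 = 2 * (n $ 1 * A $ 1 $ 2 + n $ 2 * A $ 2 $ 2) - (A $ 1 $ 1 + A $ 2 $ 2) * n $ 2"
  by (simp_all add: lin_def trace_2 vector_matrix_mult_def sum_2 algebra_simps)

lemma act_nth: "act A a b n $ i = a * n $ i + b * lin A n $ i"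
  by (simp add: act_def)

lemma discr_eq:
  assumes "Determinants.det (A :: int^2^2) = 1"
  shows "discr A = (A $ 1 $ 1 - A $ 2 $ 2)\<^sup>2 + 4 * A $ 1 $ 2 * A $ 2 $ 1"
proof -
  have "A $ 1 $ 1 * A $ 2 $ 2 - A $ 1 $ 2 * A $ 2 $ 1 = 1" using assms by (simp add: det_2)
  moreover have "(a + d)\<^sup>2 - 4 = (a - d)\<^sup>2 + 4 * b * c" if "a * d - b * c = 1" for a b c d :: int
  proof -
    have "(a + d)\<^sup>2 - 4 = (a - d)\<^sup>2 + 4 * b * c + 4 * (a * d - b * c - 1)"
      by (simp add: power2_eq_square algebra_simps)
    then show ?thesis using that by simp
  qed
  ultimately show ?thesis unfolding discr_def trace_2 by blast
qed

lemma Q_form_eq: "Q_form A n = A $ 2 $ 1 * (n $ 2)\<^sup>2 - A $ 1 $ 2 * (n $ 1)\<^sup>2 + (A $ 1 $ 1 - A $ 2 $ 2) * (n $ 1 * n $ 2)"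
  by (simp add: Q_form_def omega_def vector_matrix_mult_def sum_2 power2_eq_square algebra_simps)

lemma omega_lin_self: "omega (lin A n) n = 2 * Q_form A n"
  by (simp add: omega_def lin_nth Q_form_eq power2_eq_square algebra_simps)

lemma lin_lin:
  assumes "Determinants.det A = 1"
  shows "lin A (lin A n) $ i = discr A * n $ i"
proof -
  have "lin A (lin A n) $ 1 = discr A * n $ 1" "lin A (lin A n) $ 2 = discr A * n $ 2"
    unfolding lin_nth discr_eq[OF assms] by (simp_all add: power2_eq_square algebra_simps)
  then show ?thesis using exhaust_2[of i] by auto
qed

text \<open>Up to scaling, \<open>Q_form\<close> is a norm form of the order, so it is multiplied by
  the norm of a + b sqrt D.\<close>

lemma Q_form_act:
  assumes "Determinants.det A = 1"
  shows "Q_form A (act A a b n) = (a\<^sup>2 - discr A * b\<^sup>2) * Q_form A n"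
  unfolding Q_form_eq act_nth lin_nth discr_eq[OF assms] by (simp add: power2_eq_square algebra_simps)

lemma lin_cong: "vcong N m n \<Longrightarrow> vcong N (lin A m) (lin A n)"
  unfolding vcong_def forall_2 lin_nth by (intro conjI cong_diff cong_mult cong_add cong_refl) auto

lemma act_cong:
  "[a = a'] (mod int N) \<Longrightarrow> [b = b'] (mod int N) \<Longrightarrow> vcong N m n \<Longrightarrow> vcong N (act A a b m) (act A a' b' n)"
  using lin_cong[of N m n A] unfolding vcong_def act_nth by (auto intro!: cong_add cong_mult)

lemma Q_form_cong: "vcong N m n \<Longrightarrow> [Q_form A m = Q_form A n] (mod int N)"
  unfolding Q_form_eq vcong_def by (intro cong_add cong_diff cong_mult cong_pow cong_refl) auto

lemma act_act:
  assumes "Determinants.det A = 1"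
  shows "act A a b (act A c d n) = act A (a * c + discr A * b * d) (a * d + b * c) n"
proof -
  have "lin A (act A c d n) $ i = c * lin A n $ i + d * (discr A * n $ i)" for i
  proof -
    have "lin A (act A c d n) $ i = c * lin A n $ i + d * lin A (lin A n) $ i"
      using exhaust_2[of i] by (auto simp: lin_nth act_nth algebra_simps)
    then show ?thesis by (simp add: lin_lin[OF assms])
  qed
  then show ?thesis by (simp add: Finite_Cartesian_Product.vec_eq_iff act_nth algebra_simps)
qed

lemma act_one [simp]: "act A 1 0 n = n"
  by (simp add: Finite_Cartesian_Product.vec_eq_iff act_nth)

lemma act_uminus: "act A a b (- n) = - act A a b n"
  by (simp add: Finite_Cartesian_Product.vec_eq_iff act_nth forall_2 lin_nth algebra_simps)

lemma Bmat_nth: "Bmat A a b $ i $ j = (if i = j then a - trace A * b else 0) + 2 * b * A $ i $ j"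
  by (simp add: Bmat_def Finite_Cartesian_Product.mat_def map_matrix_def)

lemma vector_Bmat: "n v* Bmat A a b = act A a b n"
  by (simp add: Finite_Cartesian_Product.vec_eq_iff forall_2 act_nth lin_nth vector_matrix_mult_def sum_2 Bmat_nth trace_2 algebra_simps)

lemma Bmat_mult:
  assumes "Determinants.det A = 1"
  shows "Bmat A a b ** Bmat A c d = Bmat A (a * c + discr A * b * d) (a * d + b * c)"
proof -
  have "(Bmat A a b ** Bmat A c d) $ i $ j = Bmat A (a * c + discr A * b * d) (a * d + b * c) $ i $ j" for i j
  proof -
    consider "i = 1" "j = 1" | "i = 1" "j = 2" | "i = 2" "j = 1" | "i = 2" "j = 2" using exhaust_2 by blast
    then show ?thesis
      by cases (simp_all add: matrix_matrix_mult_def sum_2 Bmat_nth trace_2 discr_eq[OF assms] power2_eq_square algebra_simps)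
  qed
  then show ?thesis by (simp add: Finite_Cartesian_Product.vec_eq_iff)
qed

lemma det_Bmat:
  assumes "Determinants.det A = 1"
  shows "Determinants.det (Bmat A a b) = a\<^sup>2 - discr A * b\<^sup>2"
proof -
  have "A $ 1 $ 1 * A $ 2 $ 2 - A $ 1 $ 2 * A $ 2 $ 1 = 1" using assms by (simp add: det_2)
  moreover have "(x - (a + d) * y + 2 * y * a) * (x - (a + d) * y + 2 * y * d) - (2 * y * b) * (2 * y * c)
      = x\<^sup>2 - ((a - d)\<^sup>2 + 4 * b * c) * y\<^sup>2" if "a * d - b * c = 1" for a b c d x y :: int
  proof -
    have "(x - (a + d) * y + 2 * y * a) * (x - (a + d) * y + 2 * y * d) - (2 * y * b) * (2 * y * c)
      = x\<^sup>2 - ((a - d)\<^sup>2 + 4 * b * c) * y\<^sup>2"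
      by (simp add: power2_eq_square algebra_simps)
    then show ?thesis .
  qed
  ultimately show ?thesis unfolding det_2 Bmat_nth trace_2 discr_eq[OF assms] by simp
qed

section \<open>The binary Gauss sum of the form \<open>Q\<close>\<close>

text \<open>Vanishing modulo p at (1,0), (0,1) and (1,1) would make all three coefficients of the
  form divisible by p, and with them its discriminant D.\<close>

lemma Q_form_represents_unit:
  assumes p: "Factorial_Ring.prime p" "odd p" and "Determinants.det A = 1" "\<not> int p dvd discr A"
  shows "\<exists>v. \<not> int p dvd Q_form A v"
proof (rule ccontr)
  assume "\<not> ?thesis"
  then have d: "int p dvd Q_form A v" for v by blast
  have 1: "int p dvd A $ 1 $ 2" using d[of "vector [1, 0]"] by (simp add: Q_form_eq)
  have 2: "int p dvd A $ 2 $ 1" using d[of "vector [0, 1]"] by (simp add: Q_form_eq)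
  have "int p dvd A $ 2 $ 1 - A $ 1 $ 2 + (A $ 1 $ 1 - A $ 2 $ 2)" using d[of "vector [1, 1]"] by (simp add: Q_form_eq)
  then have "int p dvd (A $ 1 $ 1 - A $ 2 $ 2)" using 1 2 by (metis dvd_add_right_iff dvd_diff)
  then have "int p dvd discr A" using 1 unfolding discr_eq[OF assms(3)] by (simp add: power2_eq_square)
  then show False using assms(4) by blast
qed

lemma coprime_prime_power:
  assumes "Factorial_Ring.prime p" "k \<ge> 1"
  shows "coprime a (int (p ^ k)) \<longleftrightarrow> \<not> int p dvd a"
proof -
  have pi: "Factorial_Ring.prime (int p)" using assms(1) by simp
  have "coprime a (int (p ^ k)) \<longleftrightarrow> coprime a (int p)" using assms(2) by (simp add: coprime_power_right_iff)
  also have "\<dots> \<longleftrightarrow> \<not> int p dvd a"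
    using pi by (metis coprime_commute prime_imp_coprime coprime_absorb_left not_prime_unit)
  finally show ?thesis .
qed

lemma prime_not_dvd_two: "Factorial_Ring.prime p \<Longrightarrow> odd p \<Longrightarrow> \<not> int p dvd 2"
  by (metis dvd_refl even_of_nat int_dvd_int_iff of_nat_numeral primes_dvd_imp_eq two_is_prime_nat)

text \<open>In the basis v, sqrt D v with Q(v) a unit, the form is Q(v) (a^2 - D b^2). The sum
  factors into the Gauss sum of \<open>c\<close> and the conjugate of that of
  \<open>discr A * c\<close>; the two differ by the Legendre sign, and the squared modulus is the
  level.\<close>

lemma binary_gauss_sum:
  assumes p: "Factorial_Ring.prime p" "odd p" and k: "k \<ge> 1"
    and A: "Determinants.det A = 1" "\<not> int p dvd discr A" and u: "\<not> int p dvd u"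
  shows "(\<Sum>m\<in>lattice_box (p ^ k). e_mod (p ^ k) (u * Q_form A m))
    = of_int (Legendre (discr A) (int p) ^ k) * of_nat (p ^ k)"
proof -
  define N where "N = p ^ k"
  have N: "N > 0" "odd N" using p prime_gt_0_nat by (auto simp: N_def)
  have pi: "Factorial_Ring.prime (int p)" using p(1) by simp
  obtain v where v: "\<not> int p dvd Q_form A v" using Q_form_represents_unit[OF p A] by blast
  define c where "c = u * Q_form A v"
  have c: "\<not> int p dvd c" using u v pi by (simp add: c_def prime_dvd_mult_iff)
  have cN: "coprime c (int N)" unfolding N_def coprime_prime_power[OF p(1) k] by (rule c)
  have "\<not> int p dvd 2 * Q_form A v" using v prime_not_dvd_two[OF p] pi by (simp add: prime_dvd_mult_iff)
  then have Qv: "coprime (2 * Q_form A v) (int N)" unfolding N_def coprime_prime_power[OF p(1) k] .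
  define \<phi> where "\<phi> m = m $ 1 *s v + m $ 2 *s lin A v" for m :: "int^2"
  have \<phi>: "\<phi> m = act A (m $ 1) (m $ 2) v" for m by (simp add: \<phi>_def act_def)
  \<comment> \<open>Pairing with \<open>v\<close> and \<open>lin A v\<close> recovers both
    coordinates up to the unit \<open>2 * Q_form A v\<close>, so \<open>\<phi>\<close> is injective
    modulo \<open>N\<close>.\<close>
  have om: "omega (\<phi> m) v = m $ 2 * (2 * Q_form A v)" "omega (lin A v) (\<phi> m) = m $ 1 * (2 * Q_form A v)" for m
    unfolding omega_lin_self[symmetric] \<phi>_def omega_def by (simp_all add: algebra_simps)
  have inj: "vcong N x y" if "vcong N (\<phi> x) (\<phi> y)" for x y
  proof -
    have "[x $ 2 * (2 * Q_form A v) = y $ 2 * (2 * Q_form A v)] (mod int N)"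
      using omega_cong[OF that vcong_refl, of v] om by simp
    moreover have "[x $ 1 * (2 * Q_form A v) = y $ 1 * (2 * Q_form A v)] (mod int N)"
      using omega_cong[OF vcong_refl that, of "lin A v"] om by simp
    ultimately show ?thesis using Qv by (simp add: vcong_def forall_2 cong_mult_rcancel)
  qed
  have "(\<Sum>m\<in>lattice_box N. e_mod N (u * Q_form A m)) = (\<Sum>m\<in>lattice_box N. e_mod N (u * Q_form A (\<phi> m)))"
    using N inj by (intro sum_box_reindex[symmetric])
      (auto intro!: e_mod_cong cong_mult Q_form_cong)
  also have "\<dots> = (\<Sum>a\<in>{0..<int N}. \<Sum>b\<in>{0..<int N}. e_mod N (c * a\<^sup>2) * e_mod N (- (discr A * c) * b\<^sup>2))"
    unfolding sum_box \<phi> Q_form_act[OF A(1)] vector_2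
    by (intro sum.cong refl) (simp add: e_mod_add[symmetric] c_def algebra_simps)
  also have "\<dots> = gauss_sum N c * gauss_sum N (- (discr A * c))"
    by (simp add: gauss_sum_def sum_product)
  also have "gauss_sum N (- (discr A * c)) = of_int (Legendre (discr A) (int p) ^ k) * cnj (gauss_sum N c)"
    unfolding gauss_sum_minus N_def gauss_sum_mult_unit[OF p c A(2)] by simp
  also have "gauss_sum N c * (of_int (Legendre (discr A) (int p) ^ k) * cnj (gauss_sum N c))
    = of_int (Legendre (discr A) (int p) ^ k) * of_nat N"
    using gauss_sum_norm[OF N(2) cN] by (simp add: mult_ac)
  finally show ?thesis by (simp add: N_def)
qed

section \<open>Traces of the quantum propagator\<close>

lemma reduce_mat_nth: "reduce_mat N B $ i $ j = B $ i $ j mod int N"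
  by (simp add: reduce_mat_def map_matrix_def)

lemma reduce_mat_eqI:
  "(\<And>i j. [B $ i $ j = C $ i $ j] (mod int N)) \<Longrightarrow> reduce_mat N B = reduce_mat N C"
  by (simp add: Finite_Cartesian_Product.vec_eq_iff reduce_mat_nth Cong.cong_def)

lemma reduce_mat_idem: "reduce_mat N (reduce_mat N B) = reduce_mat N B"
  by (simp add: Finite_Cartesian_Product.vec_eq_iff reduce_mat_nth)

lemma reduce_mat_mult: "reduce_mat N (reduce_mat N B ** reduce_mat N C) = reduce_mat N (B ** C)"
  by (rule reduce_mat_eqI)
    (auto simp: matrix_matrix_mult_def sum_2 reduce_mat_nth Cong.cong_def intro!: mod_add_cong mod_mult_cong)

lemma det_reduce_mat: "[Determinants.det (reduce_mat N (B :: int^2^2)) = Determinants.det B] (mod int N)"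
  unfolding det_2 reduce_mat_nth by (intro cong_diff cong_mult) (simp_all add: Cong.cong_def)

lemma vector_reduce_mat: "vcong N (n v* reduce_mat N B) (n v* B)"
  unfolding vcong_def vector_matrix_mult_def reduce_mat_nth
  by (auto simp: sum_2 Cong.cong_def intro!: mod_add_cong mod_mult_cong)

lemma vcong_uminus: "vcong N m n \<Longrightarrow> vcong N (- m) (- n)"
  by (simp add: vcong_def cong_minus_minus_iff)

section \<open>The propagator on the torus, in coordinates a + b sqrt D\<close>

locale propagator =
  fixes N :: nat and A :: "int^2^2" and \<rho> :: "int^2^2 \<Rightarrow> complex Matrix.mat"
  assumes oddN: "odd N" and detA: "Determinants.det A = 1" and qp: "quantum_propagator N \<rho>"
begin

abbreviation "D \<equiv> discr A"
abbreviation "TT \<equiv> T_tilde N"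

text \<open>The class of a + b sqrt D has norm 1, so it belongs to C(N).\<close>

definition nrm :: "int \<Rightarrow> int \<Rightarrow> bool" where
  "nrm a b \<longleftrightarrow> [a\<^sup>2 - D * b\<^sup>2 = 1] (mod int N)"

definition V :: "int \<Rightarrow> int \<Rightarrow> complex Matrix.mat" where
  "V a b = \<rho> (reduce_mat N (Bmat A a b))"

definition f :: "int \<Rightarrow> int \<Rightarrow> complex" where
  "f a b = mtr (V a b)"

lemma N_pos: "N > 0"
  using oddN by (cases N) auto

lemma mat_assoc:
  "M \<in> carrier_mat N N \<Longrightarrow> K \<in> carrier_mat N N \<Longrightarrow> L \<in> carrier_mat N N \<Longrightarrow> M * K * L = M * (K * L)"
  for M K L :: "complex Matrix.mat"
  by (rule assoc_mult_mat)

lemma mat_closed: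
  "M \<in> carrier_mat N N \<Longrightarrow> K \<in> carrier_mat N N \<Longrightarrow> M * K \<in> carrier_mat N N"
  for M K :: "complex Matrix.mat"
  by (rule mult_carrier_mat)

lemma Bmat_SL2: "nrm a b \<Longrightarrow> reduce_mat N (Bmat A a b) \<in> carrier (SL2 N)"
  using det_reduce_mat[of N "Bmat A a b"] cong_trans
  by (auto simp: SL2_def nrm_def reduce_mat_idem det_Bmat[OF detA])

lemma V_unitary:
  assumes "nrm a b"
  shows "V a b \<in> carrier_mat N N" "mat_adjoint (V a b) * V a b = 1\<^sub>m N"
  using Bmat_SL2[OF assms] qp by (auto simp: quantum_propagator_def hom_def unitary_group_def V_def)

lemma nrm_mult:
  assumes "nrm a b" "nrm c d"
  shows "nrm (a * c + D * b * d) (a * d + b * c)"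
proof -
  have "(a * c + D * b * d)\<^sup>2 - D * (a * d + b * c)\<^sup>2 = (a\<^sup>2 - D * b\<^sup>2) * (c\<^sup>2 - D * d\<^sup>2)"
    by (simp add: power2_eq_square algebra_simps)
  then show ?thesis using cong_mult[OF assms[unfolded nrm_def]] by (simp add: nrm_def)
qed

lemma nrm_uminus: "nrm a (- b) \<longleftrightarrow> nrm a b"
  by (simp add: nrm_def)

lemma V_mult:
  assumes "nrm a b" "nrm c d"
  shows "V a b * V c d = V (a * c + D * b * d) (a * d + b * c)"
proof -
  have "\<rho> (reduce_mat N (Bmat A a b) \<otimes>\<^bsub>SL2 N\<^esub> reduce_mat N (Bmat A c d)) = V a b * V c d"
    using qp hom_mult[of \<rho> "SL2 N" "unitary_group N", OF _ Bmat_SL2[OF assms(1)] Bmat_SL2[OF assms(2)]]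
    by (simp add: quantum_propagator_def unitary_group_def V_def)
  then show ?thesis by (simp add: SL2_def V_def reduce_mat_mult Bmat_mult[OF detA])
qed

lemma V_cong:
  assumes "[a = c] (mod int N)" "[b = d] (mod int N)"
  shows "V a b = V c d"
  unfolding V_def
  by (rule arg_cong[where f = \<rho>], rule reduce_mat_eqI)
    (use assms in \<open>auto simp: Bmat_nth intro!: cong_add cong_diff cong_mult\<close>)

lemma right_inverse_adjoint:
  assumes "nrm a b"
  shows "V a b * mat_adjoint (V a b) = 1\<^sub>m N" "mat_adjoint (V a b) \<in> carrier_mat N N"
proof -
  have c: "mat_adjoint (V a b) \<in> carrier_mat N N" using V_unitary(1)[OF assms] by (auto simp: mat_adjoint_def mat_of_rows_def)
  then show "mat_adjoint (V a b) \<in> carrier_mat N N" .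
  show "V a b * mat_adjoint (V a b) = 1\<^sub>m N"
    using mat_mult_left_right_inverse[OF c V_unitary[OF assms]] .
qed

lemma nrm_one [simp]: "nrm 1 0"
  by (simp add: nrm_def)

text \<open>Multiplicativity makes this matrix idempotent, and a unitary idempotent is the
  identity.\<close>

lemma V_one: "V 1 0 = 1\<^sub>m N"
proof -
  have c: "V 1 0 \<in> carrier_mat N N" using V_unitary(1)[OF nrm_one] .
  have m: "V 1 0 * V 1 0 = V 1 0" using V_mult[OF nrm_one nrm_one] by simp
  have a: "mat_adjoint (V 1 0) \<in> carrier_mat N N" using right_inverse_adjoint[OF nrm_one] by blast
  have "mat_adjoint (V 1 0) * (V 1 0 * V 1 0) = (mat_adjoint (V 1 0) * V 1 0) * V 1 0"
    using assoc_mult_mat[OF a c c] by simp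
  then show ?thesis using m V_unitary(2)[OF nrm_one] c by simp
qed

lemma V_mult_inv:
  assumes "nrm a b"
  shows "V a b * V a (- b) = 1\<^sub>m N"
proof -
  have "V a b * V a (- b) = V (a * a + D * b * - b) (a * - b + b * a)"
    using V_mult[OF assms, of a "- b"] assms nrm_uminus by blast
  also have "\<dots> = V 1 0"
    using assms by (intro V_cong) (simp_all add: nrm_def power2_eq_square algebra_simps)
  finally show ?thesis by (simp add: V_one)
qed

lemma V_inv:
  assumes "nrm a b"
  shows "V a (- b) = mat_adjoint (V a b)"
proof -
  have c: "V a b \<in> carrier_mat N N" "V a (- b) \<in> carrier_mat N N"
    using V_unitary(1) assms nrm_uminus by blast+
  have a: "mat_adjoint (V a b) \<in> carrier_mat N N" using right_inverse_adjoint[OF assms] by blast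
  have "mat_adjoint (V a b) * (V a b * V a (- b)) = V a (- b)"
    using assoc_mult_mat[OF a c] V_unitary(2)[OF assms] c by simp
  then show ?thesis using V_mult_inv[OF assms] a by simp
qed

lemma f_inv:
  assumes "nrm a b"
  shows "f a (- b) = cnj (f a b)"
  unfolding f_def V_inv[OF assms] using V_unitary(1)[OF assms]
  by (auto simp: mtr_def mat_adjoint_def mat_of_rows_def cols_def)

lemma T_V:
  assumes "nrm a b"
  shows "TT n * V a b = V a b * TT (act A a b n)"
proof -
  note c = V_unitary(1)[OF assms] and a = right_inverse_adjoint[OF assms]
  have "mat_adjoint (V a b) * TT n * V a b = TT (n v* reduce_mat N (Bmat A a b))"
    using Bmat_SL2[OF assms] qp by (simp add: quantum_propagator_def V_def)
  also have "\<dots> = TT (act A a b n)"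
    by (rule T_tilde_cong[OF oddN]) (metis vector_reduce_mat vector_Bmat)
  finally have e: "mat_adjoint (V a b) * TT n * V a b = TT (act A a b n)" .
  have "V a b * TT (act A a b n) = V a b * (mat_adjoint (V a b) * (TT n * V a b))"
    unfolding e[symmetric] using a c by (simp add: mat_assoc mat_closed)
  also have "\<dots> = TT n * V a b"
    using a c by (simp add: assoc_mult_mat[of _ N N _ N _ N, symmetric])
  finally show ?thesis by simp
qed

lemma act_inv:
  assumes "nrm a b"
  shows "vcong N (act A a b (act A a (- b) n)) n"
proof -
  have "act A a b (act A a (- b) n) = act A (a * a + D * b * - b) (a * - b + b * a) n"
    by (rule act_act[OF detA])
  moreover have "vcong N \<dots> (act A 1 0 n)"
    using assms by (intro act_cong) (simp_all add: nrm_def power2_eq_square algebra_simps)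
  ultimately show ?thesis by simp
qed

lemma V_T:
  assumes "nrm a b"
  shows "V a b * TT n = TT (act A a (- b) n) * V a b"
  using T_V[OF assms, of "act A a (- b) n"] T_tilde_cong[OF oddN act_inv[OF assms, of n]] by simp

lemma T_mult: "TT m * TT n = e_mod N (half N * omega m n) \<cdot>\<^sub>m TT (m + n)"
  by (rule T_tilde_mult[OF oddN])

lemma mtr_T_conj:
  assumes "M \<in> carrier_mat N N"
  shows "mtr (TT m * M * TT (- m)) = mtr M"
proof -
  have "TT (- m) * TT m = 1\<^sub>m N"
    unfolding T_mult by (simp add: omega_def T_tilde_zero[OF oddN] mult.commute)
      (rule eq_matI, auto)
  moreover have "mtr (TT m * M * TT (- m)) = mtr (TT (- m) * (TT m * M))"
    by (rule mtr_commute[of _ N]) (use assms in auto)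
  ultimately show ?thesis using assms by (simp add: assoc_mult_mat[of _ N N _ N _ N, symmetric])
qed

text \<open>The trace is unchanged by conjugation with \<open>TT m\<close>, and
  \<open>TT (- m)\<close> can be moved across \<open>V a b\<close> at the price of acting on
  \<open>m\<close>. The frequency \<open>m\<close> is free; both evaluations of these traces come
  from choosing it well.\<close>

lemma mtr_T_V_shift:
  assumes "nrm a b"
  shows "mtr (TT n * V a b) = mtr (TT m * TT n * TT (- act A a (- b) m) * V a b)"
proof -
  note c = V_unitary(1)[OF assms]
  have "mtr (TT n * V a b) = mtr (TT m * (TT n * V a b) * TT (- m))"
    by (rule mtr_T_conj[symmetric]) (use c in auto)
  also have "TT m * (TT n * V a b) * TT (- m) = TT m * TT n * (V a b * TT (- m))"
    using c by (simp add: mat_assoc mat_closed)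
  also have "V a b * TT (- m) = TT (- act A a (- b) m) * V a b"
    by (simp add: V_T[OF assms] act_uminus)
  also have "TT m * TT n * (TT (- act A a (- b) m) * V a b) = TT m * TT n * TT (- act A a (- b) m) * V a b"
    using c by (simp add: mat_assoc mat_closed)
  finally show ?thesis .
qed

lemma mtr_smult_mult:
  assumes "M \<in> carrier_mat N N" "K \<in> carrier_mat N N"
  shows "mtr ((c \<cdot>\<^sub>m M) * K) = c * mtr (M * K)"
proof -
  have "(c \<cdot>\<^sub>m M) * K = c \<cdot>\<^sub>m (M * K)" using mult_smult_assoc_mat[OF assms] .
  then show ?thesis using mtr_smult[of "M * K" N] assms by simp
qed

lemma T_mult3:
  "TT m * TT n * TT l = e_mod N (half N * (omega m n + omega (m + n) l)) \<cdot>\<^sub>m TT (m + n + l)"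
proof -
  have "TT m * TT n * TT l = e_mod N (half N * omega m n) \<cdot>\<^sub>m (TT (m + n) * TT l)"
    unfolding T_mult[of m n] by (rule mult_smult_assoc_mat) auto
  also have "\<dots> = (e_mod N (half N * omega m n) * e_mod N (half N * omega (m + n) l)) \<cdot>\<^sub>m TT (m + n + l)"
    unfolding T_mult[of "m + n" l] by (rule eq_matI) auto
  finally show ?thesis by (simp add: e_mod_add[symmetric] ring_distribs)
qed

text \<open>The element \<open>a + b\<surd>D\<close> is the Cayley transform
  \<open>(\<surd>D x + 1) / (\<surd>D x - 1)\<close>.\<close>

definition cay :: "int \<Rightarrow> int \<Rightarrow> int \<Rightarrow> bool" where
  "cay x a b \<longleftrightarrow> nrm a b \<and> [D * x * b = a + 1] (mod int N) \<and> [x * a = x + b] (mod int N)"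

text \<open>The two congruences in \<open>cay\<close> are the components of (sqrt D x - 1)(a + b
  sqrt D) = sqrt D x + 1. Conjugating sqrt D shows that the inverse element has parameter
  -x.\<close>

lemma cay_uminus: "cay x a b \<Longrightarrow> cay (- x) a (- b)"
proof -
  assume c: "cay x a b"
  have "(- x) * a - (- x + - b) = - (x * a - (x + b))" by simp
  then have "[(- x) * a = - x + - b] (mod int N)"
    using c by (simp only: cay_def cong_iff_dvd_diff dvd_minus_iff)
  moreover have "[D * (- x) * (- b) = a + 1] (mod int N)" "nrm a (- b)"
    using c by (simp_all add: cay_def nrm_uminus)
  ultimately show ?thesis by (simp only: cay_def)
qed

text \<open>Conjugation by \<open>TT m\<close> multiplies \<open>TT n * V a b\<close> by a phase and translates \<open>n\<close> by
  \<open>m (1 - B\<^sup>-\<^sup>1)\<close>, where \<open>B\<close> is the matrix of \<open>a + b\<surd>D\<close>; choose \<open>m\<close> so that \<open>n\<close> is moved to \<open>0\<close>.\<close>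

lemma mtr_T_V_cay:
  assumes "cay x a b"
  shows "mtr (TT n * V a b) = e_mod N (- (half N * x * Q_form A n)) * f a b"
proof -
  have ab: "nrm a b" and r1: "int N dvd D * x * b - (a + 1)" and r2: "int N dvd x * a - (x + b)"
    using assms by (auto simp: cay_def cong_iff_dvd_diff)
  let ?h = "half N"
  \<comment> \<open>The solution of B^(-1) m = m + n: as B^(-1) - 1 = -2 / (sqrt D x + 1), it is m =
    -(1 + sqrt D x) n / 2.\<close>
  define m where "m = act A (- ?h) (- (?h * x)) n"
  have e: "vcong N (act A a (- b) m) (m + n)"
    unfolding vcong_def
  proof
    fix i
    have "act A a (- b) m $ i = a * (- ?h) * n $ i + D * b * (?h * x) * n $ i + (- (a * (?h * x)) + b * ?h) * lin A n $ i"
      unfolding m_def act_act[OF detA] act_nth by (simp add: algebra_simps)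
    moreover have "(m + n) $ i = (1 - ?h) * n $ i - ?h * x * lin A n $ i"
      by (simp add: m_def act_nth algebra_simps)
    ultimately have "act A a (- b) m $ i - (m + n) $ i
      = (D * x * b - (a + 1)) * (?h * n $ i) + (x * a - (x + b)) * (- ?h * lin A n $ i) + (2 * ?h * 1 - 1) * n $ i"
      by (simp add: algebra_simps)
    moreover have "int N dvd 2 * ?h * 1 - 1" using half_cong[OF oddN, of 1] by (simp add: cong_iff_dvd_diff)
    ultimately show "[act A a (- b) m $ i = (m + n) $ i] (mod int N)"
      using r1 r2 by (simp add: cong_iff_dvd_diff)
  qed
  then have e': "vcong N (- act A a (- b) m) (- (m + n))"
    by (rule vcong_uminus)
  have "TT m * TT n * TT (- act A a (- b) m) = TT m * TT n * TT (- (m + n))"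
    using T_tilde_cong[OF oddN e'] by simp
  also have "\<dots> = e_mod N (?h * omega m n) \<cdot>\<^sub>m 1\<^sub>m N"
    unfolding T_mult3 by (simp add: T_tilde_zero[OF oddN] omega_def algebra_simps)
  finally have "mtr (TT n * V a b) = e_mod N (?h * omega m n) * f a b"
    unfolding mtr_T_V_shift[OF ab, of n m] f_def
    using mtr_smult_mult[of "1\<^sub>m N" "V a b"] V_unitary(1)[OF ab] by simp
  moreover have "omega m n = - (2 * ?h * (x * Q_form A n))"
  proof -
    have "omega m n = - (?h * x) * omega (lin A n) n" by (simp add: m_def omega_def act_nth algebra_simps)
    then show ?thesis by (simp add: omega_lin_self)
  qed
  moreover have "e_mod N (?h * - (2 * ?h * (x * Q_form A n))) = e_mod N (- (?h * x * Q_form A n))"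
  proof (rule e_mod_cong[OF N_pos])
    have "[?h * - (2 * ?h * (x * Q_form A n)) = ?h * - (x * Q_form A n)] (mod int N)"
      by (intro cong_mult cong_refl) (simp only: cong_minus_minus_iff half_cong[OF oddN])
    then show "[?h * - (2 * ?h * (x * Q_form A n)) = - (?h * x * Q_form A n)] (mod int N)"
      by (simp add: mult_ac)
  qed
  ultimately show ?thesis by simp
qed

text \<open>If \<open>m\<close> is divisible by \<open>M\<close>, conjugation by \<open>TT m\<close> only multiplies \<open>TT n * V a b\<close> by
  \<open>e_mod N (omega m n)\<close>, which is not always \<open>1\<close>.\<close>

lemma mtr_T_V_congruence_subgroup:
  assumes ab: "nrm a b" and N: "N = p * M" and c: "int p dvd a - 1" "int p dvd b" and n: "\<not> vcong p n 0"
  shows "mtr (TT n * V a b) = 0"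
proof -
  have M0: "M > 0" "p > 0" using N N_pos by (auto intro: Nat.gr0I)
  \<comment> \<open>A basis vector pairing to a unit with \<open>n\<close>; the phase found at the
    end is \<open>e_mod p (omega l n)\<close>, which is therefore not 1.\<close>
  obtain l where l: "\<not> int p dvd omega l n"
  proof (cases "int p dvd n $ 1")
    case True
    then have "\<not> int p dvd n $ 2" using n by (auto simp: vcong_def forall_2 cong_0_iff)
    then show ?thesis using that[of "vector [1, 0]"] by (simp add: omega_def)
  next
    case False
    then show ?thesis using that[of "vector [0, 1]"] by (simp add: omega_def)
  qed
  define m where "m = int M *s l"
  \<comment> \<open>An element congruent to 1 modulo \<open>p\<close> moves \<open>M\<close> times
    \<open>l\<close> by a multiple of \<open>p * M = N\<close> only.\<close>
  have e: "vcong N (- act A a (- b) m) (- m)"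
    unfolding vcong_def
  proof
    fix i
    obtain u v where uv: "a - 1 = int p * u" "b = int p * v" using c by (auto elim!: dvdE)
    have "lin A m $ i = int M * lin A l $ i" using exhaust_2[of i] by (auto simp: m_def lin_nth algebra_simps)
    then have "(- act A a (- b) m) $ i - (- m) $ i = int M * (b * lin A l $ i - (a - 1) * l $ i)"
      by (simp add: m_def act_nth algebra_simps)
    also have "\<dots> = int N * (v * lin A l $ i - u * l $ i)" unfolding uv N by (simp add: algebra_simps)
    finally show "[(- act A a (- b) m) $ i = (- m) $ i] (mod int N)" by (simp add: cong_iff_dvd_diff)
  qed
  have "TT m * TT n * TT (- act A a (- b) m) = TT m * TT n * TT (- m)"
    using T_tilde_cong[OF oddN e] by simp
  also have "\<dots> = e_mod N (half N * (2 * omega m n)) \<cdot>\<^sub>m TT n"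
    unfolding T_mult3 by (simp add: omega_def algebra_simps)
  finally have "mtr (TT n * V a b) = e_mod N (half N * (2 * omega m n)) * mtr (TT n * V a b)"
    using mtr_T_V_shift[OF ab, of n m] mtr_smult_mult[of "TT n" "V a b"] V_unitary(1)[OF ab] by simp
  moreover have "e_mod N (half N * (2 * omega m n)) \<noteq> 1"
  proof -
    have "e_mod N (half N * (2 * omega m n)) = e_mod N (omega m n)"
      using half_cong[OF oddN, of "omega m n"] by (intro e_mod_cong[OF N_pos]) (simp add: mult_ac)
    also have "\<dots> = e_mod (p * M) (omega l n * int M)"
      unfolding N by (simp add: m_def omega_def algebra_simps)
    also have "\<dots> = e_mod p (omega l n)" by (rule e_mod_mult_right[OF M0(1)])
    finally show ?thesis using l e_mod_eq_1_iff[OF M0(2)] by simp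
  qed
  ultimately show ?thesis by (metis mult_cancel_right1)
qed

text \<open>Schur orthogonality writes the product of two traces as a sum of traces of
  \<open>TT m * V a b * TT (- m) * V c d\<close>. Moving \<open>TT (- m)\<close> to the left across
  \<open>V a b\<close> leaves the operator of the product element.\<close>

lemma f_mult_sum:
  assumes ab: "nrm a b" and cd: "nrm c d"
  shows "of_nat N * f a b * f c d = (\<Sum>m\<in>lattice_box N. e_mod N (- (half N * omega m (act A a (- b) m)))
    * mtr (TT (m - act A a (- b) m) * V (a * c + D * b * d) (a * d + b * c)))"
proof -
  note C = V_unitary(1)[OF ab] V_unitary(1)[OF cd]
  have "mtr (TT m * V a b * TT (- m) * V c d) = e_mod N (- (half N * omega m (act A a (- b) m)))
    * mtr (TT (m - act A a (- b) m) * V (a * c + D * b * d) (a * d + b * c))" for m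
  proof -
    have "TT m * V a b * TT (- m) = TT m * (V a b * TT (- m))"
      using C by (simp add: mat_assoc mat_closed)
    also have "V a b * TT (- m) = TT (- act A a (- b) m) * V a b"
      by (simp add: V_T[OF ab] act_uminus)
    also have "TT m * (TT (- act A a (- b) m) * V a b) = TT m * TT (- act A a (- b) m) * V a b"
      using C by (simp add: mat_assoc mat_closed)
    finally have "TT m * V a b * TT (- m) * V c d = TT m * TT (- act A a (- b) m) * (V a b * V c d)"
      using C by (simp add: mat_assoc mat_closed)
    also have "V a b * V c d = V (a * c + D * b * d) (a * d + b * c)" by (rule V_mult[OF ab cd])
    also have "TT m * TT (- act A a (- b) m)
      = e_mod N (- (half N * omega m (act A a (- b) m))) \<cdot>\<^sub>m TT (m - act A a (- b) m)"
      unfolding T_mult by (simp add: omega_def algebra_simps)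
    finally show ?thesis
      using mtr_smult_mult V_unitary(1)[OF nrm_mult[OF ab cd]] by simp
  qed
  then show ?thesis unfolding f_def schur_orthogonality[OF oddN C, symmetric] by simp
qed

text \<open>Apply \<open>f_mult_sum\<close> to an element and its inverse. The product operator is
  the identity, so only those \<open>m\<close> survive for which the remaining Heisenberg operator
  is trivial, namely the fixed ones; their phase is 1 because \<open>omega m m = 0\<close>.\<close>

lemma f_norm_fixed:
  assumes "nrm a b"
  shows "(cmod (f a b))\<^sup>2 = card {m \<in> lattice_box N. vcong N (act A a (- b) m) m}"
proof -
  have ab': "nrm a (- b)" using assms nrm_uminus by blast
  have V1: "V (a * a + D * b * - b) (a * - b + b * a) = 1\<^sub>m N"
    using V_mult_inv[OF assms] V_mult[OF assms ab'] by simp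
  have "of_nat N * f a b * f a (- b) = (\<Sum>m\<in>lattice_box N. if vcong N (act A a (- b) m) m then of_nat N else 0)"
    unfolding f_mult_sum[OF assms ab'] V1
  proof (rule sum.cong[OF refl])
    fix m :: "int^2"
    let ?m = "act A a (- b) m"
    have c: "vcong N (m - ?m) 0 \<longleftrightarrow> vcong N ?m m"
      by (auto simp: vcong_def cong_iff_dvd_diff dvd_diff_commute)
    have "mtr (TT (m - ?m) * 1\<^sub>m N) = (if vcong N ?m m then of_nat N else 0)"
      using mtr_T_tilde[OF oddN, of "m - ?m"] c by simp
    moreover have "e_mod N (- (half N * omega m ?m)) = 1" if "vcong N ?m m"
    proof -
      have "[omega m ?m = omega m m] (mod int N)" using omega_cong[OF vcong_refl that] .
      then have "int N dvd omega m ?m" by (simp add: omega_def cong_iff_dvd_diff mult.commute)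
      then show ?thesis using e_mod_eq_1_iff[OF N_pos] by simp
    qed
    ultimately show "e_mod N (- (half N * omega m ?m)) * mtr (TT (m - ?m) * 1\<^sub>m N)
      = (if vcong N ?m m then of_nat N else 0)" by simp
  qed
  also have "\<dots> = of_nat N * of_nat (card {m \<in> lattice_box N. vcong N (act A a (- b) m) m})"
    by (simp add: sum.inter_filter[symmetric] finite_box)
  finally have "f a b * cnj (f a b) = of_nat (card {m \<in> lattice_box N. vcong N (act A a (- b) m) m})"
    using N_pos f_inv[OF assms] by simp
  then have "complex_of_real ((cmod (f a b))\<^sup>2) = of_real (real (card {m \<in> lattice_box N. vcong N (act A a (- b) m) m}))"
    by (simp add: complex_norm_square[symmetric])
  then show ?thesis by (simp only: of_real_eq_iff)
qed

text \<open>Modulo \<open>N\<close>, the number \<open>2 - 2 * a\<close> is the norm of \<beta> - 1.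
  If it is a unit, multiplying the fixed point equation by the conjugate of \<beta> - 1 leaves only
  0.\<close>

lemma f_norm_regular:
  assumes ab: "nrm a b" and cop: "coprime (2 - 2 * a) (int N)"
  shows "cmod (f a b) = 1"
proof -
  have "vcong N m 0" if m: "vcong N (act A a (- b) m) m" for m
    unfolding vcong_def
  proof
    fix i
    have "vcong N (act A (a - 1) (- b) m) 0"
      using m by (simp add: vcong_def act_nth cong_iff_dvd_diff algebra_simps)
    then have "vcong N (act A (a - 1) b (act A (a - 1) (- b) m)) (act A (a - 1) b 0)"
      by (intro act_cong) auto
    moreover have "act A (a - 1) b 0 $ i = 0"
      using exhaust_2[of i] by (auto simp: act_nth lin_nth)
    moreover have "act A (a - 1) b (act A (a - 1) (- b) m) $ i = ((a - 1)\<^sup>2 - D * b\<^sup>2) * m $ i"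
      unfolding act_act[OF detA] act_nth by (simp add: power2_eq_square algebra_simps)
    ultimately have "int N dvd ((a - 1)\<^sup>2 - D * b\<^sup>2) * m $ i"
      by (metis vcong_def cong_0_iff)
    moreover have "((a - 1)\<^sup>2 - D * b\<^sup>2) * m $ i = (a\<^sup>2 - D * b\<^sup>2 - 1) * m $ i + (2 - 2 * a) * m $ i"
      by (simp add: power2_eq_square algebra_simps)
    moreover have "int N dvd (a\<^sup>2 - D * b\<^sup>2 - 1) * m $ i"
      using ab by (simp add: nrm_def cong_iff_dvd_diff)
    ultimately have "int N dvd (2 - 2 * a) * m $ i" by (simp only: dvd_add_right_iff)
    then have "int N dvd m $ i" using cop by (simp add: coprime_commute coprime_dvd_mult_right_iff)
    then show "[m $ i = 0 $ i] (mod int N)" by (simp add: cong_0_iff)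
  qed
  moreover have "vcong N (act A a (- b) 0) 0"
    by (simp add: vcong_def forall_2 act_nth lin_nth)
  moreover have "0 \<in> lattice_box N" using N_pos by (simp add: lattice_box_def)
  ultimately have "{m \<in> lattice_box N. vcong N (act A a (- b) m) m} = {0}"
    using vcong_box_eq[of _ N 0] by blast
  then have "(cmod (f a b))\<^sup>2 = 1" using f_norm_fixed[OF ab] by simp
  then show ?thesis by (simp add: power2_eq_1_iff) (metis norm_ge_zero not_one_le_zero le_minus_one_simps(3) order.trans zero_le_one linorder_not_le)
qed

text \<open>Rationalising the Cayley quotient gives a = (D x^2 + 1) / (D x^2 - 1). The product being
  2, both factors are units for odd \<open>N\<close>.\<close>

lemma cay_unit:
  assumes "cay x a b"
  shows "[(a - 1) * (D * x\<^sup>2 - 1) = 2] (mod int N)"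
proof -
  have "int N dvd D * x * b - (a + 1)" "int N dvd x * a - (x + b)"
    using assms by (auto simp: cay_def cong_iff_dvd_diff)
  moreover have "(a - 1) * (D * x\<^sup>2 - 1) - 2 = (D * x * b - (a + 1)) + (x * a - (x + b)) * (D * x)"
    by (simp add: power2_eq_square algebra_simps)
  ultimately show ?thesis unfolding cong_iff_dvd_diff by (metis dvd_add dvd_mult2)
qed

lemma cay_coprime:
  assumes "cay x a b"
  shows "coprime (a - 1) (int N)" "coprime (2 - 2 * a) (int N)" "coprime (D * x\<^sup>2 - 1) (int N)"
proof -
  have "coprime 2 (int N)" using oddN by simp
  then have c: "coprime ((a - 1) * (D * x\<^sup>2 - 1)) (int N)"
    using cay_unit[OF assms] cong_imp_coprime cong_sym by blast
  then show "coprime (a - 1) (int N)" "coprime (D * x\<^sup>2 - 1) (int N)" by simp_all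
  moreover have "2 - 2 * a = (- 2) * (a - 1)" by simp
  ultimately show "coprime (2 - 2 * a) (int N)" using oddN by (simp only: coprime_mult_left_iff) simp
qed

text \<open>With all three Cayley parameters at hand, every term of \<open>f_mult_sum\<close> equals
  \<open>f\<close> of the product times a phase in a multiple of \<open>Q_form A m\<close>. The sum
  over \<open>m\<close> is the binary Gauss sum, so the product of traces depends only on the
  product element and a sign.\<close>

lemma f_mult_cay:
  assumes x: "cay x a b" and y: "cay y c d" and w: "cay w (a * c + D * b * d) (a * d + b * c)"
    and N: "N = p ^ k" "Factorial_Ring.prime p" "k \<ge> 1" and pD: "\<not> int p dvd D"
  shows "f a b * f c d = of_int (Legendre D (int p) ^ k) * f (a * c + D * b * d) (a * d + b * c)"
proof -
  have p2: "odd p" using oddN N by simp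
  have pi: "Factorial_Ring.prime (int p)" using N(2) by simp
  have pN: "int p dvd int N" using N by (simp add: dvd_power)
  have cN: "coprime z (int N) \<longleftrightarrow> \<not> int p dvd z" for z using coprime_prime_power[OF N(2,3)] N(1) by simp
  define a' where "a' = a * c + D * b * d"
  define b' where "b' = a * d + b * c"
  have ab: "nrm a b" and cd: "nrm c d" using x y by (auto simp: cay_def)
  have w': "cay w a' b'" using w by (simp add: a'_def b'_def)
  \<comment> \<open>The total coefficient of Q(m). The cocycle contributes -b, with b = x (a - 1).
    The trace contributes -w/2 times the norm 2 - 2 a of 1 - a + b sqrt D, which is w (a -
    1).\<close>
  define u where "u = (a - 1) * (w - x)"
  \<comment> \<open>Equal parameters modulo \<open>p\<close> would mean that the product agrees
    modulo \<open>p\<close> with the first factor. The second factor would then be 1 modulo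
    \<open>p\<close>, which no Cayley transform is.\<close>
  have wx: "\<not> int p dvd w - x"
  proof
    assume "int p dvd w - x"
    then have wxp: "[w = x] (mod int p)" by (simp add: cong_iff_dvd_diff)
    have nx: "coprime (D * x\<^sup>2 - 1) (int p)" using cay_coprime(3)[OF x] pN coprime_divisors[OF dvd_refl] by blast
    have "[(a' - 1) * (D * x\<^sup>2 - 1) = (a' - 1) * (D * w\<^sup>2 - 1)] (mod int p)"
      using wxp by (intro cong_mult cong_diff cong_pow cong_refl) (simp add: cong_sym)
    also have "[(a' - 1) * (D * w\<^sup>2 - 1) = 2] (mod int p)"
      using cay_unit[OF w'] pN cong_dvd_modulus by blast
    also have "[2 = (a - 1) * (D * x\<^sup>2 - 1)] (mod int p)"
      using cay_unit[OF x] pN cong_dvd_modulus cong_sym by blast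
    finally have a1: "[a' - 1 = a - 1] (mod int p)" using nx by (simp add: cong_mult_rcancel)
    then have aa: "[a' = a] (mod int p)" by (simp add: cong_iff_dvd_diff)
    have bx: "[b = x * (a - 1)] (mod int p)" "[b' = w * (a' - 1)] (mod int p)"
    proof -
      have "[b = x * (a - 1)] (mod int N)" "[b' = w * (a' - 1)] (mod int N)"
        using x w' by (auto simp: cay_def cong_iff_dvd_diff algebra_simps dvd_diff_commute)
      then show "[b = x * (a - 1)] (mod int p)" "[b' = w * (a' - 1)] (mod int p)"
        using pN cong_dvd_modulus by blast+
    qed
    have bb: "[b' = b] (mod int p)"
      using cong_trans[OF bx(2) cong_trans[OF cong_mult[OF wxp a1] cong_sym[OF bx(1)]]] .
    have "[a\<^sup>2 - D * b\<^sup>2 = 1] (mod int p)" using ab pN cong_dvd_modulus unfolding nrm_def by blast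
    \<comment> \<open>\<open>c\<close> is the rational part of the product element divided by the
      first factor.\<close>
    have "[c = c * (a\<^sup>2 - D * b\<^sup>2)] (mod int p)"
      using cong_mult[OF cong_refl[of c] \<open>[a\<^sup>2 - D * b\<^sup>2 = 1] (mod int p)\<close>] by (simp add: cong_sym)
    also have "c * (a\<^sup>2 - D * b\<^sup>2) = a * a' - D * b * b'"
      by (simp add: a'_def b'_def power2_eq_square algebra_simps)
    also have "[a * a' - D * b * b' = a * a - D * b * b] (mod int p)"
      by (intro cong_diff cong_mult cong_refl aa bb)
    also have "[a * a - D * b * b = 1] (mod int p)"
      using \<open>[a\<^sup>2 - D * b\<^sup>2 = 1] (mod int p)\<close> by (simp add: power2_eq_square mult.assoc)
    finally have "int p dvd c - 1" by (simp add: cong_iff_dvd_diff)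
    then show False using cay_coprime(1)[OF y] cN by blast
  qed
  have u: "\<not> int p dvd u"
    using wx cay_coprime(1)[OF x] cN pi by (simp add: u_def prime_dvd_mult_iff)
  have "e_mod N (- (half N * omega m (act A a (- b) m))) * mtr (TT (m - act A a (- b) m) * V a' b')
    = e_mod N (u * Q_form A m) * f a' b'" for m
  proof -
    have "m - act A a (- b) m = act A (1 - a) b m"
      by (simp add: Finite_Cartesian_Product.vec_eq_iff act_nth algebra_simps)
    then have "mtr (TT (m - act A a (- b) m) * V a' b')
      = e_mod N (- (half N * w * (((1 - a)\<^sup>2 - D * b\<^sup>2) * Q_form A m))) * f a' b'"
      by (simp add: mtr_T_V_cay[OF w'] Q_form_act[OF detA])
    moreover have "omega m (act A a (- b) m) = 2 * b * Q_form A m"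
    proof -
      have "omega m (act A a (- b) m) = b * omega (lin A m) m"
        by (simp add: omega_def act_nth algebra_simps)
      then show ?thesis by (simp add: omega_lin_self)
    qed
    moreover have "e_mod N (- (half N * (2 * b * Q_form A m)))
        * e_mod N (- (half N * w * (((1 - a)\<^sup>2 - D * b\<^sup>2) * Q_form A m))) = e_mod N (u * Q_form A m)"
      unfolding e_mod_add[symmetric]
    proof (rule e_mod_cong[OF N_pos])
      let ?q = "Q_form A m" and ?h = "half N"
      have d1: "int N dvd a\<^sup>2 - D * b\<^sup>2 - 1" using ab by (simp add: nrm_def cong_iff_dvd_diff)
      have d2: "int N dvd x * a - (x + b)" using x by (simp add: cay_def cong_iff_dvd_diff)
      have d3: "int N dvd 2 * ?h * 1 - 1" using half_cong[OF oddN, of 1] by (simp add: cong_iff_dvd_diff)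
      have "- (?h * (2 * b * ?q)) + - (?h * w * (((1 - a)\<^sup>2 - D * b\<^sup>2) * ?q)) - u * ?q
        = (a\<^sup>2 - D * b\<^sup>2 - 1) * (- (?h * w * ?q)) + (x * a - (x + b)) * ?q + (2 * ?h * 1 - 1) * (- (b * ?q) - w * (1 - a) * ?q)"
        by (simp add: u_def power2_eq_square algebra_simps)
      then show "[- (?h * (2 * b * ?q)) + - (?h * w * (((1 - a)\<^sup>2 - D * b\<^sup>2) * ?q)) = u * ?q] (mod int N)"
        using d1 d2 d3 by (simp only: cong_iff_dvd_diff) (intro dvd_add dvd_mult2)
    qed
    ultimately show ?thesis by (simp only: mult.assoc[symmetric])
  qed
  then have "of_nat N * f a b * f c d = (\<Sum>m\<in>lattice_box N. e_mod N (u * Q_form A m)) * f a' b'"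
    unfolding f_mult_sum[OF ab cd] a'_def[symmetric] b'_def[symmetric] by (simp add: sum_distrib_right)
  also have "(\<Sum>m\<in>lattice_box N. e_mod N (u * Q_form A m)) = of_int (Legendre D (int p) ^ k) * of_nat N"
    unfolding N(1) by (rule binary_gauss_sum[OF N(2) p2 N(3) detA pD u])
  finally show ?thesis using N_pos by (simp add: a'_def b'_def)
qed

text \<open>The element is the negative of a Cayley transform \<beta>(x). Since 1 + \<beta>(x)^(-1)
  = 2 sqrt D x / (sqrt D x + 1), a vector fixed by its inverse is annihilated by
  \<open>x\<close>.\<close>

lemma f_norm_congruence_subgroup:
  assumes x: "cay x a b" and cD: "coprime D (int N)"
  shows "(cmod (f (- a) (- b)))\<^sup>2 \<le> card {m \<in> lattice_box N. vcong N (x *s m) 0}"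
proof -
  have ab: "nrm (- a) (- b)" using x by (simp add: cay_def nrm_def)
  have d1: "int N dvd D * x * b - (a + 1)" and d2: "int N dvd x * a - (x + b)"
    using x by (auto simp: cay_def cong_iff_dvd_diff)
  have "vcong N (x *s m) 0" if m: "vcong N (act A (- a) (- (- b)) m) m" for m
    unfolding vcong_def
  proof
    fix i
    have "vcong N (act A (- a - 1) b m) 0"
      using m by (simp add: vcong_def act_nth cong_iff_dvd_diff algebra_simps)
    \<comment> \<open>Multiplication by D x + sqrt D = sqrt D (sqrt D x + 1) clears the denominator
      and leaves -2 D x.\<close>
    then have "vcong N (act A (D * x) 1 (act A (- a - 1) b m)) (act A (D * x) 1 0)"
      by (intro act_cong) auto
    moreover have "act A (D * x) 1 0 $ i = 0"
      using exhaust_2[of i] by (auto simp: act_nth lin_nth)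
    moreover have "act A (D * x) 1 (act A (- a - 1) b m) $ i
      = (D * x * b - (a + 1)) * lin A m $ i + (x * a - (x + b)) * (- D * m $ i) - 2 * D * (x * m $ i)"
      unfolding act_act[OF detA] act_nth by (simp add: algebra_simps)
    ultimately have "int N dvd (D * x * b - (a + 1)) * lin A m $ i + (x * a - (x + b)) * (- D * m $ i) - 2 * D * (x * m $ i)"
      by (metis vcong_def cong_0_iff)
    moreover have "int N dvd (D * x * b - (a + 1)) * lin A m $ i + (x * a - (x + b)) * (- D * m $ i)"
      by (intro dvd_add dvd_mult2 d1 d2)
    ultimately have "int N dvd 2 * D * (x * m $ i)" by (metis dvd_diff_right_iff)
    moreover have "coprime (2 * D) (int N)" using cD oddN by simp
    ultimately have "int N dvd x * m $ i" by (metis coprime_commute coprime_dvd_mult_right_iff)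
    then show "[(x *s m) $ i = 0 $ i] (mod int N)" by (simp add: cong_0_iff)
  qed
  then have "{m \<in> lattice_box N. vcong N (act A (- a) (- (- b)) m) m} \<subseteq> {m \<in> lattice_box N. vcong N (x *s m) 0}"
    by blast
  then have "card {m \<in> lattice_box N. vcong N (act A (- a) (- (- b)) m) m} \<le> card {m \<in> lattice_box N. vcong N (x *s m) 0}"
    by (intro card_mono) (auto simp: finite_box)
  then show ?thesis using f_norm_fixed[OF ab] by simp
qed
end

section \<open>The order \<open>\<int>[\<alpha>]\<close> modulo \<open>N\<close>\<close>

lemma eigenvalue_quadratic:
  assumes "Determinants.det A = 1" "eigenvalue_of A \<alpha>"
  shows "\<alpha> * \<alpha> = of_int (trace A) * \<alpha> - 1"
proof -
  obtain v where v: "v \<noteq> 0" "map_matrix real_of_int A *v v = \<alpha> *s v"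
    using assms(2) by (auto simp: eigenvalue_of_def)
  define a b c d where "a = real_of_int (A $ 1 $ 1)" and "b = real_of_int (A $ 1 $ 2)"
    and "c = real_of_int (A $ 2 $ 1)" and "d = real_of_int (A $ 2 $ 2)"
  note abcd = a_def b_def c_def d_def
  have e: "(map_matrix real_of_int A *v v) $ i = \<alpha> * v $ i" for i
    using v(2) by simp
  have 1: "a * v $ 1 + b * v $ 2 = \<alpha> * v $ 1" and 2: "c * v $ 1 + d * v $ 2 = \<alpha> * v $ 2"
    using e[of 1] e[of 2] by (simp_all add: abcd matrix_vector_mult_def sum_2 map_matrix_def)
  let ?P = "(a - \<alpha>) * (d - \<alpha>) - b * c"
  have "?P * v $ 1 = (d - \<alpha>) * (a * v $ 1 + b * v $ 2 - \<alpha> * v $ 1) - b * (c * v $ 1 + d * v $ 2 - \<alpha> * v $ 2)"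
    by (simp add: algebra_simps)
  then have p1: "?P * v $ 1 = 0" using 1 2 by simp
  have "?P * v $ 2 = (a - \<alpha>) * (c * v $ 1 + d * v $ 2 - \<alpha> * v $ 2) - c * (a * v $ 1 + b * v $ 2 - \<alpha> * v $ 1)"
    by (simp add: algebra_simps)
  then have p2: "?P * v $ 2 = 0" using 1 2 by simp
  have "v $ 1 \<noteq> 0 \<or> v $ 2 \<noteq> 0"
    using v(1) by (simp add: Finite_Cartesian_Product.vec_eq_iff forall_2)
  then have P: "?P = 0" using p1 p2 by auto
  have "A $ 1 $ 1 * A $ 2 $ 2 - A $ 1 $ 2 * A $ 2 $ 1 = 1" using assms(1) by (simp add: det_2)
  then have "real_of_int (A $ 1 $ 1 * A $ 2 $ 2 - A $ 1 $ 2 * A $ 2 $ 1) = 1" by simp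
  then have "a * d - b * c = 1" by (simp add: abcd)
  moreover have "of_int (trace A) = a + d" by (simp add: trace_2 abcd)
  ultimately show ?thesis using P by (simp add: algebra_simps)
qed

text \<open>The only squares at distance 4 are 4 and 0: bases differing by 1 have squares at odd
  distance, and a larger gap already forces the smaller base to be 0.\<close>

lemma hyperbolic_discr_not_square:
  fixes t s :: int
  assumes "\<bar>t\<bar> > 2"
  shows "t\<^sup>2 - 4 \<noteq> s\<^sup>2"
proof
  assume e: "t\<^sup>2 - 4 = s\<^sup>2"
  define T S where "T = \<bar>t\<bar>" and "S = \<bar>s\<bar>"
  have TS: "T * T = S * S + 4" "T > 2" "S \<ge> 0" using e assms by (simp_all add: T_def S_def power2_eq_square)
  have "T > S"
  proof (rule ccontr)
    assume "\<not> T > S"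
    then have "T * T \<le> S * S" using TS by (intro mult_mono) auto
    then show False using TS by simp
  qed
  then consider "T = S + 1" | "T \<ge> S + 2" by linarith
  then show False
  proof cases
    case 1
    then have "2 * S + 1 = 4" using TS(1) by (simp add: algebra_simps)
    then show False by presburger
  next
    case 2
    then have "(S + 2) * (S + 2) \<le> T * T" using TS by (intro mult_mono) auto
    then have "S = 0" using TS by (simp add: algebra_simps)
    then have "T * T = 4" using TS(1) by simp
    moreover have "3 * 3 \<le> T * T" using TS(2) by (intro mult_mono) auto
    ultimately show False by simp
  qed
qed

text \<open>Completing the square, a rational eigenvalue would make the discriminant a square.
  Irrationality makes coordinates with respect to 1 and \<alpha> unique, on which the descriptions
  in \<open>iota\<close> and \<open>field_norm\<close> depend.\<close>

lemma eigenvalue_irrational: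
  assumes A: "Determinants.det A = 1" "\<bar>trace A\<bar> > 2" "eigenvalue_of A \<alpha>"
  shows "\<alpha> \<notin> \<rat>"
proof
  assume "\<alpha> \<in> \<rat>"
  then obtain n m :: int where m: "m > 0" "\<alpha> = of_int n / of_int m" using Rats_cases' by blast
  let ?t = "trace A"
  have am: "\<alpha> * of_int m = of_int n" using m by simp
  have "real_of_int (n * n) = (\<alpha> * \<alpha>) * (of_int m * of_int m)"
    by (simp add: am[symmetric] mult_ac)
  also have "\<dots> = of_int ?t * (\<alpha> * of_int m) * of_int m - of_int m * of_int m"
    unfolding eigenvalue_quadratic[OF A(1,3)] by (simp add: algebra_simps)
  also have "\<dots> = of_int (?t * n * m - m * m)" by (simp add: am)
  finally have "real_of_int (n * n) = of_int (?t * n * m - m * m)" .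
  then have n: "n * n = ?t * n * m - m * m" by linarith
  have "(2 * n - ?t * m)\<^sup>2 = (?t\<^sup>2 - 4) * m\<^sup>2 + 4 * (n * n - (?t * n * m - m * m))"
    by (simp add: power2_eq_square algebra_simps)
  then have e: "(2 * n - ?t * m)\<^sup>2 = (?t\<^sup>2 - 4) * m\<^sup>2" using n by simp
  then have "m\<^sup>2 dvd (2 * n - ?t * m)\<^sup>2" by simp
  then have "m dvd 2 * n - ?t * m" by simp
  then obtain s where "2 * n - ?t * m = m * s" by blast
  then have "(?t\<^sup>2 - 4) * m\<^sup>2 = (m * s)\<^sup>2" using e by (simp only:)
  moreover have "(m * s)\<^sup>2 = s\<^sup>2 * m\<^sup>2" by (simp add: power_mult_distrib)
  ultimately have "(?t\<^sup>2 - 4) * m\<^sup>2 = s\<^sup>2 * m\<^sup>2" by (rule trans)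
  moreover have "m\<^sup>2 \<noteq> 0" using m(1) by simp
  ultimately have "?t\<^sup>2 - 4 = s\<^sup>2" by (metis mult_right_cancel)
  then show False using hyperbolic_discr_not_square[OF A(2)] by blast
qed

lemma irrational_coords:
  assumes "\<alpha> \<notin> \<rat>" "a + b * \<alpha> = c + d * \<alpha>" "a \<in> \<rat>" "b \<in> \<rat>" "c \<in> \<rat>" "d \<in> \<rat>"
  shows "a = c \<and> b = (d :: real)"
proof -
  have "b = d"
  proof (rule ccontr)
    assume "b \<noteq> d"
    then have "\<alpha> = (c - a) / (b - d)" using assms(2) by (simp add: field_simps)
    also have "\<dots> \<in> \<rat>" using assms by simp
    finally show False using assms(1) by blast
  qed
  then show ?thesis using assms(2) by simp
qed

lemma the_elem_const:
  assumes "x \<in> S" "\<And>y. y \<in> S \<Longrightarrow> F y = c"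
  shows "the_elem (F ` S) = c"
proof -
  have "F ` S = {c}" using assms by force
  then show ?thesis by simp
qed

locale hecke_level = propagator N A \<rho> for N A \<rho> +
  fixes \<alpha> :: real and p k :: nat
  assumes hyp: "\<bar>trace A\<bar> > 2" and eig: "eigenvalue_of A \<alpha>"
    and N_eq: "N = p ^ k" and prime_p: "Factorial_Ring.prime p" and k1: "k \<ge> 1" and pD: "\<not> int p dvd discr A"
begin

abbreviation "t \<equiv> trace A"
abbreviation "\<O> \<equiv> order_ring \<alpha>"
abbreviation "I \<equiv> level_ideal \<alpha> N"
abbreviation "\<Q> \<equiv> order_mod \<alpha> N"
abbreviation "C \<equiv> hecke_group \<alpha> N"

lemmas quad = eigenvalue_quadratic[OF detA eig]
lemmas irr = eigenvalue_irrational[OF detA hyp eig]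

lemma coords: "of_int a + of_int b * \<alpha> = of_int c + of_int d * \<alpha> \<longleftrightarrow> a = c \<and> b = d"
  using irrational_coords[OF irr, of "of_int a" "of_int b" "of_int c" "of_int d"] by auto

lemma alpha_nz: "\<alpha> \<noteq> 0"
  using irr by auto

lemma inverse_alpha: "inverse \<alpha> = of_int t - \<alpha>"
proof -
  have "\<alpha> * (of_int t - \<alpha>) = 1" using quad by (simp add: algebra_simps)
  then show ?thesis using alpha_nz by (simp add: inverse_eq_divide field_simps)
qed

lemma sqrt_D_eq: "sqrt_D \<alpha> = 2 * \<alpha> - of_int t"
  by (simp add: sqrt_D_def inverse_alpha)

section \<open>Arithmetic in the order and in its quotient by N\<close>

lemma O_simps [simp]:
  "monoid.mult \<O> = (*)" "one \<O> = 1" "ring.zero \<O> = 0" "add \<O> = (+)"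
  by (simp_all add: order_ring_def)

lemma O_carrier: "x \<in> carrier \<O> \<longleftrightarrow> (\<exists>n m. x = of_int n + of_int m * \<alpha>)"
  by (auto simp: order_ring_def)

lemma O_mult: "(of_int u + of_int v * \<alpha>) * (of_int u' + of_int v' * \<alpha>)
  = of_int (u * u' - v * v') + of_int (u * v' + v * u' + t * v * v') * \<alpha>"
proof -
  have "(of_int u + of_int v * \<alpha>) * (of_int u' + of_int v' * \<alpha>)
    = of_int (u * u') + of_int (u * v' + v * u') * \<alpha> + of_int (v * v') * (\<alpha> * \<alpha>)"
    by (simp add: algebra_simps)
  then show ?thesis by (simp add: quad algebra_simps)
qed

lemma cring_O: "cring \<O>"
proof (rule cringI)
  show "abelian_group \<O>"
  proof (rule abelian_groupI)
    show "x \<oplus>\<^bsub>\<O>\<^esub> y \<in> carrier \<O>" if xy: "x \<in> carrier \<O>" "y \<in> carrier \<O>" for x y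
    proof -
      obtain a b c d :: int where "x = of_int a + of_int b * \<alpha>" "y = of_int c + of_int d * \<alpha>"
        using xy by (auto simp: O_carrier)
      then have "x + y = of_int (a + c) + of_int (b + d) * \<alpha>" by (simp add: algebra_simps)
      then show ?thesis unfolding O_carrier O_simps by blast
    qed
    have "(0::real) = of_int 0 + of_int 0 * \<alpha>" by simp
    then show "\<zero>\<^bsub>\<O>\<^esub> \<in> carrier \<O>" unfolding O_carrier O_simps by blast
    show "\<exists>y\<in>carrier \<O>. y \<oplus>\<^bsub>\<O>\<^esub> x = \<zero>\<^bsub>\<O>\<^esub>" if x: "x \<in> carrier \<O>" for x
    proof -
      obtain a b :: int where "x = of_int a + of_int b * \<alpha>" using x by (auto simp: O_carrier)
      then have "- x = of_int (- a) + of_int (- b) * \<alpha>" by simp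
      then have "- x \<in> carrier \<O>" unfolding O_carrier by blast
      then show ?thesis by (intro bexI[of _ "- x"]) auto
    qed
  qed auto
  show "comm_monoid \<O>"
  proof (rule comm_monoidI)
    show "x \<otimes>\<^bsub>\<O>\<^esub> y \<in> carrier \<O>" if "x \<in> carrier \<O>" "y \<in> carrier \<O>" for x y
      using that O_mult unfolding O_carrier O_simps by metis
    have "(1::real) = of_int 1 + of_int 0 * \<alpha>" by simp
    then show "\<one>\<^bsub>\<O>\<^esub> \<in> carrier \<O>" unfolding O_carrier O_simps by blast
  qed auto
qed (auto simp: algebra_simps)

lemma O_minus:
  assumes "x \<in> carrier \<O>" "y \<in> carrier \<O>"
  shows "x \<ominus>\<^bsub>\<O>\<^esub> y = x - y"
proof -
  interpret O: cring \<O> by (rule cring_O)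
  have "x \<ominus>\<^bsub>\<O>\<^esub> y \<oplus>\<^bsub>\<O>\<^esub> y = x" using assms by (simp add: O.minus_eq O.a_assoc O.l_neg del: O_simps)
  then have "(x \<ominus>\<^bsub>\<O>\<^esub> y) + y = x" by simp
  then show ?thesis by linarith
qed

lemma ideal_I: "ideal I \<O>"
proof -
  interpret O: cring \<O> by (rule cring_O)
  have "real N = of_int (int N) + of_int 0 * \<alpha>" by simp
  then have "real N \<in> carrier \<O>" unfolding O_carrier by blast
  then show ?thesis unfolding level_ideal_def by (rule O.cgenideal_ideal)
qed

lemma I_mem: "of_int u + of_int v * \<alpha> \<in> I \<longleftrightarrow> int N dvd u \<and> int N dvd v"
proof
  assume "of_int u + of_int v * \<alpha> \<in> I"
  then obtain n m :: int where "of_int u + of_int v * \<alpha> = (of_int n + of_int m * \<alpha>) * real N"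
    by (auto simp: level_ideal_def cgenideal_def O_carrier)
  then have "of_int u + of_int v * \<alpha> = of_int (n * int N) + of_int (m * int N) * \<alpha>" by (simp add: algebra_simps)
  then show "int N dvd u \<and> int N dvd v" unfolding coords by simp
next
  assume "int N dvd u \<and> int N dvd v"
  then obtain n m where "u = int N * n" "v = int N * m" by (auto elim!: dvdE)
  then have "of_int u + of_int v * \<alpha> = (of_int n + of_int m * \<alpha>) * real N" by (simp add: algebra_simps)
  then show "of_int u + of_int v * \<alpha> \<in> I"
    unfolding level_ideal_def cgenideal_def O_simps O_carrier by blast
qed

definition P :: "int \<Rightarrow> int \<Rightarrow> real set" where
  "P u v = residue_class \<alpha> N (of_int u + of_int v * \<alpha>)"

lemma P_eq: "P u v = P u' v' \<longleftrightarrow> [u = u'] (mod int N) \<and> [v = v'] (mod int N)"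
proof -
  interpret O: cring \<O> by (rule cring_O)
  have c: "of_int u + of_int v * \<alpha> \<in> carrier \<O>" "of_int u' + of_int v' * \<alpha> \<in> carrier \<O>" by (auto simp: O_carrier)
  have "P u v = P u' v' \<longleftrightarrow> (of_int u + of_int v * \<alpha>) - (of_int u' + of_int v' * \<alpha>) \<in> I"
    unfolding P_def residue_class_def using O.quotient_eq_iff_same_a_r_cos[OF ideal_I c] O_minus[OF c] by simp
  also have "(of_int u + of_int v * \<alpha>) - (of_int u' + of_int v' * \<alpha>) = of_int (u - u') + of_int (v - v') * \<alpha>"
    by (simp add: algebra_simps)
  finally show ?thesis unfolding I_mem by (simp add: cong_iff_dvd_diff)
qed

lemma P_mem: "x \<in> P u v \<longleftrightarrow> (\<exists>u' v'. x = of_int u' + of_int v' * \<alpha> \<and> [u' = u] (mod int N) \<and> [v' = v] (mod int N))"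
proof
  assume "x \<in> P u v"
  then obtain i where i: "i \<in> I" "x = i + (of_int u + of_int v * \<alpha>)"
    by (auto simp: P_def residue_class_def a_r_coset_def' )
  then obtain n m :: int where nm: "i = of_int n + of_int m * \<alpha>"
    using ideal.Icarr[OF ideal_I i(1)] by (auto simp: O_carrier)
  then have "int N dvd n" "int N dvd m" using i(1) I_mem by auto
  moreover have "x = of_int (n + u) + of_int (m + v) * \<alpha>" using i(2) nm by (simp add: algebra_simps)
  ultimately show "\<exists>u' v'. x = of_int u' + of_int v' * \<alpha> \<and> [u' = u] (mod int N) \<and> [v' = v] (mod int N)"
    by (intro exI[of _ "n + u"] exI[of _ "m + v"]) (simp add: cong_iff_dvd_diff)
next
  assume "\<exists>u' v'. x = of_int u' + of_int v' * \<alpha> \<and> [u' = u] (mod int N) \<and> [v' = v] (mod int N)"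
  then obtain u' v' where x: "x = of_int u' + of_int v' * \<alpha>" "[u' = u] (mod int N)" "[v' = v] (mod int N)" by blast
  have "of_int (u' - u) + of_int (v' - v) * \<alpha> \<in> I" unfolding I_mem using x by (simp add: cong_iff_dvd_diff)
  moreover have "x = (of_int (u' - u) + of_int (v' - v) * \<alpha>) + (of_int u + of_int v * \<alpha>)"
    using x(1) by (simp add: algebra_simps)
  ultimately show "x \<in> P u v" unfolding P_def residue_class_def a_r_coset_def' O_simps by blast
qed

lemma P_nonempty: "of_int u + of_int v * \<alpha> \<in> P u v"
  unfolding P_mem by (intro exI[of _ u] exI[of _ v]) simp

lemma cring_Q: "cring \<Q>"
proof -
  interpret O: cring \<O> by (rule cring_O)
  show ?thesis unfolding order_mod_def by (rule ideal.quotient_is_cring[OF ideal_I cring_O])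
qed

lemma Q_carrier: "x \<in> carrier \<Q> \<longleftrightarrow> (\<exists>u v. x = P u v)"
proof -
  have "x \<in> carrier \<Q> \<longleftrightarrow> (\<exists>y\<in>carrier \<O>. x = residue_class \<alpha> N y)"
    by (auto simp: order_mod_def FactRing_def A_RCOSETS_def' residue_class_def)
  also have "\<dots> \<longleftrightarrow> (\<exists>u v. x = P u v)"
    unfolding Bex_def O_carrier P_def by blast
  finally show ?thesis .
qed

lemma Q_mult: "P u v \<otimes>\<^bsub>\<Q>\<^esub> P u' v' = P (u * u' - v * v') (u * v' + v * u' + t * v * v')"
proof -
  have c: "of_int u + of_int v * \<alpha> \<in> carrier \<O>" "of_int u' + of_int v' * \<alpha> \<in> carrier \<O>" by (auto simp: O_carrier)
  show ?thesis
    using ideal.rcoset_mult_add[OF ideal_I c]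
    by (simp add: order_mod_def FactRing_def P_def residue_class_def O_mult)
qed

lemma Q_one: "\<one>\<^bsub>\<Q>\<^esub> = P 1 0"
  by (simp add: order_mod_def FactRing_def P_def residue_class_def)

lemma field_norm_int: "field_norm \<alpha> (of_int u + of_int v * \<alpha>) = of_int (u\<^sup>2 + t * u * v + v\<^sup>2)"
proof -
  have e: "(of_int u + of_int v * \<alpha>) * (of_int u + of_int v * inverse \<alpha>) = of_int (u\<^sup>2 + t * u * v + v\<^sup>2)"
  proof -
    have "(of_int u + of_int v * \<alpha>) * (of_int u + of_int v * (of_int t - \<alpha>))
      = of_int (u\<^sup>2 + t * u * v) + of_int (v\<^sup>2) * (of_int t * \<alpha> - \<alpha> * \<alpha>)"
      by (simp add: power2_eq_square algebra_simps)
    then show ?thesis by (simp add: inverse_alpha quad)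
  qed
  show ?thesis
    unfolding field_norm_def
  proof (rule the_equality)
    show "\<exists>a b. of_int u + of_int v * \<alpha> = of_rat a + of_rat b * \<alpha> \<and>
        of_int (u\<^sup>2 + t * u * v + v\<^sup>2) = (of_rat a + of_rat b * \<alpha>) * (of_rat a + of_rat b * inverse \<alpha>)"
      using e by (intro exI[of _ "of_int u"] exI[of _ "of_int v"]) simp
    fix r assume "\<exists>a b. of_int u + of_int v * \<alpha> = of_rat a + of_rat b * \<alpha> \<and>
        r = (of_rat a + of_rat b * \<alpha>) * (of_rat a + of_rat b * inverse \<alpha>)"
    then obtain a b :: rat where ab: "of_int u + of_int v * \<alpha> = of_rat a + of_rat b * \<alpha>"
        "r = (of_rat a + of_rat b * \<alpha>) * (of_rat a + of_rat b * inverse \<alpha>)" by blast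
    then have "of_int u = (of_rat a :: real) \<and> of_int v = (of_rat b :: real)"
      by (intro irrational_coords[OF irr]) auto
    then show "r = of_int (u\<^sup>2 + t * u * v + v\<^sup>2)" using ab(2) e by metis
  qed
qed

lemma iota_int: "iota A \<alpha> (of_int u + of_int v * \<alpha>) = Finite_Cartesian_Product.mat u + map_matrix ((*) v) A"
  unfolding iota_def
proof (rule the_equality)
  show "\<exists>n m. of_int u + of_int v * \<alpha> = of_int n + of_int m * \<alpha> \<and>
    Finite_Cartesian_Product.mat u + map_matrix ((*) v) A = Finite_Cartesian_Product.mat n + map_matrix ((*) m) A" by blast
  show "M = Finite_Cartesian_Product.mat u + map_matrix ((*) v) A"
    if "\<exists>n m. of_int u + of_int v * \<alpha> = of_int n + of_int m * \<alpha> \<and>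
      M = Finite_Cartesian_Product.mat n + map_matrix ((*) m) A" for M
    using that unfolding coords by blast
qed

text \<open>Elements of the order have integral norm, so \<open>floor\<close> changes only the type.
  The norm is a polynomial in the coordinates and hence constant modulo \<open>N\<close> on a
  class.\<close>

lemma norm_mod_P: "norm_mod \<alpha> N (P u v) = (u\<^sup>2 + t * u * v + v\<^sup>2) mod int N"
  unfolding norm_mod_def
proof (rule the_elem_const[OF P_nonempty])
  fix y assume "y \<in> P u v"
  then obtain u' v' where y: "y = of_int u' + of_int v' * \<alpha>" "[u' = u] (mod int N)" "[v' = v] (mod int N)"
    unfolding P_mem by blast
  have "[u'\<^sup>2 + t * u' * v' + v'\<^sup>2 = u\<^sup>2 + t * u * v + v\<^sup>2] (mod int N)"
    using y(2,3) by (intro cong_add cong_mult cong_pow cong_refl)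
  then show "\<lfloor>field_norm \<alpha> y\<rfloor> mod int N = (u\<^sup>2 + t * u * v + v\<^sup>2) mod int N"
    unfolding y(1) field_norm_int floor_of_int Cong.cong_def .
qed

lemma iota_mod_P: "iota_mod A \<alpha> N (P u v) = reduce_mat N (Finite_Cartesian_Product.mat u + map_matrix ((*) v) A)"
  unfolding iota_mod_def
proof (rule the_elem_const[OF P_nonempty])
  fix y assume "y \<in> P u v"
  then obtain u' v' where y: "y = of_int u' + of_int v' * \<alpha>" "[u' = u] (mod int N)" "[v' = v] (mod int N)"
    unfolding P_mem by blast
  show "reduce_mat N (iota A \<alpha> y) = reduce_mat N (Finite_Cartesian_Product.mat u + map_matrix ((*) v) A)"
    unfolding y(1) iota_int
    by (rule reduce_mat_eqI)
      (use y(2,3) in \<open>auto simp: Finite_Cartesian_Product.mat_def map_matrix_def intro!: cong_add cong_mult\<close>)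
qed

text \<open>Coordinates with respect to \<open>1, \<surd>D\<close>, a basis modulo the odd number \<open>N\<close>.\<close>

definition R :: "int \<Rightarrow> int \<Rightarrow> real set" where
  "R a b = P (a - t * b) (2 * b)"

lemma residue_class_R: "residue_class \<alpha> N (sqrt_D \<alpha> * of_int b + of_int a) = R a b"
  by (simp add: R_def P_def sqrt_D_eq algebra_simps)

lemma R_eq: "R a b = R c d \<longleftrightarrow> [a = c] (mod int N) \<and> [b = d] (mod int N)"
proof
  assume "R a b = R c d"
  then have 1: "[a - t * b = c - t * d] (mod int N)" and 2: "[2 * b = 2 * d] (mod int N)"
    by (auto simp: R_def P_eq)
  have b: "[b = d] (mod int N)" using 2 oddN by (simp add: cong_mult_lcancel)
  have "[(a - t * b) + t * b = (c - t * d) + t * d] (mod int N)" by (intro cong_add cong_mult cong_refl 1 b)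
  then show "[a = c] (mod int N) \<and> [b = d] (mod int N)" using b by simp
next
  assume "[a = c] (mod int N) \<and> [b = d] (mod int N)"
  then show "R a b = R c d" unfolding R_def P_eq by (auto intro!: cong_diff cong_mult)
qed

text \<open>The inverse change of coordinates, from \<alpha> = (t + sqrt D) / 2 with
  \<open>half N\<close> in place of 1/2.\<close>

lemma P_R: "P u v = R (u + half N * (v * t)) (half N * v)"
proof -
  have "[2 * half N * v = v] (mod int N)" "[2 * half N * (v * t) = v * t] (mod int N)" by (rule half_cong[OF oddN])+
  then show ?thesis unfolding R_def P_eq by (simp add: cong_iff_dvd_diff algebra_simps dvd_diff_commute)
qed

lemma Q_carrier_R: "x \<in> carrier \<Q> \<longleftrightarrow> (\<exists>a b. x = R a b)"
  unfolding Q_carrier using P_R R_def by metis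

lemma D_eq: "D = t * t - 4"
  by (simp add: discr_def power2_eq_square)

lemma R_mult: "R a b \<otimes>\<^bsub>\<Q>\<^esub> R c d = R (a * c + D * b * d) (a * d + b * c)"
  unfolding R_def Q_mult D_eq by (rule arg_cong2[where f = P]) (simp_all add: algebra_simps)

lemma R_one: "\<one>\<^bsub>\<Q>\<^esub> = R 1 0"
  by (simp add: Q_one R_def)

lemma norm_mod_R: "norm_mod \<alpha> N (R a b) = (a\<^sup>2 - D * b\<^sup>2) mod int N"
proof -
  have "(a - t * b)\<^sup>2 + t * (a - t * b) * (2 * b) + (2 * b)\<^sup>2 = a\<^sup>2 - D * b\<^sup>2"
    unfolding D_eq by (simp add: power2_eq_square algebra_simps)
  then show ?thesis by (simp add: R_def norm_mod_P)
qed

lemma iota_mod_R: "iota_mod A \<alpha> N (R a b) = reduce_mat N (Bmat A a b)"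
  by (simp add: R_def iota_mod_P Bmat_def mult.commute)

section \<open>The Hecke group as the norm-one group\<close>

lemma N_gt1: "int N > 1"
proof -
  have "p > 1" using prime_p prime_gt_1_nat by blast
  then have "N > 1" using k1 one_less_power[of p k] N_eq by simp
  then show ?thesis by simp
qed

lemma R_unit:
  assumes "nrm a b"
  shows "R a b \<in> Units \<Q>"
proof -
  have "R (a * a + D * b * - b) (a * - b + b * a) = R 1 0" "R (a * a + D * - b * b) (a * b + - b * a) = R 1 0"
    using assms unfolding R_eq nrm_def by (simp_all add: power2_eq_square algebra_simps)
  then have "R a b \<otimes>\<^bsub>\<Q>\<^esub> R a (- b) = \<one>\<^bsub>\<Q>\<^esub>" "R a (- b) \<otimes>\<^bsub>\<Q>\<^esub> R a b = \<one>\<^bsub>\<Q>\<^esub>"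
    by (simp_all only: R_mult R_one)
  moreover have "R a b \<in> carrier \<Q>" "R a (- b) \<in> carrier \<Q>" using Q_carrier_R by blast+
  ultimately show ?thesis unfolding Units_def by blast
qed

lemma C_carrier: "x \<in> carrier C \<longleftrightarrow> (\<exists>a b. nrm a b \<and> x = R a b)"
proof -
  have one: "\<one>\<^bsub>units_of (residue_ring (int N))\<^esub> = 1" by (simp add: units_of_one residue_ring_def)
  have c: "carrier C = {x \<in> Units \<Q>. norm_mod \<alpha> N x = 1}"
    by (simp add: hecke_group_def kernel_def one units_of_carrier)
  show ?thesis
  proof
    assume x: "x \<in> carrier C"
    then have "x \<in> carrier \<Q>" "norm_mod \<alpha> N x = 1" using c by (auto simp: Units_def)
    then obtain a b where "x = R a b" "(a\<^sup>2 - D * b\<^sup>2) mod int N = 1" using Q_carrier_R norm_mod_R by auto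
    then show "\<exists>a b. nrm a b \<and> x = R a b" using N_gt1 by (auto simp: nrm_def Cong.cong_def)
  next
    assume "\<exists>a b. nrm a b \<and> x = R a b"
    then show "x \<in> carrier C" using R_unit N_gt1 unfolding c by (auto simp: norm_mod_R nrm_def Cong.cong_def)
  qed
qed

lemma C_R: "R a b \<in> carrier C \<longleftrightarrow> nrm a b"
proof
  assume Rab: "R a b \<in> carrier C"
  obtain c d where "nrm c d" "R a b = R c d" using iffD1[OF C_carrier Rab] by blast
  then have cd: "nrm c d" "[a = c] (mod int N)" "[b = d] (mod int N)" by (simp_all add: R_eq)
  have "[a\<^sup>2 - D * b\<^sup>2 = c\<^sup>2 - D * d\<^sup>2] (mod int N)" by (intro cong_diff cong_mult cong_pow cong_refl cd)
  then show "nrm a b" using cd(1) cong_trans unfolding nrm_def by blast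
qed (use C_carrier in blast)

lemma C_mult: "monoid.mult C = monoid.mult \<Q>" and C_one: "one C = one \<Q>"
  by (simp_all add: hecke_group_def units_of_mult units_of_one)

lemma C_R_mult: "R a b \<otimes>\<^bsub>C\<^esub> R c d = R (a * c + D * b * d) (a * d + b * c)"
  by (simp only: C_mult R_mult)

lemma C_R_one: "\<one>\<^bsub>C\<^esub> = R 1 0"
  by (simp only: C_one R_one)

lemma comm_group_C: "comm_group C"
proof (rule comm_groupI)
  show "x \<otimes>\<^bsub>C\<^esub> y \<in> carrier C" if "x \<in> carrier C" "y \<in> carrier C" for x y
    using that nrm_mult C_R_mult unfolding C_carrier by metis
  show "\<one>\<^bsub>C\<^esub> \<in> carrier C" unfolding C_R_one C_R by (rule nrm_one)
  show "x \<otimes>\<^bsub>C\<^esub> y \<otimes>\<^bsub>C\<^esub> z = x \<otimes>\<^bsub>C\<^esub> (y \<otimes>\<^bsub>C\<^esub> z)" if "x \<in> carrier C" "y \<in> carrier C" "z \<in> carrier C" for x y z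
  proof -
    interpret Q: cring \<Q> by (rule cring_Q)
    show ?thesis using that Q_carrier_R unfolding C_carrier C_mult by (metis Q.m_assoc)
  qed
  show "x \<otimes>\<^bsub>C\<^esub> y = y \<otimes>\<^bsub>C\<^esub> x" if "x \<in> carrier C" "y \<in> carrier C" for x y
  proof -
    interpret Q: cring \<Q> by (rule cring_Q)
    show ?thesis using that Q_carrier_R unfolding C_carrier C_mult by (metis Q.m_comm)
  qed
  show "\<one>\<^bsub>C\<^esub> \<otimes>\<^bsub>C\<^esub> x = x" if "x \<in> carrier C" for x
    using that unfolding C_carrier C_R_one by (auto simp: C_R_mult)
  show "\<exists>y\<in>carrier C. y \<otimes>\<^bsub>C\<^esub> x = \<one>\<^bsub>C\<^esub>" if x: "x \<in> carrier C" for x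
  proof -
    obtain a b where ab: "nrm a b" "x = R a b" using iffD1[OF C_carrier x] by blast
    have "R (a * a + D * - b * b) (a * b + - b * a) = R 1 0"
      using ab(1) unfolding R_eq nrm_def by (simp_all add: power2_eq_square algebra_simps)
    then show ?thesis unfolding ab(2) C_R_one using ab(1) C_R C_R_mult nrm_uminus by metis
  qed
qed

lemma C_R_inv: "nrm a b \<Longrightarrow> inv\<^bsub>C\<^esub> (R a b) = R a (- b)"
proof -
  assume ab: "nrm a b"
  interpret C: comm_group C by (rule comm_group_C)
  have "R (a * a + D * b * - b) (a * - b + b * a) = R 1 0"
    using ab unfolding R_eq nrm_def by (simp_all add: power2_eq_square algebra_simps)
  then have "R a b \<otimes>\<^bsub>C\<^esub> R a (- b) = \<one>\<^bsub>C\<^esub>" by (simp only: C_R_mult C_R_one)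
  then show ?thesis using ab C_R nrm_uminus by (intro C.comm_inv_char) auto
qed

lemma finite_C: "finite (carrier C)"
proof -
  have "carrier C \<subseteq> (\<lambda>(a, b). R a b) ` ({0..<int N} \<times> {0..<int N})"
  proof
    fix x assume x: "x \<in> carrier C"
    obtain a b where "x = R a b" using iffD1[OF C_carrier x] by blast
    then have "x = R (a mod int N) (b mod int N)" unfolding R_eq by (simp add: R_eq Cong.cong_def)
    moreover have "(a mod int N, b mod int N) \<in> {0..<int N} \<times> {0..<int N}" using N_gt1 by auto
    ultimately show "x \<in> (\<lambda>(a, b). R a b) ` ({0..<int N} \<times> {0..<int N})" by force
  qed
  then show ?thesis using finite_subset by blast
qed

lemma coprime_N: "coprime z (int N) \<longleftrightarrow> \<not> int p dvd z"
  using coprime_prime_power[OF prime_p k1] N_eq by simp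

lemma p_dvd_N: "int p dvd int N"
  using k1 by (simp add: N_eq dvd_power)

lemma prime_int_p: "Factorial_Ring.prime (int p)"
  using prime_p by simp

lemma odd_p: "odd p"
  using oddN k1 by (simp add: N_eq)

section \<open>The Cayley parametrisation\<close>

lemma cay_cong:
  assumes "cay x a b" "cay x c d"
  shows "[a = c] (mod int N)" "[b = d] (mod int N)"
proof -
  have "[(a - 1) * (D * x\<^sup>2 - 1) = (c - 1) * (D * x\<^sup>2 - 1)] (mod int N)"
    using cong_trans[OF cay_unit[OF assms(1)] cong_sym[OF cay_unit[OF assms(2)]]] .
  then have "[a - 1 = c - 1] (mod int N)" using cay_coprime(3)[OF assms(1)] by (simp add: cong_mult_rcancel)
  then show ac: "[a = c] (mod int N)" by (simp add: cong_iff_dvd_diff)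
  have "[x + b = x * a] (mod int N)" "[x * c = x + d] (mod int N)" using assms by (auto simp: cay_def cong_sym)
  then have "[x + b = x + d] (mod int N)" using cong_trans cong_mult[OF cong_refl ac] by blast
  then show "[b = d] (mod int N)" by (simp add: cong_add_lcancel)
qed

lemma cayley_cay:
  assumes "coprime (D * x\<^sup>2 - 1) (int N)"
  shows "\<exists>a b. cay x a b \<and> cayley \<alpha> N x = R a b"
proof -
  interpret Q: cring \<Q> by (rule cring_Q)
  \<comment> \<open>As D x^2 - 1 = (sqrt D x - 1)(sqrt D x + 1), the inverse of the denominator is s
    (sqrt D x + 1).\<close>
  obtain s where s: "[(D * x\<^sup>2 - 1) * s = 1] (mod int N)" using cong_solve_coprime_int[OF assms] by blast
  then have s': "int N dvd (D * x\<^sup>2 - 1) * s - 1" by (simp add: cong_iff_dvd_diff)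
  have "R (- 1 * s + D * x * (s * x)) (- 1 * (s * x) + x * s) = R 1 0"
    unfolding R_eq using s by (simp add: power2_eq_square algebra_simps)
  then have "R (- 1) x \<otimes>\<^bsub>\<Q>\<^esub> R s (s * x) = \<one>\<^bsub>\<Q>\<^esub>" by (simp only: R_mult R_one)
  then have inv: "inv\<^bsub>\<Q>\<^esub> R (- 1) x = R s (s * x)" using Q_carrier_R by (intro Q.comm_inv_char) auto
  define a where "a = 1 * s + D * x * (s * x)"
  define b where "b = 1 * (s * x) + x * s"
  have r: "residue_class \<alpha> N (sqrt_D \<alpha> * of_int x + 1) = R 1 x" "residue_class \<alpha> N (sqrt_D \<alpha> * of_int x - 1) = R (- 1) x"
    using residue_class_R[of x 1] residue_class_R[of x "- 1"] by simp_all
  have "cayley \<alpha> N x = R a b" unfolding cayley_def r inv a_def b_def by (rule R_mult)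
  moreover have "cay x a b"
    unfolding cay_def
  proof (intro conjI)
    have "a\<^sup>2 - D * b\<^sup>2 - 1 = ((D * x\<^sup>2 - 1) * s - 1) * ((D * x\<^sup>2 - 1) * s + 1)"
      by (simp add: a_def b_def power2_eq_square algebra_simps)
    then show "nrm a b" unfolding nrm_def cong_iff_dvd_diff using s' by simp
    have e: "D * x * b - (a + 1) = (D * x\<^sup>2 - 1) * s - 1"
      by (simp add: a_def b_def power2_eq_square algebra_simps)
    show "[D * x * b = a + 1] (mod int N)" using s' by (simp only: cong_iff_dvd_diff e)
    have e: "x * a - (x + b) = ((D * x\<^sup>2 - 1) * s - 1) * x"
      by (simp add: a_def b_def power2_eq_square algebra_simps)
    show "[x * a = x + b] (mod int N)" using s' by (simp only: cong_iff_dvd_diff e dvd_mult2)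
  qed
  ultimately show ?thesis by blast
qed

lemma X_coprime: "x \<in> X_set A p k \<longleftrightarrow> x \<in> {0..<int N} \<and> coprime (D * x\<^sup>2 - 1) (int N)"
  unfolding X_set_def coprime_N by (auto simp: N_eq cong_iff_dvd_diff)

lemma cayley_eq: "cay x a b \<Longrightarrow> cayley \<alpha> N x = R a b"
  using cayley_cay[OF cay_coprime(3)] cay_cong R_eq by metis

section \<open>The congruence subgroup of level p\<close>

definition H :: "real set set" where
  "H = {R a b | a b. nrm a b \<and> int p dvd a - 1 \<and> int p dvd b}"

lemma H_R: "R a b \<in> H \<longleftrightarrow> nrm a b \<and> int p dvd a - 1 \<and> int p dvd b"
proof
  assume "R a b \<in> H"
  then obtain c d where cd: "nrm c d" "int p dvd c - 1" "int p dvd d" "R a b = R c d" by (auto simp: H_def)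
  have "[a = c] (mod int N)" "[b = d] (mod int N)" using cd(4) by (simp_all add: R_eq)
  then have "[a = c] (mod int p)" "[b = d] (mod int p)" using p_dvd_N cong_dvd_modulus by blast+
  then have "int p dvd (a - c) + (c - 1)" "int p dvd (b - d) + d"
    using cd(2,3) by (intro dvd_add; simp add: cong_iff_dvd_diff)+
  moreover have "nrm a b" using cd C_R by metis
  ultimately show "nrm a b \<and> int p dvd a - 1 \<and> int p dvd b" by simp
qed (auto simp: H_def)

text \<open>Modulo \<open>p\<close> the norm equation reads D b^2 = (a - 1)(a + 1), and D is a unit.
  Membership in \<open>H\<close> can thus be tested on the first coordinate.\<close>

lemma nrm_not_H:
  assumes "nrm a b" "int p dvd a - 1"
  shows "int p dvd b"
proof -
  have "int p dvd a\<^sup>2 - D * b\<^sup>2 - 1" using assms(1) p_dvd_N dvd_trans unfolding nrm_def cong_iff_dvd_diff by blast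
  moreover have "D * b\<^sup>2 = (a - 1) * (a + 1) - (a\<^sup>2 - D * b\<^sup>2 - 1)" by (simp add: power2_eq_square algebra_simps)
  ultimately have "int p dvd D * b\<^sup>2" using assms(2) by (metis dvd_diff dvd_mult2)
  then show ?thesis using prime_int_p pD by (simp add: prime_dvd_mult_iff power2_eq_square)
qed

lemma cay_exists:
  assumes ab: "nrm a b" and a: "\<not> int p dvd a - 1"
  shows "\<exists>x\<in>X_set A p k. cay x a b"
proof -
  have "coprime (a - 1) (int N)" using a coprime_N by blast
  then obtain s where "[(a - 1) * s = 1] (mod int N)" using cong_solve_coprime_int by blast
  then have s: "int N dvd (a - 1) * s - 1" by (simp add: cong_iff_dvd_diff)
  \<comment> \<open>The parameter is b / (a - 1), as dictated by x a = x + b.\<close>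
  define x where "x = (b * s) mod int N"
  have "[x = b * s] (mod int N)" by (simp add: x_def Cong.cong_def)
  then have x: "int N dvd x - b * s" by (simp add: cong_iff_dvd_diff)
  have "x * a - (x + b) = (x - b * s) * (a - 1) + ((a - 1) * s - 1) * b" by (simp add: algebra_simps)
  then have 1: "int N dvd x * a - (x + b)" using x s by simp
  \<comment> \<open>The other congruence follows from the norm equation once it is multiplied by the
    unit \<open>a - 1\<close>.\<close>
  have "(a - 1) * (D * x * b - (a + 1)) = (x * a - (x + b)) * (D * b) - (a\<^sup>2 - D * b\<^sup>2 - 1)"
    by (simp add: power2_eq_square algebra_simps)
  moreover have "int N dvd a\<^sup>2 - D * b\<^sup>2 - 1" using ab by (simp add: nrm_def cong_iff_dvd_diff)
  ultimately have "int N dvd (a - 1) * (D * x * b - (a + 1))" using 1 by (metis dvd_diff dvd_mult2)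
  then have "int N dvd D * x * b - (a + 1)"
    using \<open>coprime (a - 1) (int N)\<close> by (metis coprime_commute coprime_dvd_mult_right_iff)
  then have c: "cay x a b" using ab 1 by (simp add: cay_def cong_iff_dvd_diff)
  have "x \<in> {0..<int N}" using N_gt1 by (simp add: x_def)
  then show ?thesis using c cay_coprime(3)[OF c] X_coprime by blast
qed

lemma cay_determines:
  assumes "cay x a b" "cay y c d" "R a b = R c d" "x \<in> {0..<int N}" "y \<in> {0..<int N}"
  shows "x = y"
proof -
  have ac: "[a = c] (mod int N)" "[b = d] (mod int N)" using assms(3) by (simp_all add: R_eq)
  have "[x * (a - 1) = b] (mod int N)" "[y * (c - 1) = d] (mod int N)"
    using assms(1,2) by (auto simp: cay_def cong_iff_dvd_diff algebra_simps)
  then have "[x * (a - 1) = y * (c - 1)] (mod int N)" using ac(2) cong_trans cong_sym by meson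
  moreover have "[y * (c - 1) = y * (a - 1)] (mod int N)" by (intro cong_mult cong_diff cong_refl cong_sym[OF ac(1)])
  ultimately have "[x * (a - 1) = y * (a - 1)] (mod int N)" using cong_trans by blast
  then have "[x = y] (mod int N)" using cay_coprime(1)[OF assms(1)] by (simp add: cong_mult_rcancel)
  then show ?thesis using assms(4,5) by (simp add: Cong.cong_def)
qed

text \<open>Membership in X(p^k) says that sqrt D x - 1 is invertible. The image consists of the
  classes with a - 1 a unit because a - 1 = 2 / (D x^2 - 1), and x = b / (a - 1) inverts the
  map.\<close>

lemma bij_cayley: "bij_betw (cayley \<alpha> N) (X_set A p k) (carrier C - H)"
  unfolding bij_betw_def
proof
  show "inj_on (cayley \<alpha> N) (X_set A p k)"
  proof (rule inj_onI)
    fix x y assume xy: "x \<in> X_set A p k" "y \<in> X_set A p k" "cayley \<alpha> N x = cayley \<alpha> N y"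
    then obtain a b c d where "cay x a b" "cayley \<alpha> N x = R a b" "cay y c d" "cayley \<alpha> N y = R c d"
      using cayley_cay X_coprime by meson
    then show "x = y" using xy X_coprime cay_determines by metis
  qed
  show "cayley \<alpha> N ` X_set A p k = carrier C - H"
  proof (intro equalityI subsetI)
    fix z assume "z \<in> cayley \<alpha> N ` X_set A p k"
    then obtain x a b where z: "cay x a b" "z = R a b" using cayley_cay X_coprime by (metis imageE)
    then show "z \<in> carrier C - H"
      using cay_coprime(1)[OF z(1)] coprime_N C_R H_R by (auto simp: cay_def)
  next
    fix z assume z: "z \<in> carrier C - H"
    then have "z \<in> carrier C" by blast
    then obtain a b where ab: "nrm a b" "z = R a b" using iffD1[OF C_carrier] by blast
    then have "\<not> int p dvd a - 1" using z H_R[of a b] nrm_not_H[of a b] by blast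
    then obtain x where "x \<in> X_set A p k" "cay x a b" using cay_exists[OF ab(1)] by blast
    then show "z \<in> cayley \<alpha> N ` X_set A p k" using ab(2) cayley_eq by blast
  qed
qed

text \<open>Multiplication by \<open>-1\<close> carries \<open>H\<close> into the range of the Cayley transform,
  to the parameters divisible by \<open>p\<close>.\<close>

definition Y :: "int set" where
  "Y = {x \<in> {0..<int N}. int p dvd x}"

lemma Y_X: "Y \<subseteq> X_set A p k"
proof
  fix x assume "x \<in> Y"
  then have x: "x \<in> {0..<int N}" "int p dvd x" by (auto simp: Y_def)
  have "\<not> int p dvd D * x\<^sup>2 - 1"
  proof
    assume "int p dvd D * x\<^sup>2 - 1"
    moreover have "int p dvd D * x\<^sup>2" using x(2) by (simp add: power2_eq_square)
    ultimately have "int p dvd 1" by (metis dvd_diff_right_iff)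
    then show False using prime_int_p not_prime_unit by blast
  qed
  then show "x \<in> X_set A p k" using x X_coprime coprime_N by blast
qed

lemma neg_R: "R (- 1) 0 \<otimes>\<^bsub>C\<^esub> R a b = R (- a) (- b)"
  by (simp add: C_R_mult)

text \<open>A Cayley transform is -1 modulo \<open>p\<close> exactly when its parameter is 0 modulo
  \<open>p\<close>. The bijection yields the order of \<open>H\<close> and coordinates in which the
  traces on \<open>H\<close> can be bounded.\<close>

lemma bij_neg_cayley: "bij_betw (\<lambda>x. R (- 1) 0 \<otimes>\<^bsub>C\<^esub> cayley \<alpha> N x) Y H"
  unfolding bij_betw_def
proof
  show "inj_on (\<lambda>x. R (- 1) 0 \<otimes>\<^bsub>C\<^esub> cayley \<alpha> N x) Y"
  proof (rule inj_onI)
    fix x y assume xy: "x \<in> Y" "y \<in> Y" "R (- 1) 0 \<otimes>\<^bsub>C\<^esub> cayley \<alpha> N x = R (- 1) 0 \<otimes>\<^bsub>C\<^esub> cayley \<alpha> N y"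
    then obtain a b c d where c: "cay x a b" "cayley \<alpha> N x = R a b" "cay y c d" "cayley \<alpha> N y = R c d"
      using cayley_cay X_coprime Y_X by (metis subsetD)
    then have "R (- a) (- b) = R (- c) (- d)" using xy(3) neg_R by simp
    then have "R a b = R c d" unfolding R_eq by (simp add: cong_minus_minus_iff)
    then show "x = y" using c xy cay_determines by (auto simp: Y_def)
  qed
  show "(\<lambda>x. R (- 1) 0 \<otimes>\<^bsub>C\<^esub> cayley \<alpha> N x) ` Y = H"
  proof (intro equalityI subsetI)
    fix z assume "z \<in> (\<lambda>x. R (- 1) 0 \<otimes>\<^bsub>C\<^esub> cayley \<alpha> N x) ` Y"
    then obtain x where x: "x \<in> Y" "z = R (- 1) 0 \<otimes>\<^bsub>C\<^esub> cayley \<alpha> N x" by blast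
    then obtain a b where ab: "cay x a b" "cayley \<alpha> N x = R a b" using cayley_cay X_coprime Y_X by (metis subsetD)
    have px: "int p dvd x" using x(1) by (simp add: Y_def)
    have "int N dvd D * x * b - (a + 1)" "int N dvd x * a - (x + b)"
      using ab(1) by (auto simp: cay_def cong_iff_dvd_diff)
    then have "int p dvd D * x * b - (a + 1)" "int p dvd x * a - (x + b)" using p_dvd_N dvd_trans by blast+
    moreover have "- a - 1 = (D * x * b - (a + 1)) - x * (D * b)" "- b = (x * a - (x + b)) - x * (a - 1)"
      by (simp_all add: algebra_simps)
    ultimately have "int p dvd - a - 1" "int p dvd - b" using px by (metis dvd_diff dvd_mult2)+
    then show "z \<in> H" using x(2) ab H_R[of "- a" "- b"] neg_R by (simp add: cay_def nrm_def)
  next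
    fix z assume "z \<in> H"
    then obtain a b where ab: "nrm a b" "int p dvd a - 1" "int p dvd b" "z = R a b" by (auto simp: H_def)
    have n: "nrm (- a) (- b)" using ab(1) by (simp add: nrm_def)
    have "\<not> int p dvd - a - 1"
    proof
      assume "int p dvd - a - 1"
      then have "int p dvd (- a - 1) + (a - 1)" using ab(2) dvd_add by blast
      then show False using prime_not_dvd_two[OF prime_p odd_p] by simp
    qed
    then obtain x where x: "x \<in> X_set A p k" "cay x (- a) (- b)" using cay_exists[OF n] by blast
    have "int N dvd x * (- a) - (x + - b)" using x(2) by (simp add: cay_def cong_iff_dvd_diff)
    then have "int p dvd x * (- a) - (x + - b)" using p_dvd_N dvd_trans by blast
    moreover have "x * 2 = b - x * (a - 1) - (x * (- a) - (x + - b))" by (simp add: algebra_simps)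
    ultimately have "int p dvd x * 2" using ab(2,3) by (metis dvd_diff dvd_mult)
    then have "int p dvd x" using prime_not_dvd_two[OF prime_p odd_p] prime_int_p by (simp add: prime_dvd_mult_iff)
    then have "x \<in> Y" using x(1) X_coprime by (simp add: Y_def)
    moreover have "z = R (- 1) 0 \<otimes>\<^bsub>C\<^esub> cayley \<alpha> N x" using cayley_eq[OF x(2)] neg_R ab(4) by simp
    ultimately show "z \<in> (\<lambda>x. R (- 1) 0 \<otimes>\<^bsub>C\<^esub> cayley \<alpha> N x) ` Y" by blast
  qed
qed

lemma subgroup_H: "subgroup H C"
proof -
  interpret C: comm_group C by (rule comm_group_C)
  show ?thesis
  proof (rule C.subgroupI)
    show "H \<subseteq> carrier C" by (auto simp: H_def C_R)
    have "R 1 0 \<in> H" by (simp add: H_R)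
    then show "H \<noteq> {}" by blast
    show "inv\<^bsub>C\<^esub> x \<in> H" if "x \<in> H" for x
      using that unfolding H_def by (auto simp: C_R_inv) (metis H_R H_def dvd_minus_iff mem_Collect_eq nrm_uminus)
    show "x \<otimes>\<^bsub>C\<^esub> y \<in> H" if xy: "x \<in> H" "y \<in> H" for x y
    proof -
      obtain a b c d where o: "x = R a b" "y = R c d" "nrm a b" "nrm c d"
        "int p dvd a - 1" "int p dvd c - 1" "int p dvd b" "int p dvd d"
        using xy by (auto simp: H_def)
      have "a * c + D * b * d - 1 = (a - 1) * c + (c - 1) + b * (D * d)" "a * d + b * c = d * a + b * c"
        by (simp_all add: algebra_simps)
      then have "int p dvd a * c + D * b * d - 1" "int p dvd a * d + b * c"
        using o by (metis dvd_add dvd_mult2)+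
      then show ?thesis using o nrm_mult by (simp add: C_R_mult H_R)
    qed
  qed
qed

text \<open>The class of \<alpha> has norm 1 and is mapped to \<open>A\<close>, so the propagator of
  \<open>A\<close> is itself one of the Hecke operators.\<close>

lemma A_in_C: "R (half N * t) (half N) \<in> carrier C" "iota_mod A \<alpha> N (R (half N * t) (half N)) = reduce_mat N A"
proof -
  have e: "R (half N * t) (half N) = P 0 1" using P_R[of 0 1] by simp
  have u: "P 0 1 \<in> carrier C \<longleftrightarrow> norm_mod \<alpha> N (P 0 1) = 1"
  proof -
    have "P 0 1 \<in> carrier C \<longleftrightarrow> nrm (half N * t) (half N)" using e C_R by metis
    also have "\<dots> \<longleftrightarrow> norm_mod \<alpha> N (P 0 1) = 1"
      unfolding e[symmetric] norm_mod_R nrm_def using N_gt1 by (simp add: Cong.cong_def)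
    finally show ?thesis .
  qed
  show "R (half N * t) (half N) \<in> carrier C" unfolding e u norm_mod_P using N_gt1 by simp
  show "iota_mod A \<alpha> N (R (half N * t) (half N)) = reduce_mat N A"
    unfolding e iota_mod_P
    by (rule arg_cong[where f = "reduce_mat N"])
      (simp add: Finite_Cartesian_Product.vec_eq_iff Finite_Cartesian_Product.mat_def map_matrix_def)
qed
end

section \<open>Hermitian idempotents\<close>

text \<open>An orthogonal projection given by its entries. Functions of two indices allow rank-one
  parts to be subtracted pointwise.\<close>

definition herm_idem :: "nat \<Rightarrow> (nat \<Rightarrow> nat \<Rightarrow> complex) \<Rightarrow> bool" where
  "herm_idem n P \<longleftrightarrow> (\<forall>i<n. \<forall>j<n. P j i = cnj (P i j)) \<and>
     (\<forall>i<n. \<forall>j<n. (\<Sum>z<n. P i z * P z j) = P i j)"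

lemma herm_idemD:
  assumes "herm_idem n P" "i < n" "j < n"
  shows "P j i = cnj (P i j)" "(\<Sum>z<n. P i z * P z j) = P i j"
  using assms unfolding herm_idem_def by blast+

text \<open>From P = P P* the trace is a sum of squares. It is thus nonnegative, and it vanishes
  only for the zero projection.\<close>

lemma herm_idem_trace:
  assumes "herm_idem n P"
  shows "(\<Sum>i<n. P i i) = of_real (\<Sum>i<n. \<Sum>j<n. (cmod (P i j))\<^sup>2)"
proof -
  have "P i i = of_real (\<Sum>j<n. (cmod (P i j))\<^sup>2)" if i: "i < n" for i
  proof -
    have "P i i = (\<Sum>j<n. P i j * P j i)" by (rule herm_idemD(2)[OF assms i i, symmetric])
    also have "\<dots> = (\<Sum>j<n. P i j * cnj (P i j))"
      by (intro sum.cong refl arg_cong[where f = "\<lambda>z. P i _ * z"] herm_idemD(1)[OF assms i]) simp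
    also have "\<dots> = of_real (\<Sum>j<n. (cmod (P i j))\<^sup>2)" by (simp only: complex_norm_square[symmetric] of_real_sum)
    finally show ?thesis .
  qed
  then show ?thesis by simp
qed

lemma herm_idem_trace_0:
  assumes "herm_idem n P" "(\<Sum>i<n. P i i) = 0" "i < n" "j < n"
  shows "P i j = 0"
proof -
  have "complex_of_real (\<Sum>i<n. \<Sum>j<n. (cmod (P i j))\<^sup>2) = 0"
    by (rule trans[OF sym[OF herm_idem_trace[OF assms(1)]] assms(2)])
  then have 1: "(\<Sum>i<n. \<Sum>j<n. (cmod (P i j))\<^sup>2) = 0" by (simp only: of_real_eq_0_iff)
  have "\<forall>a\<in>{..<n}. (\<Sum>j<n. (cmod (P a j))\<^sup>2) = 0"
    by (rule iffD1[OF sum_nonneg_eq_0_iff 1]) (auto intro: sum_nonneg)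
  then have 2: "(\<Sum>j<n. (cmod (P i j))\<^sup>2) = 0" using assms(3) by blast
  have "\<forall>b\<in>{..<n}. (cmod (P i b))\<^sup>2 = 0"
    by (rule iffD1[OF sum_nonneg_eq_0_iff 2]) auto
  then show ?thesis using assms(4) by simp
qed

lemma herm_idem_deflate:
  assumes P: "herm_idem n P" and fixd: "\<And>i. i < n \<Longrightarrow> (\<Sum>j<n. P i j * \<psi> j) = \<psi> i"
    and nrm: "(\<Sum>i<n. \<psi> i * cnj (\<psi> i)) = 1"
  shows "herm_idem n (\<lambda>i j. P i j - \<psi> i * cnj (\<psi> j))"
    and "(\<Sum>i<n. P i i - \<psi> i * cnj (\<psi> i)) = (\<Sum>i<n. P i i) - 1"
proof -
  have adj: "(\<Sum>z<n. cnj (\<psi> z) * P z j) = cnj (\<psi> j)" if j: "j < n" for j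
  proof -
    have "(\<Sum>z<n. cnj (\<psi> z) * P z j) = (\<Sum>z<n. cnj (P j z * \<psi> z))"
    proof (rule sum.cong[OF refl])
      fix z assume "z \<in> {..<n}"
      then have "P z j = cnj (P j z)" using herm_idemD(1)[OF P j] by simp
      then show "cnj (\<psi> z) * P z j = cnj (P j z * \<psi> z)" by (simp only: complex_cnj_mult mult.commute)
    qed
    then show ?thesis using fixd[OF j] by (metis cnj_sum)
  qed
  show "herm_idem n (\<lambda>i j. P i j - \<psi> i * cnj (\<psi> j))"
    unfolding herm_idem_def
  proof (intro conjI allI impI)
    fix i j assume ij: "i < n" "j < n"
    show "P j i - \<psi> j * cnj (\<psi> i) = cnj (P i j - \<psi> i * cnj (\<psi> j))"
      using herm_idemD(1)[OF P ij] by (simp add: mult.commute)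
    have "(\<Sum>z<n. (P i z - \<psi> i * cnj (\<psi> z)) * (P z j - \<psi> z * cnj (\<psi> j)))
      = (\<Sum>z<n. P i z * P z j) - (\<Sum>z<n. P i z * \<psi> z) * cnj (\<psi> j)
        - \<psi> i * (\<Sum>z<n. cnj (\<psi> z) * P z j) + \<psi> i * (\<Sum>z<n. \<psi> z * cnj (\<psi> z)) * cnj (\<psi> j)"
      by (simp add: sum_distrib_left sum_distrib_right sum.distrib sum_subtractf algebra_simps)
    also have "\<dots> = P i j - \<psi> i * cnj (\<psi> j)"
      using herm_idemD(2)[OF P ij] fixd[OF ij(1)] adj[OF ij(2)] nrm by simp
    finally show "(\<Sum>z<n. (P i z - \<psi> i * cnj (\<psi> z)) * (P z j - \<psi> z * cnj (\<psi> j))) = P i j - \<psi> i * cnj (\<psi> j)" .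
  qed
  show "(\<Sum>i<n. P i i - \<psi> i * cnj (\<psi> i)) = (\<Sum>i<n. P i i) - 1"
    using nrm by (simp add: sum_subtractf)
qed

text \<open>Idempotence fixes every column, so a nonzero column can be normalised.\<close>

lemma herm_idem_fixed_vector:
  assumes P: "herm_idem n P" and nz: "a < n" "b < n" "P a b \<noteq> 0"
  shows "\<exists>\<psi>. (\<forall>i<n. (\<Sum>j<n. P i j * \<psi> j) = \<psi> i) \<and> (\<Sum>i<n. \<psi> i * cnj (\<psi> i)) = 1"
proof -
  define s where "s = (\<Sum>i<n. (cmod (P i b))\<^sup>2)"
  have "s \<ge> (cmod (P a b))\<^sup>2" unfolding s_def using nz(1) by (intro member_le_sum) auto
  then have s: "s > 0" using nz(3) by (smt (verit) zero_less_norm_iff zero_less_power)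
  define \<psi> where "\<psi> i = P i b / of_real (sqrt s)" for i
  have "(\<Sum>j<n. P i j * \<psi> j) = \<psi> i" if i: "i < n" for i
    using herm_idemD(2)[OF P i nz(2)] by (simp add: \<psi>_def sum_divide_distrib[symmetric])
  moreover have "(\<Sum>i<n. \<psi> i * cnj (\<psi> i)) = 1"
  proof -
    have "(\<Sum>i<n. \<psi> i * cnj (\<psi> i)) = (\<Sum>i<n. of_real ((cmod (P i b))\<^sup>2) / of_real s)"
      using s by (intro sum.cong refl)
        (simp add: \<psi>_def complex_norm_square[symmetric] of_real_mult[symmetric] del: of_real_mult of_real_power)
    also have "\<dots> = of_real s / of_real s" by (simp only: sum_divide_distrib[symmetric] s_def of_real_sum)
    finally show ?thesis using s by simp
  qed
  ultimately show ?thesis by blast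
qed

text \<open>The trace is the rank, counted by splitting off one unit vector at a time. Each split
  lowers the trace by 1 while it stays nonnegative, so an upper bound on its real part serves as the
  induction measure.\<close>

lemma herm_idem_trace_nat:
  assumes "herm_idem n P"
  shows "\<exists>r::nat. (\<Sum>i<n. P i i) = of_nat r"
proof -
  have "\<exists>r::nat. (\<Sum>i<n. P i i) = of_nat r" if "herm_idem n P" "Re (\<Sum>i<n. P i i) < real m" for m P
    using that
  proof (induction m arbitrary: P)
    case 0
    have "Re (\<Sum>i<n. P i i) \<ge> 0" unfolding herm_idem_trace[OF 0(1)] by (simp add: sum_nonneg)
    then show ?case using 0(2) by simp
  next
    case (Suc m)
    show ?case
    proof (cases "\<exists>a<n. \<exists>b<n. P a b \<noteq> 0")
      case False
      then have "(\<Sum>i<n. P i i) = of_nat 0" by simp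
      then show ?thesis by blast
    next
      case True
      then obtain \<psi> where psi: "\<And>i. i < n \<Longrightarrow> (\<Sum>j<n. P i j * \<psi> j) = \<psi> i" "(\<Sum>i<n. \<psi> i * cnj (\<psi> i)) = 1"
        using herm_idem_fixed_vector[OF Suc.prems(1)] by blast
      have d: "herm_idem n (\<lambda>i j. P i j - \<psi> i * cnj (\<psi> j))"
        "(\<Sum>i<n. P i i - \<psi> i * cnj (\<psi> i)) = (\<Sum>i<n. P i i) - 1"
        using herm_idem_deflate[OF Suc.prems(1), of \<psi>] psi by blast+
      have "Re (\<Sum>i<n. P i i - \<psi> i * cnj (\<psi> i)) < real m"
      proof -
        have "Re (\<Sum>i<n. P i i - \<psi> i * cnj (\<psi> i)) = Re ((\<Sum>i<n. P i i) - 1)"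
          by (rule arg_cong[OF d(2)])
        also have "\<dots> = Re (\<Sum>i<n. P i i) - 1" by (simp only: minus_complex.sel one_complex.sel)
        finally show ?thesis using Suc.prems(2) by linarith
      qed
      from Suc.IH[OF d(1) this] obtain r :: nat where "(\<Sum>i<n. P i i - \<psi> i * cnj (\<psi> i)) = of_nat r" by blast
      then have "(\<Sum>i<n. P i i) - 1 = of_nat r" by (rule trans[OF sym[OF d(2)]])
      then have "(\<Sum>i<n. P i i) = of_nat (Suc r)" by (simp add: algebra_simps)
      then show ?thesis by blast
    qed
  qed
  then show ?thesis using assms reals_Archimedean2 by blast
qed

text \<open>Splitting off \<open>\<psi>\<close> leaves a projection of trace 0, which is 0.\<close>

lemma herm_idem_trace_1:
  assumes P: "herm_idem n P" and tr: "(\<Sum>i<n. P i i) = 1"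
    and fixd: "\<And>i. i < n \<Longrightarrow> (\<Sum>j<n. P i j * \<psi> j) = \<psi> i" and nrm: "(\<Sum>i<n. \<psi> i * cnj (\<psi> i)) = 1"
    and ij: "i < n" "j < n"
  shows "P i j = \<psi> i * cnj (\<psi> j)"
proof -
  have d: "herm_idem n (\<lambda>i j. P i j - \<psi> i * cnj (\<psi> j))"
    "(\<Sum>i<n. P i i - \<psi> i * cnj (\<psi> i)) = (\<Sum>i<n. P i i) - 1"
    using herm_idem_deflate[OF P, of \<psi>] fixd nrm by blast+
  have "P i j - \<psi> i * cnj (\<psi> j) = 0"
    by (rule herm_idem_trace_0[OF d(1) _ ij]) (simp only: d(2) tr diff_self)
  then show ?thesis by (simp only: right_minus_eq)
qed

section \<open>Isotypic projections of a unitary representation of a finite abelian group\<close>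

lemma mult_mat_vec_index:
  assumes "M \<in> carrier_mat n n" "\<psi> \<in> carrier_vec n" "i < n"
  shows "vec_index (M *\<^sub>v \<psi>) i = (\<Sum>j<n. M $$ (i, j) * vec_index \<psi> j)"
  using assms by (auto simp: scalar_prod_def atLeast0LessThan intro!: sum.cong)

lemma state_inner_eq:
  assumes "\<psi> \<in> carrier_vec n"
  shows "state_inner n \<phi> \<psi> = (\<Sum>i<n. vec_index \<phi> i * cnj (vec_index \<psi> i)) / of_nat n"
proof -
  have "\<phi> \<bullet>c \<psi> = (\<Sum>i<n. vec_index \<phi> i * cnj (vec_index \<psi> i))"
    unfolding scalar_prod_def using assms by (simp add: atLeast0LessThan)
  then show ?thesis by (simp only: state_inner_def)
qed

locale unitary_rep =
  fixes G :: "'g monoid" and \<pi> :: "'g \<Rightarrow> complex Matrix.mat" and n :: nat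
  assumes comm: "comm_group G" and fin: "finite (carrier G)" and n0: "n > 0"
    and pi_carrier: "\<And>x. x \<in> carrier G \<Longrightarrow> \<pi> x \<in> carrier_mat n n"
    and pi_mult: "\<And>x y. x \<in> carrier G \<Longrightarrow> y \<in> carrier G \<Longrightarrow> \<pi> (x \<otimes>\<^bsub>G\<^esub> y) = \<pi> x * \<pi> y"
    and pi_inv: "\<And>x i j. x \<in> carrier G \<Longrightarrow> i < n \<Longrightarrow> j < n \<Longrightarrow> \<pi> (inv\<^bsub>G\<^esub> x) $$ (i, j) = cnj (\<pi> x $$ (j, i))"
begin

definition proj :: "('g \<Rightarrow> complex) \<Rightarrow> nat \<Rightarrow> nat \<Rightarrow> complex" where
  "proj \<theta> i j = (\<Sum>x\<in>carrier G. cnj (\<theta> x) * \<pi> x $$ (i, j)) / of_nat (card (carrier G))"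

definition eigen :: "('g \<Rightarrow> complex) \<Rightarrow> complex Matrix.vec \<Rightarrow> bool" where
  "eigen \<theta> \<psi> \<longleftrightarrow> \<psi> \<in> carrier_vec n \<and> (\<forall>x\<in>carrier G. \<pi> x *\<^sub>v \<psi> = \<theta> x \<cdot>\<^sub>v \<psi>)"

lemma card_nz: "of_nat (card (carrier G)) \<noteq> (0::complex)"
proof -
  interpret comm_group G by (rule comm)
  show ?thesis using fin by auto
qed

lemma proj_times:
  "proj \<theta> i j * c = (\<Sum>x\<in>carrier G. cnj (\<theta> x) * (\<pi> x $$ (i, j) * c)) / of_nat (card (carrier G))"
  by (simp add: proj_def sum_distrib_right mult.assoc)

text \<open>Substitute \<open>y \<otimes> x\<close> for \<open>x\<close> in the average. In other
  words, the columns of the projection are eigenvectors with character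
  \<open>\<theta>\<close>.\<close>

lemma proj_mult:
  assumes th: "\<theta> \<in> characters G" and y: "y \<in> carrier G" and ij: "i < n" "j < n"
  shows "(\<Sum>z<n. \<pi> y $$ (i, z) * proj \<theta> z j) = \<theta> y * proj \<theta> i j"
proof -
  interpret comm_group G by (rule comm)
  have ent: "(\<Sum>z<n. \<pi> y $$ (i, z) * \<pi> x $$ (z, j)) = \<pi> (y \<otimes>\<^bsub>G\<^esub> x) $$ (i, j)" if x: "x \<in> carrier G" for x
    using pi_carrier[OF y] pi_carrier[OF x] ij by (simp add: pi_mult[OF y x] scalar_prod_def atLeast0LessThan)
  have ty: "\<theta> y * cnj (\<theta> y) = 1" using characters_D(1)[OF th y] by (simp add: complex_norm_square[symmetric])
  have bij: "bij_betw (\<lambda>x. y \<otimes>\<^bsub>G\<^esub> x) (carrier G) (carrier G)"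
    by (rule bij_betwI[of _ _ _ "\<lambda>x. inv\<^bsub>G\<^esub> y \<otimes>\<^bsub>G\<^esub> x"]) (use y in \<open>auto simp: m_assoc[symmetric]\<close>)
  have "(\<Sum>z<n. \<pi> y $$ (i, z) * proj \<theta> z j)
    = (\<Sum>z<n. \<Sum>x\<in>carrier G. cnj (\<theta> x) * (\<pi> y $$ (i, z) * \<pi> x $$ (z, j))) / of_nat (card (carrier G))"
    by (simp add: proj_def sum_distrib_left sum_divide_distrib mult_ac)
  also have "(\<Sum>z<n. \<Sum>x\<in>carrier G. cnj (\<theta> x) * (\<pi> y $$ (i, z) * \<pi> x $$ (z, j)))
    = (\<Sum>x\<in>carrier G. cnj (\<theta> x) * \<pi> (y \<otimes>\<^bsub>G\<^esub> x) $$ (i, j))"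
    by (subst sum.swap) (simp add: sum_distrib_left[symmetric] ent)
  also have "\<dots> = (\<Sum>x\<in>carrier G. \<theta> y * (cnj (\<theta> (y \<otimes>\<^bsub>G\<^esub> x)) * \<pi> (y \<otimes>\<^bsub>G\<^esub> x) $$ (i, j)))"
  proof (rule sum.cong[OF refl])
    fix x assume x: "x \<in> carrier G"
    have "\<theta> y * cnj (\<theta> (y \<otimes>\<^bsub>G\<^esub> x)) = (\<theta> y * cnj (\<theta> y)) * cnj (\<theta> x)"
      by (simp add: characters_D(2)[OF th y x])
    then have "\<theta> y * cnj (\<theta> (y \<otimes>\<^bsub>G\<^esub> x)) = cnj (\<theta> x)" using ty by simp
    then show "cnj (\<theta> x) * \<pi> (y \<otimes>\<^bsub>G\<^esub> x) $$ (i, j)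
      = \<theta> y * (cnj (\<theta> (y \<otimes>\<^bsub>G\<^esub> x)) * \<pi> (y \<otimes>\<^bsub>G\<^esub> x) $$ (i, j))" by (simp add: mult.assoc[symmetric])
  qed
  also have "\<dots> = (\<Sum>x\<in>carrier G. \<theta> y * (cnj (\<theta> x) * \<pi> x $$ (i, j)))"
    using sum.reindex_bij_betw[OF bij, of "\<lambda>x. \<theta> y * (cnj (\<theta> x) * \<pi> x $$ (i, j))"] .
  finally show ?thesis by (simp add: proj_def sum_distrib_left)
qed

lemma herm_idem_proj:
  assumes th: "\<theta> \<in> characters G"
  shows "herm_idem n (proj \<theta>)"
  unfolding herm_idem_def
proof (intro conjI allI impI)
  interpret comm_group G by (rule comm)
  fix i j assume ij: "i < n" "j < n"
  have bij: "bij_betw (\<lambda>x. inv\<^bsub>G\<^esub> x) (carrier G) (carrier G)"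
    by (rule bij_betwI[of _ _ _ "\<lambda>x. inv\<^bsub>G\<^esub> x"]) auto
  have "(\<Sum>x\<in>carrier G. cnj (\<theta> x) * \<pi> x $$ (j, i)) = (\<Sum>x\<in>carrier G. cnj (\<theta> (inv\<^bsub>G\<^esub> x)) * \<pi> (inv\<^bsub>G\<^esub> x) $$ (j, i))"
    using sum.reindex_bij_betw[OF bij, of "\<lambda>x. cnj (\<theta> x) * \<pi> x $$ (j, i)"] by simp
  also have "\<dots> = cnj (\<Sum>x\<in>carrier G. cnj (\<theta> x) * \<pi> x $$ (i, j))"
    unfolding cnj_sum using ij by (intro sum.cong refl) (simp add: pi_inv character_inv[OF comm th])
  finally show "proj \<theta> j i = cnj (proj \<theta> i j)" by (simp add: proj_def)
  have "(\<Sum>z<n. proj \<theta> i z * proj \<theta> z j)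
    = (\<Sum>z<n. \<Sum>x\<in>carrier G. cnj (\<theta> x) * (\<pi> x $$ (i, z) * proj \<theta> z j)) / of_nat (card (carrier G))"
    by (simp only: proj_times sum_divide_distrib)
  also have "(\<Sum>z<n. \<Sum>x\<in>carrier G. cnj (\<theta> x) * (\<pi> x $$ (i, z) * proj \<theta> z j))
    = (\<Sum>x\<in>carrier G. cnj (\<theta> x) * (\<theta> x * proj \<theta> i j))"
    by (subst sum.swap) (simp add: sum_distrib_left[symmetric] proj_mult[OF th _ ij])
  also have "\<dots> = (\<Sum>x\<in>carrier G. proj \<theta> i j)"
  proof (rule sum.cong[OF refl])
    fix x assume "x \<in> carrier G"
    then have "cnj (\<theta> x) * \<theta> x = 1"
      using characters_D(1)[OF th] by (simp add: mult.commute complex_norm_square[symmetric])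
    then show "cnj (\<theta> x) * (\<theta> x * proj \<theta> i j) = proj \<theta> i j" by (simp add: mult.assoc[symmetric])
  qed
  finally show "(\<Sum>z<n. proj \<theta> i z * proj \<theta> z j) = proj \<theta> i j" using card_nz by simp
qed

lemma proj_trace: "(\<Sum>i<n. proj \<theta> i i) = char_coeff G (\<lambda>x. mtr (\<pi> x)) \<theta>"
proof -
  have "(\<Sum>i<n. \<Sum>x\<in>carrier G. cnj (\<theta> x) * \<pi> x $$ (i, i)) = (\<Sum>x\<in>carrier G. cnj (\<theta> x) * mtr (\<pi> x))"
    using pi_carrier by (subst sum.swap) (auto simp: mtr_def sum_distrib_left intro!: sum.cong)
  then show ?thesis by (simp add: proj_def char_coeff_def sum_divide_distrib[symmetric])
qed

lemma multiplicity_nat: "\<theta> \<in> characters G \<Longrightarrow> \<exists>r::nat. char_coeff G (\<lambda>x. mtr (\<pi> x)) \<theta> = of_nat r"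
  using herm_idem_trace_nat[OF herm_idem_proj] proj_trace by metis

lemma eigen_fixed:
  assumes th: "\<theta> \<in> characters G" and e: "eigen \<theta> \<psi>" and i: "i < n"
  shows "(\<Sum>j<n. proj \<theta> i j * vec_index \<psi> j) = vec_index \<psi> i"
proof -
  have psi: "\<psi> \<in> carrier_vec n" using e by (simp add: eigen_def)
  have "(\<Sum>j<n. proj \<theta> i j * vec_index \<psi> j)
    = (\<Sum>j<n. \<Sum>x\<in>carrier G. cnj (\<theta> x) * (\<pi> x $$ (i, j) * vec_index \<psi> j)) / of_nat (card (carrier G))"
    by (simp only: proj_times sum_divide_distrib)
  also have "(\<Sum>j<n. \<Sum>x\<in>carrier G. cnj (\<theta> x) * (\<pi> x $$ (i, j) * vec_index \<psi> j))
    = (\<Sum>x\<in>carrier G. cnj (\<theta> x) * vec_index (\<pi> x *\<^sub>v \<psi>) i)"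
  proof -
    have "(\<Sum>j<n. cnj (\<theta> x) * (\<pi> x $$ (i, j) * vec_index \<psi> j)) = cnj (\<theta> x) * vec_index (\<pi> x *\<^sub>v \<psi>) i"
      if "x \<in> carrier G" for x
      by (simp only: mult_mat_vec_index[OF pi_carrier[OF that] psi i] sum_distrib_left)
    then show ?thesis by (subst sum.swap) simp
  qed
  also have "\<dots> = (\<Sum>x\<in>carrier G. vec_index \<psi> i)"
  proof (rule sum.cong[OF refl])
    fix x assume x: "x \<in> carrier G"
    then have "cnj (\<theta> x) * \<theta> x = 1"
      using characters_D(1)[OF th] by (simp add: mult.commute complex_norm_square[symmetric])
    then show "cnj (\<theta> x) * vec_index (\<pi> x *\<^sub>v \<psi>) i = vec_index \<psi> i"
      using e x psi i by (simp add: eigen_def mult.assoc[symmetric])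
  qed
  finally show ?thesis using card_nz by simp
qed

lemma fixed_eigen:
  assumes th: "\<theta> \<in> characters G" and psi: "\<psi> \<in> carrier_vec n"
    and fixd: "\<And>i. i < n \<Longrightarrow> (\<Sum>j<n. proj \<theta> i j * vec_index \<psi> j) = vec_index \<psi> i"
  shows "eigen \<theta> \<psi>"
  unfolding eigen_def
proof (intro conjI ballI psi)
  fix x assume x: "x \<in> carrier G"
  show "\<pi> x *\<^sub>v \<psi> = \<theta> x \<cdot>\<^sub>v \<psi>"
  proof (rule eq_vecI)
    fix i assume "i < dim_vec (\<theta> x \<cdot>\<^sub>v \<psi>)"
    then have i: "i < n" using psi by simp
    have "vec_index (\<pi> x *\<^sub>v \<psi>) i = (\<Sum>z<n. \<pi> x $$ (i, z) * vec_index \<psi> z)"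
      by (rule mult_mat_vec_index[OF pi_carrier[OF x] psi i])
    also have "\<dots> = (\<Sum>z<n. \<Sum>j<n. \<pi> x $$ (i, z) * proj \<theta> z j * vec_index \<psi> j)"
    proof (rule sum.cong[OF refl])
      fix z assume "z \<in> {..<n}"
      then have "\<pi> x $$ (i, z) * vec_index \<psi> z = \<pi> x $$ (i, z) * (\<Sum>j<n. proj \<theta> z j * vec_index \<psi> j)"
        using fixd by (metis lessThan_iff)
      then show "\<pi> x $$ (i, z) * vec_index \<psi> z = (\<Sum>j<n. \<pi> x $$ (i, z) * proj \<theta> z j * vec_index \<psi> j)"
        by (simp only: sum_distrib_left mult.assoc)
    qed
    also have "\<dots> = (\<Sum>j<n. (\<Sum>z<n. \<pi> x $$ (i, z) * proj \<theta> z j) * vec_index \<psi> j)"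
      by (subst sum.swap) (simp add: sum_distrib_right)
    also have "\<dots> = (\<Sum>j<n. \<theta> x * (proj \<theta> i j * vec_index \<psi> j))"
      by (intro sum.cong refl) (simp add: proj_mult[OF th x i])
    also have "\<dots> = \<theta> x * vec_index \<psi> i" by (simp add: sum_distrib_left[symmetric] fixd[OF i])
    finally show "vec_index (\<pi> x *\<^sub>v \<psi>) i = vec_index (\<theta> x \<cdot>\<^sub>v \<psi>) i" using i psi by simp
  qed (use pi_carrier[OF x] psi in auto)
qed

lemma simple_eigenvector:
  assumes th: "\<theta> \<in> characters G" and one: "char_coeff G (\<lambda>x. mtr (\<pi> x)) \<theta> = 1"
  shows "\<exists>\<psi>. eigen \<theta> \<psi> \<and> state_inner n \<psi> \<psi> = 1"
proof -
  have "\<exists>a<n. \<exists>b<n. proj \<theta> a b \<noteq> 0"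
  proof (rule ccontr)
    assume "\<not> ?thesis"
    then have "(\<Sum>i<n. proj \<theta> i i) = 0" by simp
    then show False using one proj_trace by simp
  qed
  then obtain v where v: "\<And>i. i < n \<Longrightarrow> (\<Sum>j<n. proj \<theta> i j * v j) = v i" "(\<Sum>i<n. v i * cnj (v i)) = 1"
    using herm_idem_fixed_vector[OF herm_idem_proj[OF th]] by blast
  \<comment> \<open>The factor \<open>sqrt n\<close> compensates for the division by the dimension
    in \<open>state_inner\<close>.\<close>
  define \<psi> where "\<psi> = Matrix.vec n (\<lambda>i. of_real (sqrt n) * v i)"
  have psi: "\<psi> \<in> carrier_vec n" "\<And>i. i < n \<Longrightarrow> vec_index \<psi> i = of_real (sqrt n) * v i" by (auto simp: \<psi>_def)
  have "eigen \<theta> \<psi>"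
  proof (rule fixed_eigen[OF th psi(1)])
    fix i assume i: "i < n"
    have "(\<Sum>j<n. proj \<theta> i j * vec_index \<psi> j) = of_real (sqrt n) * (\<Sum>j<n. proj \<theta> i j * v j)"
      by (simp add: psi(2) sum_distrib_left mult_ac)
    then show "(\<Sum>j<n. proj \<theta> i j * vec_index \<psi> j) = vec_index \<psi> i" using v(1)[OF i] psi(2)[OF i] by simp
  qed
  moreover have "state_inner n \<psi> \<psi> = 1"
  proof -
    have "complex_of_real (sqrt n) * complex_of_real (sqrt n) = of_nat n"
      by (metis abs_of_nat of_real_mult of_real_of_nat_eq real_sqrt_mult_self)
    then have "(\<Sum>i<n. vec_index \<psi> i * cnj (vec_index \<psi> i)) = of_nat n * (\<Sum>i<n. v i * cnj (v i))"
      unfolding sum_distrib_left by (intro sum.cong refl) (simp add: psi(2) mult_ac)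
    then show ?thesis using v(2) n0 by (simp add: state_inner_eq[OF psi(1)])
  qed
  ultimately show ?thesis by blast
qed

lemma proj_simple:
  assumes th: "\<theta> \<in> characters G" and one: "char_coeff G (\<lambda>x. mtr (\<pi> x)) \<theta> = 1"
    and e: "eigen \<theta> \<psi>" and nrm: "state_inner n \<psi> \<psi> = 1" and ij: "i < n" "j < n"
  shows "proj \<theta> i j = vec_index \<psi> i * cnj (vec_index \<psi> j) / of_nat n"
proof -
  have psi: "\<psi> \<in> carrier_vec n" using e by (simp add: eigen_def)
  define v where "v i = vec_index \<psi> i / of_real (sqrt n)" for i
  have sq: "complex_of_real (sqrt n) * complex_of_real (sqrt n) = of_nat n"
    by (metis abs_of_nat of_real_mult of_real_of_nat_eq real_sqrt_mult_self)
  have vv: "v i * cnj (v j) = vec_index \<psi> i * cnj (vec_index \<psi> j) / of_nat n" for i j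
    by (simp add: v_def sq)
  have "proj \<theta> i j = v i * cnj (v j)"
  proof (rule herm_idem_trace_1[OF herm_idem_proj[OF th] _ _ _ ij])
    show "(\<Sum>i<n. proj \<theta> i i) = 1" using one proj_trace by simp
    show "(\<Sum>j<n. proj \<theta> i j * v j) = v i" if "i < n" for i
      using eigen_fixed[OF th e that] by (simp add: v_def sum_divide_distrib[symmetric])
    show "(\<Sum>i<n. v i * cnj (v i)) = 1"
      using nrm by (simp add: vv state_inner_eq[OF psi] sum_divide_distrib)
  qed
  then show ?thesis using vv by simp
qed

text \<open>Every eigenvector is fixed by a projection of rank one, so it is the multiple of
  \<open>\<psi>\<close> given by their inner product.\<close>

lemma simple_eigenvector_unique:
  assumes th: "\<theta> \<in> characters G" and one: "char_coeff G (\<lambda>x. mtr (\<pi> x)) \<theta> = 1"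
    and e: "eigen \<theta> \<psi>" and nrm: "state_inner n \<psi> \<psi> = 1"
    and e': "eigen \<theta> \<phi>" and nrm': "state_inner n \<phi> \<phi> = 1"
  shows "\<exists>c. cmod c = 1 \<and> \<phi> = c \<cdot>\<^sub>v \<psi>"
proof -
  have psi: "\<psi> \<in> carrier_vec n" and phi: "\<phi> \<in> carrier_vec n" using e e' by (auto simp: eigen_def)
  define c where "c = state_inner n \<phi> \<psi>"
  have ph: "vec_index \<phi> i = c * vec_index \<psi> i" if i: "i < n" for i
  proof -
    have "vec_index \<phi> i = (\<Sum>j<n. proj \<theta> i j * vec_index \<phi> j)" using eigen_fixed[OF th e' i] by simp
    also have "\<dots> = (\<Sum>j<n. vec_index \<psi> i * (vec_index \<phi> j * cnj (vec_index \<psi> j)) / of_nat n)"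
      by (intro sum.cong refl) (simp add: proj_simple[OF th one e nrm i])
    also have "\<dots> = c * vec_index \<psi> i"
      by (simp add: c_def state_inner_eq[OF psi] sum_divide_distrib[symmetric] sum_distrib_left[symmetric])
    finally show ?thesis .
  qed
  have "\<phi> = c \<cdot>\<^sub>v \<psi>" by (rule eq_vecI) (use ph psi phi in auto)
  moreover have "cmod c = 1"
  proof -
    have "(\<Sum>i<n. vec_index \<phi> i * cnj (vec_index \<phi> i)) = c * cnj c * (\<Sum>i<n. vec_index \<psi> i * cnj (vec_index \<psi> i))"
      unfolding sum_distrib_left by (intro sum.cong refl) (simp add: ph)
    then have "state_inner n \<phi> \<phi> = c * cnj c * state_inner n \<psi> \<psi>"
      by (simp add: state_inner_eq[OF phi] state_inner_eq[OF psi])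
    then have "c * cnj c = 1" using nrm nrm' by simp
    then have "complex_of_real ((cmod c)\<^sup>2) = 1" by (simp only: complex_norm_square)
    then have "(cmod c)\<^sup>2 = 1" by (metis of_real_eq_1_iff)
    then show ?thesis by (metis norm_ge_zero power2_eq_iff_nonneg zero_le_one one_power2)
  qed
  ultimately show ?thesis by blast
qed

text \<open>The isotypic projection is the rank-one projection to \<open>\<psi>\<close>, so the
  matrix element is the trace of \<open>M\<close> times it; the projection is an average of the
  operators \<open>\<pi> x\<close>, and the trace is taken termwise.\<close>

lemma simple_matrix_element:
  assumes th: "\<theta> \<in> characters G" and one: "char_coeff G (\<lambda>x. mtr (\<pi> x)) \<theta> = 1"
    and e: "eigen \<theta> \<psi>" and nrm: "state_inner n \<psi> \<psi> = 1" and M: "M \<in> carrier_mat n n"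
  shows "state_inner n (M *\<^sub>v \<psi>) \<psi> = char_coeff G (\<lambda>x. mtr (M * \<pi> x)) \<theta>"
proof -
  have psi: "\<psi> \<in> carrier_vec n" using e by (simp add: eigen_def)
  have "vec_index (M *\<^sub>v \<psi>) i * cnj (vec_index \<psi> i) / of_nat n = (\<Sum>j<n. proj \<theta> j i * M $$ (i, j))"
    if i: "i < n" for i
  proof -
    have "vec_index (M *\<^sub>v \<psi>) i * cnj (vec_index \<psi> i) / of_nat n
      = (\<Sum>j<n. M $$ (i, j) * vec_index \<psi> j * cnj (vec_index \<psi> i) / of_nat n)"
      by (simp only: mult_mat_vec_index[OF M psi i] sum_distrib_right sum_divide_distrib)
    also have "\<dots> = (\<Sum>j<n. proj \<theta> j i * M $$ (i, j))"
      by (intro sum.cong refl) (simp add: proj_simple[OF th one e nrm _ i])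
    finally show ?thesis .
  qed
  then have "state_inner n (M *\<^sub>v \<psi>) \<psi> = (\<Sum>i<n. \<Sum>j<n. proj \<theta> j i * M $$ (i, j))"
    unfolding state_inner_eq[OF psi] sum_divide_distrib by simp
  also have "\<dots> = (\<Sum>i<n. \<Sum>j<n. \<Sum>x\<in>carrier G. cnj (\<theta> x) * (\<pi> x $$ (j, i) * M $$ (i, j))) / of_nat (card (carrier G))"
    by (simp only: proj_times sum_divide_distrib)
  also have "(\<Sum>i<n. \<Sum>j<n. \<Sum>x\<in>carrier G. cnj (\<theta> x) * (\<pi> x $$ (j, i) * M $$ (i, j)))
    = (\<Sum>i<n. \<Sum>x\<in>carrier G. \<Sum>j<n. cnj (\<theta> x) * (\<pi> x $$ (j, i) * M $$ (i, j)))"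
    by (intro sum.cong refl sum.swap)
  also have "\<dots> = (\<Sum>x\<in>carrier G. \<Sum>i<n. \<Sum>j<n. cnj (\<theta> x) * (\<pi> x $$ (j, i) * M $$ (i, j)))"
    by (rule sum.swap)
  also have "\<dots> = (\<Sum>x\<in>carrier G. cnj (\<theta> x) * mtr (M * \<pi> x))"
    by (intro sum.cong refl) (simp add: mtr_mult[OF M pi_carrier] sum_distrib_left mult.commute[of "M $$ _"])
  finally show ?thesis by (simp add: char_coeff_def)
qed
end

section \<open>Elementary observables\<close>

lemma integral_cis_multiple_2pi:
  fixes c :: int
  shows "(LINT s|lborel. indicator {0..1} s *\<^sub>R cis (2 * pi * (of_int c * s))) = (if c = 0 then 1 else 0)"
proof (cases "c = 0")
  case True
  then show ?thesis by (simp add: scaleR_conv_of_real)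
next
  case False
  define w where "w = \<i> * of_real (2 * pi * of_int c)"
  have w: "w \<noteq> 0" using False by (simp add: w_def)
  have cis: "cis (2 * pi * (of_int c * s)) = exp (w * of_real s)" for s
    by (simp add: cis_conv_exp w_def mult_ac)
  have "continuous_on {0..1} (\<lambda>s. cis (2 * pi * (of_int c * s)))"
    by (intro continuous_intros)
  then have int: "set_integrable lborel {0..1} (\<lambda>s. cis (2 * pi * (of_int c * s)))"
    unfolding set_integrable_def by (rule borel_integrable_compact[OF compact_Icc])
  have "((\<lambda>s. exp (w * of_real s) / w) has_vector_derivative exp (w * of_real s)) (at s within {0..1})" for s
  proof -
    have "((\<lambda>z. exp (w * z) / w) has_field_derivative exp (w * of_real s)) (at (of_real s))"
      using w by (auto intro!: derivative_eq_intros)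
    then show ?thesis by (rule has_vector_derivative_real_field)
  qed
  then have "((\<lambda>s. exp (w * of_real s)) has_integral (exp (w * of_real 1) / w - exp (w * of_real 0) / w)) {0..1}"
    by (intro fundamental_theorem_of_calculus) auto
  moreover have "exp (w * of_real 1) = 1"
    using cis[of 1] cis_multiple_2pi[of "of_int c"] by simp
  ultimately have "((\<lambda>s. cis (2 * pi * (of_int c * s))) has_integral 0) {0..1}"
    unfolding cis by simp
  then have "integral {0..1} (\<lambda>s. cis (2 * pi * (of_int c * s))) = 0" by (rule integral_unique)
  then show ?thesis
    using set_borel_integral_eq_integral(2)[OF int] False by (simp add: set_lebesgue_integral_def)
qed

lemma Basis_real_2: "b \<in> (Basis :: (real^2) set) \<longleftrightarrow> (\<exists>i. b = axis i 1)"
  by (auto simp: Basis_vec_def)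

text \<open>The integrand is a product of functions of single coordinates and the Lebesgue measure
  of the plane is the image of a product measure, so the integral is a product of integrals of
  circle characters.\<close>

lemma integral_e_fun_freq_dot:
  "integral (cbox 0 1) (\<lambda>x. e_fun (freq_dot l x)) = (if l = 0 then 1 else 0)"
proof -
  define w :: "real^2" where "w = (\<chi> i. of_int (l $ i))"
  have fd: "freq_dot l x = (\<Sum>b\<in>Basis. (w \<bullet> b) * (x \<bullet> b))" for x
  proof -
    have "freq_dot l x = w \<bullet> x" by (simp add: freq_dot_def w_def inner_vec_def)
    then show ?thesis by (simp only: euclidean_inner[of w x])
  qed
  have cis_sum: "cis (\<Sum>b\<in>B. g b) = (\<Prod>b\<in>B. cis (g b))" if "finite B" for g and B :: "(real^2) set"
    using that by (induction B rule: finite_induct) (auto simp: cis_mult[symmetric])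
  \<comment> \<open>The indicator of the unit interval is absorbed into each factor, which turns the
    integral over the square into one over the plane.\<close>
  define F :: "real^2 \<Rightarrow> real \<Rightarrow> complex" where
    "F b s = indicator {0..1} s *\<^sub>R cis (2 * pi * ((w \<bullet> b) * s))" for b s
  have intF: "integrable lborel (F b)" for b
    unfolding F_def by (rule borel_integrable_compact) (auto intro!: continuous_intros)
  have one: "(1 :: real^2) \<bullet> b = 1" if "b \<in> Basis" for b
    using that by (auto simp: Basis_real_2 inner_axis)
  have ind: "indicator (cbox 0 1) x = (\<Prod>b\<in>Basis. indicator {0..1} (x \<bullet> b) :: real)" for x :: "real^2"
    by (auto simp: indicator_def mem_box one prod_zero_iff)
  have prodF: "indicator (cbox 0 1) x *\<^sub>R e_fun (freq_dot l x) = (\<Prod>b\<in>Basis. F b (x \<bullet> b))" for x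
  proof -
    have "e_fun (freq_dot l x) = (\<Prod>b\<in>Basis. cis (2 * pi * ((w \<bullet> b) * (x \<bullet> b))))"
      unfolding e_fun_cis fd by (simp add: sum_distrib_left cis_sum)
    then show ?thesis unfolding ind F_def by (simp add: scaleR_conv_of_real prod.distrib)
  qed
  have "continuous_on (cbox 0 1) (\<lambda>x. e_fun (freq_dot l x))"
    unfolding e_fun_cis fd by (intro continuous_intros)
  then have int: "set_integrable lborel (cbox 0 1) (\<lambda>x. e_fun (freq_dot l x))"
    unfolding set_integrable_def by (rule borel_integrable_compact[OF compact_cbox])
  interpret product_sigma_finite "\<lambda>_::real^2. lborel :: real measure" ..
  have meas: "(\<lambda>x. \<Prod>b\<in>Basis. F b (x \<bullet> b)) \<in> borel_measurable (borel :: (real^2) measure)"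
    using intF[THEN borel_measurable_integrable] by measurable
  have "integral (cbox 0 1) (\<lambda>x. e_fun (freq_dot l x)) = (LINT x|lborel. (\<Prod>b\<in>Basis. F b (x \<bullet> b)))"
    unfolding set_borel_integral_eq_integral(2)[OF int, symmetric] set_lebesgue_integral_def prodF ..
  also have "\<dots> = (LINT y|(\<Pi>\<^sub>M b\<in>Basis. lborel). (\<Prod>b\<in>Basis. F b ((\<Sum>c\<in>Basis. y c *\<^sub>R c) \<bullet> b)))"
    by (subst lborel_eq, rule integral_distr[OF _ meas]) measurable
  also have "\<dots> = (LINT y|(\<Pi>\<^sub>M b\<in>Basis. lborel). (\<Prod>b\<in>Basis. F b (y b)))"
    by (intro Bochner_Integration.integral_cong refl prod.cong) simp
  also have "\<dots> = (\<Prod>b\<in>Basis. integral\<^sup>L lborel (F b))"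
    by (rule product_integral_prod) (auto intro: intF)
  also have "\<dots> = (\<Prod>b\<in>(Basis :: (real^2) set). if w \<bullet> b = 0 then 1 else 0)"
  proof (rule prod.cong[OF refl])
    fix b :: "real^2" assume "b \<in> Basis"
    then obtain i where b: "b = axis i 1" by (auto simp: Basis_real_2)
    have "w \<bullet> b = of_int (l $ i)" by (simp add: b inner_axis w_def)
    then show "integral\<^sup>L lborel (F b) = (if w \<bullet> b = 0 then 1 else 0)"
      unfolding F_def using integral_cis_multiple_2pi[of "l $ i"] by simp
  qed
  also have "\<dots> = (if l = 0 then 1 else 0)"
  proof (cases "l = 0")
    case True
    then have "w = 0" by (simp add: w_def Finite_Cartesian_Product.vec_eq_iff)
    then show ?thesis using True by simp
  next
    case False
    then obtain i where "l $ i \<noteq> 0" by (auto simp: Finite_Cartesian_Product.vec_eq_iff)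
    then have "w \<bullet> axis i 1 \<noteq> 0" "axis i 1 \<in> (Basis :: (real^2) set)"
      by (auto simp: inner_axis w_def Basis_real_2)
    then show ?thesis using False by (auto simp: prod_zero_iff)
  qed
  finally show ?thesis .
qed

lemma fourier_coeff_elementary: "fourier_coeff (elementary_observable n) m = (if m = n then 1 else 0)"
proof -
  have "elementary_observable n x * e_fun (- freq_dot m x) = e_fun (freq_dot (n - m) x)" for x
  proof -
    have "freq_dot (n - m) x = freq_dot n x + - freq_dot m x"
      by (simp add: freq_dot_def left_diff_distrib sum_subtractf)
    then show ?thesis by (simp add: elementary_observable_def e_fun_cis cis_mult ring_distribs)
  qed
  then show ?thesis by (auto simp: fourier_coeff_def integral_e_fun_freq_dot)
qed

lemma Op_elementary: "Op N (elementary_observable n) = T_op N n"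
proof (rule eq_matI)
  fix i j assume ij: "i < dim_row (T_op N n)" "j < dim_col (T_op N n)"
  have "(\<Sum>\<^sub>\<infinity>m\<in>UNIV. fourier_coeff (elementary_observable n) m * (T_op N m $$ (i, j)))
    = fourier_coeff (elementary_observable n) n * (T_op N n $$ (i, j))"
  proof -
    have "(\<Sum>\<^sub>\<infinity>m\<in>UNIV. fourier_coeff (elementary_observable n) m * (T_op N m $$ (i, j)))
      = (\<Sum>\<^sub>\<infinity>m\<in>{n}. fourier_coeff (elementary_observable n) m * (T_op N m $$ (i, j)))"
      by (rule infsum_cong_neutral) (auto simp: fourier_coeff_elementary)
    then show ?thesis by simp
  qed
  then show "Op N (elementary_observable n) $$ (i, j) = T_op N n $$ (i, j)"
    using ij by (simp add: Op_def T_op_def fourier_coeff_elementary)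
qed (simp_all add: Op_def T_op_def)

section \<open>Multiplicities of the characters of the Hecke group\<close>

lemma finite_int_interval_filter: "finite {z \<in> {0..<(m::int)}. P z}"
  by (rule finite_subset[of _ "{0..<m}"]) auto

lemma card_congruence_class:
  fixes r :: int
  assumes "M > 0"
  shows "card {z \<in> {0..<int (M * q)}. [z = r] (mod int M)} = q"
proof -
  let ?r = "r mod int M"
  have b: "bij_betw (\<lambda>w. ?r + int M * w) {0..<int q} {z \<in> {0..<int (M * q)}. [z = r] (mod int M)}"
  proof (rule bij_betwI[of _ _ _ "\<lambda>z. z div int M"])
    show "(\<lambda>w. ?r + int M * w) \<in> {0..<int q} \<rightarrow> {z \<in> {0..<int (M * q)}. [z = r] (mod int M)}"
    proof
      fix w assume w: "w \<in> {0..<int q}"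
      have "?r + int M * w < int M * (w + 1)" using assms by (simp add: algebra_simps)
      also have "\<dots> \<le> int M * int q" using w by (intro mult_left_mono) auto
      finally show "?r + int M * w \<in> {z \<in> {0..<int (M * q)}. [z = r] (mod int M)}"
        using w assms by (simp add: Cong.cong_def)
    qed
    show "(\<lambda>z. z div int M) \<in> {z \<in> {0..<int (M * q)}. [z = r] (mod int M)} \<rightarrow> {0..<int q}"
    proof
      fix z assume z: "z \<in> {z \<in> {0..<int (M * q)}. [z = r] (mod int M)}"
      have "z div int M < int q"
      proof (rule ccontr)
        assume "\<not> ?thesis"
        then have "int q * int M \<le> z div int M * int M" using assms by (intro mult_right_mono) auto
        also have "\<dots> \<le> z" using assms div_mult_mod_eq[of z "int M"] pos_mod_sign[of "int M" z] by linarith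
        finally show False using z by (simp add: mult.commute)
      qed
      then show "z div int M \<in> {0..<int q}" using z assms by (simp add: pos_imp_zdiv_nonneg_iff)
    qed
    show "(?r + int M * w) div int M = w" for w using assms by simp
    show "?r + int M * (z div int M) = z" if "z \<in> {z \<in> {0..<int (M * q)}. [z = r] (mod int M)}" for z
      using that mod_mult_div_eq[of z "int M"] by (simp add: Cong.cong_def)
  qed
  show ?thesis using bij_betw_same_card[OF b] by simp
qed

lemma card_scaled_zero_box:
  "card {m \<in> lattice_box N. vcong N (x *s m) 0} = (card {z \<in> {0..<int N}. int N dvd x * z})\<^sup>2"
proof -
  let ?S = "{z \<in> {0..<int N}. int N dvd x * z}"
  have "bij_betw (\<lambda>(a, b). vector [a, b] :: int^2) (?S \<times> ?S) {m \<in> lattice_box N. vcong N (x *s m) 0}"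
    by (rule bij_betwI[of _ _ _ "\<lambda>m. (m $ 1, m $ 2)"])
      (auto simp: lattice_box_def vcong_def forall_2 cong_0_iff)
  then show ?thesis using bij_betw_same_card by (fastforce simp: card_cartesian_product power2_eq_square)
qed

text \<open>If p^j is the exact power of p in x, the residues killed by x are the multiples of
  p^(k-j). As x is nonzero modulo p^k, j is less than k.\<close>

lemma card_annihilator_prime_power:
  assumes p: "Factorial_Ring.prime p" and x: "x \<in> {0<..<int (p ^ k)}"
  shows "\<exists>j<k. int (p ^ j) dvd x \<and> card {z \<in> {0..<int (p ^ k)}. int (p ^ k) dvd x * z} = p ^ j"
proof -
  have p0: "p > 0" using p prime_gt_0_nat by blast
  have pi: "Factorial_Ring.prime (int p)" using p by simp
  define j where "j = multiplicity (int p) x"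
  have "x \<noteq> 0" "\<not> is_unit (int p)" using x pi by auto
  then obtain u where u: "x = int p ^ j * u" "\<not> int p dvd u"
    unfolding j_def using multiplicity_decompose' by (metis)
  have "int p ^ j dvd x" using u by simp
  have jk: "j < k"
  proof (rule ccontr)
    assume "\<not> ?thesis"
    then have "int (p ^ k) dvd x" using \<open>int p ^ j dvd x\<close> le_imp_power_dvd[of k j "int p"] dvd_trans by (metis linorder_not_less of_nat_power)
    then show False using x zdvd_not_zless[of x "int (p ^ k)"] by auto
  qed
  have k: "p ^ k = p ^ (k - j) * p ^ j" using jk by (simp add: power_add[symmetric])
  have "int (p ^ k) dvd x * z \<longleftrightarrow> [z = 0] (mod int (p ^ (k - j)))" for z
  proof -
    have "int (p ^ k) dvd x * z \<longleftrightarrow> int (p ^ j) * int (p ^ (k - j)) dvd int (p ^ j) * (u * z)"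
      by (simp add: k u(1) mult_ac)
    also have "\<dots> \<longleftrightarrow> int (p ^ (k - j)) dvd u * z" using p0 by simp
    also have "\<dots> \<longleftrightarrow> int (p ^ (k - j)) dvd z"
    proof -
      have "coprime u (int (p ^ (k - j)))" using coprime_prime_power[OF p, of "k - j" u] jk u(2) by simp
      then show ?thesis by (metis coprime_commute coprime_dvd_mult_right_iff)
    qed
    finally show ?thesis by (simp add: cong_0_iff)
  qed
  then have "{z \<in> {0..<int (p ^ k)}. int (p ^ k) dvd x * z} = {z \<in> {0..<int (p ^ (k - j) * p ^ j)}. [z = 0] (mod int (p ^ (k - j)))}"
    unfolding k[symmetric] by blast
  then have "card {z \<in> {0..<int (p ^ k)}. int (p ^ k) dvd x * z} = p ^ j"
    using card_congruence_class[of "p ^ (k - j)" "p ^ j" 0] p0 by simp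
  then show ?thesis using jk \<open>int p ^ j dvd x\<close> by auto
qed

text \<open>At most p^(k-j) residues are divisible by p^j, and each contributes p^(2j), so every j <
  k accounts for at most p^(k+j), which is at most p^(2k-1). The residue 0 is left out: alone it
  would contribute p^(2k).\<close>

lemma sum_card_annihilator_squares:
  assumes p: "Factorial_Ring.prime p" and k: "k \<ge> 1"
  shows "(\<Sum>x\<in>{0<..<int (p ^ k)}. (card {z \<in> {0..<int (p ^ k)}. int (p ^ k) dvd x * z})\<^sup>2) \<le> k * p ^ (2 * k - 1)"
proof -
  have p0: "p > 0" using p prime_gt_0_nat by blast
  let ?N = "int (p ^ k)"
  have "(\<Sum>x\<in>{0<..<?N}. (card {z \<in> {0..<?N}. ?N dvd x * z})\<^sup>2)
    \<le> (\<Sum>x\<in>{0<..<?N}. \<Sum>j<k. if int (p ^ j) dvd x then (p ^ j)\<^sup>2 else 0)"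
  proof (rule sum_mono)
    fix x assume "x \<in> {0<..<?N}"
    then obtain j where j: "j < k" "int (p ^ j) dvd x" "card {z \<in> {0..<?N}. ?N dvd x * z} = p ^ j"
      using card_annihilator_prime_power[OF p] by blast
    have "(if int (p ^ j) dvd x then (p ^ j)\<^sup>2 else 0) \<le> (\<Sum>j<k. if int (p ^ j) dvd x then (p ^ j)\<^sup>2 else 0)"
      using j(1) by (intro member_le_sum) auto
    then show "(card {z \<in> {0..<?N}. ?N dvd x * z})\<^sup>2 \<le> (\<Sum>j<k. if int (p ^ j) dvd x then (p ^ j)\<^sup>2 else 0)"
      using j by simp
  qed
  also have "\<dots> = (\<Sum>j<k. \<Sum>x\<in>{0<..<?N}. if int (p ^ j) dvd x then (p ^ j)\<^sup>2 else 0)"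
    by (rule sum.swap)
  also have "\<dots> \<le> (\<Sum>j<k. p ^ (2 * k - 1))"
  proof (rule sum_mono)
    fix j assume "j \<in> {..<k}"
    then have j: "j < k" by simp
    have kj: "p ^ k = p ^ j * p ^ (k - j)" using j by (simp add: power_add[symmetric])
    have "(\<Sum>x\<in>{0<..<?N}. if int (p ^ j) dvd x then (p ^ j)\<^sup>2 else 0)
      = (\<Sum>x\<in>{x\<in>{0<..<?N}. int (p ^ j) dvd x}. (p ^ j)\<^sup>2)"
      by (rule sum.inter_filter[symmetric]) simp
    also have "\<dots> = card {x\<in>{0<..<?N}. int (p ^ j) dvd x} * (p ^ j)\<^sup>2" by simp
    also have "card {x\<in>{0<..<?N}. int (p ^ j) dvd x} \<le> p ^ (k - j)"
    proof -
      have "card {x\<in>{0<..<?N}. int (p ^ j) dvd x} \<le> card {x\<in>{0..<?N}. [x = 0] (mod int (p ^ j))}"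
        by (intro card_mono finite_int_interval_filter) (auto simp: cong_0_iff)
      also have "\<dots> = p ^ (k - j)" unfolding kj using p0 by (intro card_congruence_class) simp
      finally show ?thesis .
    qed
    then have "card {x\<in>{0<..<?N}. int (p ^ j) dvd x} * (p ^ j)\<^sup>2 \<le> p ^ (k - j) * (p ^ j)\<^sup>2" by simp
    also have "\<dots> = p ^ (k + j)" using j by (simp add: power_add[symmetric] power_mult[symmetric] add.commute)
    also have "\<dots> \<le> p ^ (2 * k - 1)" using j p0 by (intro power_increasing) auto
    finally show "(\<Sum>x\<in>{0<..<?N}. if int (p ^ j) dvd x then (p ^ j)\<^sup>2 else 0) \<le> p ^ (2 * k - 1)" .
  qed
  finally show ?thesis by simp
qed

text \<open>The sum of \<open>(r - 1)\<^sup>2\<close> over \<open>S\<close> is \<open>O(q)\<close>, and by integrality every \<open>x\<close> with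
  \<open>r x \<noteq> 1\<close> contributes at least \<open>1\<close> to it.\<close>

lemma card_multiplicity_one:
  fixes r :: "'a \<Rightarrow> nat" and p q :: real
  assumes fin: "finite S" and p: "p \<ge> 2" and q: "q \<ge> 1" and k: "k \<ge> 0"
    and card: "(p - 1) * q \<le> real (card S)" "real (card S) \<le> (p + 1) * q"
    and sum1: "(\<Sum>x\<in>S. real (r x)) = p * q"
    and sum2: "(\<Sum>x\<in>S. (real (r x))\<^sup>2) \<le> (p * q + p\<^sup>2 * q\<^sup>2 + k * p * q\<^sup>2) / real (card S)"
  shows "\<bar>real (card {x \<in> S. r x = 1}) - p * q\<bar> \<le> (2 * k + 6) * q"
proof -
  let ?c = "real (card S)"
  have pq: "(p - 1) * q > 0" using p q by simp
  then have c0: "?c > 0" using card by linarith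
  have "(p * q + p\<^sup>2 * q\<^sup>2 + k * p * q\<^sup>2) / ?c \<le> (p * q + p\<^sup>2 * q\<^sup>2 + k * p * q\<^sup>2) / ((p - 1) * q)"
    using card(1) pq p q k c0 by (intro divide_left_mono mult_pos_pos) auto
  also have "\<dots> = (p + p\<^sup>2 * q + k * p * q) / (p - 1)"
    using p q by (simp add: field_simps power2_eq_square)
  \<comment> \<open>Bounding \<open>p\<close> by \<open>p * q\<close> and removing
    \<open>p * q * (p - 1)\<close> leaves \<open>(k + 2) * p * q\<close>; by
    \<open>p \<le> 2 * (p - 1)\<close> its quotient by \<open>p - 1\<close> is at most
    \<open>(2 * k + 4) * q\<close>.\<close>
  also have "\<dots> \<le> p * q + (2 * k + 4) * q"
  proof -
    have "p \<le> p * q" using p q by simp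
    moreover have "p * ((k + 2) * q) \<le> (2 * (p - 1)) * ((k + 2) * q)"
      using p q k by (intro mult_right_mono) auto
    ultimately have "p + p\<^sup>2 * q + k * p * q \<le> (p * q + (2 * k + 4) * q) * (p - 1)"
      by (simp add: algebra_simps power2_eq_square)
    then show ?thesis using p by (simp add: pos_divide_le_eq)
  qed
  finally have s2: "(\<Sum>x\<in>S. (real (r x))\<^sup>2) \<le> p * q + (2 * k + 4) * q" using sum2 by linarith
  have "real (card {x \<in> S. r x \<noteq> 1}) = (\<Sum>x\<in>{x \<in> S. r x \<noteq> 1}. 1)" by simp
  also have "\<dots> \<le> (\<Sum>x\<in>{x \<in> S. r x \<noteq> 1}. (real (r x) - 1)\<^sup>2)"
  proof (rule sum_mono)
    fix x assume "x \<in> {x \<in> S. r x \<noteq> 1}"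
    then consider "r x = 0" | "r x \<ge> 2" by fastforce
    then show "1 \<le> (real (r x) - 1)\<^sup>2"
      by cases (auto intro!: one_le_power)
  qed
  also have "\<dots> \<le> (\<Sum>x\<in>S. (real (r x) - 1)\<^sup>2)" using fin by (intro sum_mono2) auto
  also have "\<dots> = (\<Sum>x\<in>S. (real (r x))\<^sup>2) - 2 * (\<Sum>x\<in>S. real (r x)) + ?c"
    by (simp add: power2_diff sum.distrib sum_subtractf sum_distrib_left)
  \<comment> \<open>The leading terms \<open>p * q\<close>, \<open>- 2 * p * q\<close> and
    \<open>p * q\<close> cancel; the extra \<open>q\<close> comes from the upper bound for
    \<open>card S\<close>.\<close>
  also have "\<dots> \<le> (2 * k + 5) * q" using s2 sum1 card(2) by (simp add: algebra_simps)
  finally have bad: "real (card {x \<in> S. r x \<noteq> 1}) \<le> (2 * k + 5) * q" .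
  have "card S = card {x \<in> S. r x = 1} + card {x \<in> S. r x \<noteq> 1}"
    using fin by (subst card_Un_disjoint[symmetric]) (auto intro!: arg_cong[where f = card])
  then have "?c = real (card {x \<in> S. r x = 1}) + real (card {x \<in> S. r x \<noteq> 1})" by simp
  then show ?thesis using bad card q k by (simp add: algebra_simps abs_le_iff)
qed

section \<open>The Hecke representation and its multiplicities\<close>

context hecke_level
begin

definition \<pi> :: "real set \<Rightarrow> complex Matrix.mat" where
  "\<pi> \<beta> = \<rho> (iota_mod A \<alpha> N \<beta>)"

lemma pi_R: "\<pi> (R a b) = V a b"
  by (simp add: \<pi>_def iota_mod_R V_def)

definition F :: "real set \<Rightarrow> complex" where
  "F \<beta> = mtr (\<pi> \<beta>)"

lemma F_R: "F (R a b) = f a b"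
  by (simp add: F_def pi_R f_def)

sublocale rep: unitary_rep C \<pi> N
proof (rule unitary_rep.intro)
  show "comm_group C" by (rule comm_group_C)
  show "finite (carrier C)" by (rule finite_C)
  show "N > 0" by (rule N_pos)
  show "\<pi> x \<in> carrier_mat N N" if "x \<in> carrier C" for x
    using that V_unitary(1) pi_R unfolding C_carrier by metis
  show "\<pi> (x \<otimes>\<^bsub>C\<^esub> y) = \<pi> x * \<pi> y" if "x \<in> carrier C" "y \<in> carrier C" for x y
    using that V_mult pi_R C_R_mult unfolding C_carrier by metis
  show "\<pi> (inv\<^bsub>C\<^esub> x) $$ (i, j) = cnj (\<pi> x $$ (j, i))" if x: "x \<in> carrier C" and ij: "i < N" "j < N" for x i j
  proof -
    obtain a b where ab: "nrm a b" "x = R a b" using iffD1[OF C_carrier x] by blast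
    show ?thesis using V_inv[OF ab(1)] V_unitary(1)[OF ab(1)] ij
      by (auto simp: ab(2) C_R_inv[OF ab(1)] pi_R mat_adjoint_def mat_of_rows_def cols_def)
  qed
qed

abbreviation "mult_char \<equiv> char_coeff C F"

lemma F_eq: "F = (\<lambda>x. mtr (\<pi> x))"
  by (simp add: fun_eq_iff F_def)

lemma F_norm:
  assumes "\<beta> \<in> carrier C - H"
  shows "cmod (F \<beta>) = 1"
proof -
  obtain x where "x \<in> X_set A p k" "\<beta> = cayley \<alpha> N x" using bij_cayley assms by (auto simp: bij_betw_def)
  then obtain a b where "cay x a b" "\<beta> = R a b" using cayley_cay X_coprime by blast
  then show ?thesis using f_norm_regular cay_coprime(2) by (auto simp: F_R cay_def)
qed

definition sgn_D :: int where
  "sgn_D = Legendre D (int p) ^ k"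

lemma sgn_D: "sgn_D = 1 \<or> sgn_D = - 1"
proof -
  have "Legendre D (int p) = 1 \<or> Legendre D (int p) = - 1" using pD by (auto simp: Legendre_def cong_0_iff)
  then show ?thesis unfolding sgn_D_def by (cases "even k") auto
qed

text \<open>Outside \<open>H\<close> every class is a Cayley transform, so the two factors and their
  product all have the parameters required by \<open>f_mult_cay\<close>.\<close>

lemma F_mult:
  assumes "\<beta> \<in> carrier C - H" "\<gamma> \<in> carrier C - H" "\<beta> \<otimes>\<^bsub>C\<^esub> \<gamma> \<notin> H"
  shows "F \<beta> * F \<gamma> = of_int sgn_D * F (\<beta> \<otimes>\<^bsub>C\<^esub> \<gamma>)"
proof -
  interpret C: comm_group C by (rule comm_group_C)
  have ex: "\<exists>x a b. cay x a b \<and> \<beta> = R a b" if "\<beta> \<in> carrier C - H" for \<beta>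
    using bij_cayley that cayley_cay X_coprime unfolding bij_betw_def by (metis imageE)
  obtain x a b where x: "cay x a b" "\<beta> = R a b" using ex[OF assms(1)] by blast
  obtain y c d where y: "cay y c d" "\<gamma> = R c d" using ex[OF assms(2)] by blast
  have bg: "\<beta> \<otimes>\<^bsub>C\<^esub> \<gamma> = R (a * c + D * b * d) (a * d + b * c)" by (simp only: x y C_R_mult)
  have n: "nrm (a * c + D * b * d) (a * d + b * c)" using x y nrm_mult by (simp add: cay_def)
  have "\<not> int p dvd (a * c + D * b * d) - 1"
  proof
    assume "int p dvd (a * c + D * b * d) - 1"
    then have "R (a * c + D * b * d) (a * d + b * c) \<in> H" unfolding H_R using n nrm_not_H[OF n] by blast
    then show False using assms(3) bg by metis
  qed
  then obtain w where "cay w (a * c + D * b * d) (a * d + b * c)" using cay_exists[OF n] by blast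
  from f_mult_cay[OF x(1) y(1) this N_eq prime_p k1 pD] show ?thesis
    unfolding bg by (simp only: x(2) y(2) F_R sgn_D_def)
qed

lemma card_Y: "card Y = p ^ (k - 1)"
proof -
  have "N = p * p ^ (k - 1)" using k1 by (simp add: N_eq power_eq_if)
  moreover have "p > 0" using prime_p prime_gt_0_nat by blast
  ultimately have "card {z \<in> {0..<int N}. [z = 0] (mod int p)} = p ^ (k - 1)"
    using card_congruence_class[of p "p ^ (k - 1)" 0] by metis
  then show ?thesis by (simp add: Y_def cong_0_iff)
qed

lemma card_H: "card H = p ^ (k - 1)"
  using bij_betw_same_card[OF bij_neg_cayley] card_Y by simp

lemma card_C: "card (carrier C) = card (X_set A p k) + p ^ (k - 1)"
proof -
  have "H \<subseteq> carrier C" using subgroup_H by (simp add: subgroup.subset)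
  then have "card (carrier C) = card (carrier C - H) + card H"
    using finite_C by (metis card_Diff_subset card_mono finite_subset le_add_diff_inverse2)
  then show ?thesis using bij_betw_same_card[OF bij_cayley] card_H by simp
qed

lemma card_X_le: "card (X_set A p k) \<le> N"
proof -
  have "X_set A p k \<subseteq> {0..<int N}" using X_coprime by blast
  then have "card (X_set A p k) \<le> card {0..<int N}" by (intro card_mono) auto
  then show ?thesis by simp
qed

text \<open>The excluded parameters solve D x^2 = 1 modulo \<open>p\<close>. They lie in at most two
  classes r and -r, each with p^(k-1) members.\<close>

lemma card_X_ge: "N \<le> card (X_set A p k) + 2 * p ^ (k - 1)"
proof -
  let ?B = "{x \<in> {0..<int N}. [D * x\<^sup>2 = 1] (mod int p)}"
  have Np: "N = p * p ^ (k - 1)" using k1 by (simp add: N_eq power_eq_if)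
  have p0: "p > 0" using prime_p prime_gt_0_nat by blast
  have cls: "card {z \<in> {0..<int N}. [z = r] (mod int p)} = p ^ (k - 1)" for r
    unfolding Np by (rule card_congruence_class[OF p0])
  have "card ?B \<le> 2 * p ^ (k - 1)"
  proof (cases "?B = {}")
    case False
    then obtain r where r: "[D * r\<^sup>2 = 1] (mod int p)" by blast
    have "?B \<subseteq> {z \<in> {0..<int N}. [z = r] (mod int p)} \<union> {z \<in> {0..<int N}. [z = - r] (mod int p)}"
    proof
      fix z assume z: "z \<in> ?B"
      then have "[D * z\<^sup>2 = D * r\<^sup>2] (mod int p)" using r cong_trans cong_sym by blast
      then have "int p dvd D * z\<^sup>2 - D * r\<^sup>2" by (simp add: cong_iff_dvd_diff)
      moreover have "D * z\<^sup>2 - D * r\<^sup>2 = D * ((z - r) * (z + r))" by (simp add: power2_eq_square algebra_simps)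
      ultimately have "int p dvd z - r \<or> int p dvd z + r" using pD prime_int_p by (simp add: prime_dvd_mult_iff)
      then show "z \<in> {z \<in> {0..<int N}. [z = r] (mod int p)} \<union> {z \<in> {0..<int N}. [z = - r] (mod int p)}"
        using z by (auto simp: cong_iff_dvd_diff)
    qed
    then have "card ?B \<le> card ({z \<in> {0..<int N}. [z = r] (mod int p)} \<union> {z \<in> {0..<int N}. [z = - r] (mod int p)})"
      by (intro card_mono finite_UnI finite_int_interval_filter)
    also have "\<dots> \<le> p ^ (k - 1) + p ^ (k - 1)" by (rule order_trans[OF card_Un_le]) (simp only: cls order_refl)
    finally show ?thesis by simp
  qed (simp only: card.empty zero_le)
  moreover have "card {0..<int N} \<le> card (X_set A p k) + card ?B"
  proof -
    have "{0..<int N} \<subseteq> X_set A p k \<union> ?B" by (auto simp: X_set_def N_eq)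
    moreover have "finite (X_set A p k)" unfolding X_set_def by (rule finite_int_interval_filter)
    ultimately have "card {0..<int N} \<le> card (X_set A p k \<union> ?B)"
      by (intro card_mono finite_UnI finite_int_interval_filter)
    then show ?thesis by (rule order_trans) (rule card_Un_le)
  qed
  ultimately show ?thesis by simp
qed

text \<open>The parameter 0 belongs to the identity, whose trace gives the main term N^2. The other
  elements of \<open>H\<close> together contribute only the smaller second term.\<close>

lemma sum_F_H: "(\<Sum>\<beta>\<in>H. (cmod (F \<beta>))\<^sup>2) \<le> real (N\<^sup>2 + k * p ^ (2 * k - 1))"
proof -
  let ?g = "\<lambda>x. (card {z \<in> {0..<int N}. int N dvd x * z})\<^sup>2"
  have "(\<Sum>\<beta>\<in>H. (cmod (F \<beta>))\<^sup>2) = (\<Sum>x\<in>Y. (cmod (F (R (- 1) 0 \<otimes>\<^bsub>C\<^esub> cayley \<alpha> N x)))\<^sup>2)"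
    using sum.reindex_bij_betw[OF bij_neg_cayley, of "\<lambda>\<beta>. (cmod (F \<beta>))\<^sup>2"] by simp
  also have "\<dots> \<le> (\<Sum>x\<in>Y. real (?g x))"
  proof (rule sum_mono)
    fix x assume "x \<in> Y"
    then obtain a b where ab: "cay x a b" "cayley \<alpha> N x = R a b" using cayley_cay X_coprime Y_X by (metis subsetD)
    have "coprime D (int N)" using pD coprime_N by blast
    from f_norm_congruence_subgroup[OF ab(1) this]
    show "(cmod (F (R (- 1) 0 \<otimes>\<^bsub>C\<^esub> cayley \<alpha> N x)))\<^sup>2 \<le> real (?g x)"
      by (simp only: ab(2) neg_R F_R card_scaled_zero_box)
  qed
  also have "\<dots> = real (\<Sum>x\<in>Y. ?g x)" by simp
  also have "(\<Sum>x\<in>Y. ?g x) \<le> (\<Sum>x\<in>insert 0 {0<..<int N}. ?g x)"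
    by (rule sum_mono2) (auto simp: Y_def)
  also have "\<dots> = ?g 0 + (\<Sum>x\<in>{0<..<int N}. ?g x)" by (rule sum.insert) auto
  also have "?g 0 = N\<^sup>2"
  proof -
    have "{z \<in> {0..<int N}. int N dvd 0 * z} = {0..<int N}" by auto
    then show ?thesis by simp
  qed
  also have "(\<Sum>x\<in>{0<..<int N}. ?g x) \<le> k * p ^ (2 * k - 1)"
    using sum_card_annihilator_squares[OF prime_p k1] N_eq by simp
  finally show ?thesis by simp
qed

lemma sum_F: "(\<Sum>\<beta>\<in>carrier C. (cmod (F \<beta>))\<^sup>2) \<le> real (N + N\<^sup>2 + k * p ^ (2 * k - 1))"
proof -
  have "(\<Sum>\<beta>\<in>carrier C. (cmod (F \<beta>))\<^sup>2) = (\<Sum>\<beta>\<in>carrier C - H. (cmod (F \<beta>))\<^sup>2) + (\<Sum>\<beta>\<in>H. (cmod (F \<beta>))\<^sup>2)"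
    using finite_C subgroup.subset[OF subgroup_H] by (intro sum.subset_diff) auto
  also have "(\<Sum>\<beta>\<in>carrier C - H. (cmod (F \<beta>))\<^sup>2) = real (card (carrier C - H))"
    by (simp add: F_norm)
  also have "card (carrier C - H) = card (X_set A p k)" using bij_betw_same_card[OF bij_cayley] by simp
  finally show ?thesis using sum_F_H card_X_le by simp
qed

definition simple_chars :: "(real set \<Rightarrow> complex) set" where
  "simple_chars = {\<theta> \<in> characters C. mult_char \<theta> = 1}"

text \<open>The multiplicities are natural numbers; their sum is the trace \<open>N\<close> of the
  identity, and Parseval bounds the sum of their squares.\<close>

lemma card_simple_chars: "\<bar>real (card simple_chars) / real N - 1\<bar> \<le> (2 * real k + 6) / real p"
proof -
  have p2: "real p \<ge> 2" using prime_p prime_ge_2_nat by fastforce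
  \<comment> \<open>This is the order of \<open>H\<close> and the scale of all error terms.\<close>
  define q where "q = real (p ^ (k - 1))"
  have q1: "q \<ge> 1" unfolding q_def using p2 by (metis of_nat_1 of_nat_le_iff one_le_power order_trans of_nat_numeral one_le_numeral)
  have Nq: "real N = real p * q" using k1 by (simp add: N_eq q_def power_eq_if)
  have "\<forall>\<theta>\<in>characters C. \<exists>r::nat. mult_char \<theta> = of_nat r" using rep.multiplicity_nat F_eq by simp
  then obtain r :: "(real set \<Rightarrow> complex) \<Rightarrow> nat" where r: "\<And>\<theta>. \<theta> \<in> characters C \<Longrightarrow> mult_char \<theta> = of_nat (r \<theta>)" by metis
  have S: "simple_chars = {\<theta> \<in> characters C. r \<theta> = 1}" by (auto simp: simple_chars_def r)
  have one: "F \<one>\<^bsub>C\<^esub> = of_nat N" by (simp add: C_R_one F_R f_def V_one mtr_one)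
  have "\<bar>real (card {\<theta> \<in> characters C. r \<theta> = 1}) - real p * q\<bar> \<le> (2 * real k + 6) * q"
  proof (rule card_multiplicity_one)
    show "finite (characters C)" by (rule finite_characters[OF comm_group_C finite_C])
    have "real N \<le> real (card (X_set A p k)) + 2 * q" using card_X_ge unfolding q_def by linarith
    moreover have "real (card (X_set A p k)) \<le> real N" using card_X_le by simp
    moreover have "real (card (characters C)) = real (card (X_set A p k)) + q"
      using card_characters[OF comm_group_C finite_C] card_C by (simp add: q_def)
    ultimately show "(real p - 1) * q \<le> real (card (characters C))" "real (card (characters C)) \<le> (real p + 1) * q"
      unfolding Nq by (simp_all add: algebra_simps)
    have "complex_of_real (\<Sum>\<theta>\<in>characters C. real (r \<theta>)) = of_real (real N)"
      using sum_char_coeff[OF comm_group_C finite_C, of F] one by (simp add: r)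
    then show "(\<Sum>\<theta>\<in>characters C. real (r \<theta>)) = real p * q" unfolding Nq of_real_eq_iff .
    have "(\<Sum>\<theta>\<in>characters C. (real (r \<theta>))\<^sup>2) = (\<Sum>\<beta>\<in>carrier C. (cmod (F \<beta>))\<^sup>2) / real (card (carrier C))"
      using parseval_char_coeff[OF comm_group_C finite_C, of F] by (simp add: r)
    also have "\<dots> \<le> real (N + N\<^sup>2 + k * p ^ (2 * k - 1)) / real (card (carrier C))"
      by (intro divide_right_mono sum_F) simp
    also have "real (N + N\<^sup>2 + k * p ^ (2 * k - 1)) = real p * q + (real p)\<^sup>2 * q\<^sup>2 + real k * real p * q\<^sup>2"
    proof -
      have "2 * k - 1 = 1 + (k - 1) * 2" using k1 by simp
      then have "p ^ (2 * k - 1) = p * (p ^ (k - 1))\<^sup>2" by (simp only: power_add power_mult power_one_right)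
      then have "real (p ^ (2 * k - 1)) = real p * q\<^sup>2" by (simp add: q_def)
      then show ?thesis by (simp add: Nq power_mult_distrib)
    qed
    finally show "(\<Sum>\<theta>\<in>characters C. (real (r \<theta>))\<^sup>2)
      \<le> (real p * q + (real p)\<^sup>2 * q\<^sup>2 + real k * real p * q\<^sup>2) / real (card (characters C))"
      by (simp only: card_characters[OF comm_group_C finite_C])
  qed (use p2 q1 in auto)
  then have "\<bar>real (card simple_chars) - real N\<bar> \<le> (2 * real k + 6) * q" unfolding S Nq .
  then have "\<bar>real (card simple_chars) - real N\<bar> / real N \<le> (2 * real k + 6) * q / real N"
    by (intro divide_right_mono) auto
  also have "(2 * real k + 6) * q / real N = (2 * real k + 6) / real p" unfolding Nq using q1 by simp
  also have "\<bar>real (card simple_chars) - real N\<bar> / real N = \<bar>real (card simple_chars) / real N - 1\<bar>"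
  proof -
    have "real (card simple_chars) / real N - 1 = (real (card simple_chars) - real N) / real N"
      using N_pos by (simp add: diff_divide_distrib)
    then show ?thesis by simp
  qed
  finally show ?thesis .
qed

section \<open>Matrix elements of Hecke eigenfunctions\<close>

text \<open>The eigenvector condition for \<open>A\<close> follows from the others by
  \<open>A_in_C\<close>.\<close>

lemma hecke_eigenfunction_iff:
  "hecke_eigenfunction A \<alpha> N \<rho> \<theta> \<psi> \<longleftrightarrow> rep.eigen \<theta> \<psi> \<and> \<psi> \<noteq> 0\<^sub>v N"
proof -
  have "\<exists>c. \<rho> (reduce_mat N A) *\<^sub>v \<psi> = c \<cdot>\<^sub>v \<psi>" if "rep.eigen \<theta> \<psi>"
    using that A_in_C by (metis rep.eigen_def \<pi>_def)
  then show ?thesis by (auto simp: hecke_eigenfunction_def rep.eigen_def \<pi>_def)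
qed

lemma eigen_normalized_nonzero:
  assumes "state_inner N \<psi> \<psi> = 1"
  shows "\<psi> \<noteq> 0\<^sub>v N"
proof
  assume "\<psi> = 0\<^sub>v N"
  then have "state_inner N \<psi> \<psi> = 0" by (simp add: state_inner_eq[of _ N])
  then show False using assms by simp
qed

text \<open>The sign squares to 1, so \<open>sgn_D\<close> times \<open>F\<close> is multiplicative
  outside \<open>H\<close>. The extension to a character requires more than
  \<open>4 * card H\<close> elements; the count of parameters provides at least (p - 1) p^(k-1),
  which suffices for primes above 5.\<close>

lemma exists_sign_character:
  assumes "p \<ge> 7"
  shows "\<exists>\<theta>\<in>characters C. \<forall>\<beta>\<in>carrier C - H. F \<beta> = of_int sgn_D * \<theta> \<beta>"
proof -
  let ?h = "\<lambda>\<beta>. of_int sgn_D * F \<beta>"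
  have s: "(of_int sgn_D :: complex) * of_int sgn_D = 1" using sgn_D by auto
  have "\<exists>\<theta>\<in>characters C. \<forall>x\<in>carrier C. x \<notin> H \<longrightarrow> \<theta> x = ?h x"
  proof (rule character_of_almost_multiplicative[OF comm_group_C finite_C subgroup_H])
    have "7 * p ^ (k - 1) \<le> N" using assms k1 by (simp add: N_eq power_eq_if)
    moreover have "p ^ (k - 1) > 0" using assms by simp
    ultimately show "4 * card H < card (carrier C)" using card_X_ge card_C card_H by linarith
    show "cmod (?h x) = 1" if "x \<in> carrier C" "x \<notin> H" for x
      using F_norm[of x] that sgn_D by (auto simp: norm_mult)
    show "?h (x \<otimes>\<^bsub>C\<^esub> y) = ?h x * ?h y"
      if "x \<in> carrier C" "x \<notin> H" "y \<in> carrier C" "y \<notin> H" "x \<otimes>\<^bsub>C\<^esub> y \<notin> H" for x y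
    proof -
      have "?h x * ?h y = (of_int sgn_D * of_int sgn_D) * (F x * F y)" by (simp only: mult_ac)
      also have "\<dots> = F x * F y" by (simp only: s mult_1)
      also have "\<dots> = ?h (x \<otimes>\<^bsub>C\<^esub> y)" using that by (intro F_mult) auto
      finally show ?thesis by (rule sym)
    qed
  qed
  then obtain \<theta> where th: "\<theta> \<in> characters C" "\<And>x. x \<in> carrier C \<Longrightarrow> x \<notin> H \<Longrightarrow> \<theta> x = ?h x" by blast
  have "F x = of_int sgn_D * \<theta> x" if "x \<in> carrier C - H" for x
    using th(2)[of x] that s by (simp add: mult.assoc[symmetric])
  then show ?thesis using th(1) by blast
qed

text \<open>Reindexing by inversion turns the conjugate of \<open>\<theta>\<close> into
  \<open>\<theta>\<close> and x into -x, which makes the phase positive. It also evaluates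
  \<open>F\<close> at an inverse, so the conjugate of \<open>\<theta>'\<close> appears. Terms in
  \<open>H\<close> vanish since \<open>n\<close> cannot be 0 modulo \<open>p\<close> when
  \<open>Q_form A n\<close> is a unit.\<close>

lemma char_coeff_T_tilde:
  assumes th: "\<theta> \<in> characters C" and ch: "\<theta>' \<in> characters C"
    and F: "\<And>\<beta>. \<beta> \<in> carrier C - H \<Longrightarrow> F \<beta> = of_int sgn_D * \<theta>' \<beta>"
    and Q: "\<not> int p dvd Q_form A n"
  shows "char_coeff C (\<lambda>\<beta>. mtr (TT n * \<pi> \<beta>)) \<theta> = of_int sgn_D / of_nat (card (carrier C))
    * E_sum A \<alpha> p k (Q_form A n * modular_inverse (int (p ^ k)) 2) (\<lambda>\<beta>. \<theta> \<beta> * cnj (\<theta>' \<beta>))"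
proof -
  interpret C: comm_group C by (rule comm_group_C)
  let ?G = "\<lambda>\<beta>. mtr (TT n * \<pi> \<beta>)"
  have HC: "H \<subseteq> carrier C" using subgroup_H by (simp add: subgroup.subset)
  have bij: "bij_betw (\<lambda>x. inv\<^bsub>C\<^esub> x) (carrier C) (carrier C)"
    by (rule bij_betwI[of _ _ _ "\<lambda>x. inv\<^bsub>C\<^esub> x"]) auto
  have n0: "\<not> vcong p n 0"
  proof
    assume "vcong p n 0"
    then have "[Q_form A n = Q_form A 0] (mod int p)" by (rule Q_form_cong)
    then show False using Q by (simp add: Q_form_eq cong_0_iff)
  qed
  have zero: "?G \<beta> = 0" if "\<beta> \<in> H" for \<beta>
  proof -
    obtain a b where ab: "\<beta> = R a b" "nrm a b" "int p dvd a - 1" "int p dvd b" using \<open>\<beta> \<in> H\<close> by (auto simp: H_def)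
    have "N = p * p ^ (k - 1)" using k1 by (simp add: N_eq power_eq_if)
    from mtr_T_V_congruence_subgroup[OF ab(2) this ab(3,4) n0] show ?thesis by (simp add: ab(1) pi_R)
  qed
  have "(\<Sum>\<beta>\<in>carrier C. cnj (\<theta> \<beta>) * ?G \<beta>) = (\<Sum>\<beta>\<in>carrier C. cnj (\<theta> (inv\<^bsub>C\<^esub> \<beta>)) * ?G (inv\<^bsub>C\<^esub> \<beta>))"
    using sum.reindex_bij_betw[OF bij, of "\<lambda>\<beta>. cnj (\<theta> \<beta>) * ?G \<beta>"] by simp
  also have "\<dots> = (\<Sum>\<beta>\<in>carrier C. \<theta> \<beta> * ?G (inv\<^bsub>C\<^esub> \<beta>))"
    by (intro sum.cong refl) (simp add: character_inv[OF comm_group_C th])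
  also have "\<dots> = (\<Sum>\<beta>\<in>carrier C - H. \<theta> \<beta> * ?G (inv\<^bsub>C\<^esub> \<beta>))"
    using finite_C HC subgroup.m_inv_closed[OF subgroup_H]
    by (intro sum.mono_neutral_right) (auto simp: zero)
  also have "\<dots> = (\<Sum>x\<in>X_set A p k. \<theta> (cayley \<alpha> N x) * ?G (inv\<^bsub>C\<^esub> (cayley \<alpha> N x)))"
    using sum.reindex_bij_betw[OF bij_cayley, of "\<lambda>\<beta>. \<theta> \<beta> * ?G (inv\<^bsub>C\<^esub> \<beta>)"] by simp
  also have "\<dots> = (\<Sum>x\<in>X_set A p k. of_int sgn_D * (e_mod N (Q_form A n * modular_inverse (int N) 2 * x)
      * (\<theta> (cayley \<alpha> N x) * cnj (\<theta>' (cayley \<alpha> N x)))))"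
  proof (rule sum.cong[OF refl])
    fix x assume x: "x \<in> X_set A p k"
    then obtain a b where ab: "cay x a b" "cayley \<alpha> N x = R a b" using cayley_cay X_coprime by blast
    have nb: "nrm a b" using ab(1) by (simp add: cay_def)
    have b: "cayley \<alpha> N x \<in> carrier C - H" using x bij_cayley by (auto simp: bij_betw_def)
    have ib: "inv\<^bsub>C\<^esub> (cayley \<alpha> N x) \<in> carrier C - H"
      using b subgroup.m_inv_closed[OF subgroup_H, of "inv\<^bsub>C\<^esub> (cayley \<alpha> N x)"] by auto
    have iR: "inv\<^bsub>C\<^esub> (cayley \<alpha> N x) = R a (- b)" by (simp add: ab(2) C_R_inv[OF nb])
    have "?G (inv\<^bsub>C\<^esub> (cayley \<alpha> N x)) = e_mod N (- (half N * (- x) * Q_form A n)) * F (inv\<^bsub>C\<^esub> (cayley \<alpha> N x))"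
      by (simp only: iR pi_R F_R mtr_T_V_cay[OF cay_uminus[OF ab(1)]])
    also have "F (inv\<^bsub>C\<^esub> (cayley \<alpha> N x)) = of_int sgn_D * cnj (\<theta>' (cayley \<alpha> N x))"
      using F[OF ib] character_inv[OF comm_group_C ch, of "cayley \<alpha> N x"] b by simp
    also have "e_mod N (- (half N * (- x) * Q_form A n)) = e_mod N (Q_form A n * modular_inverse (int N) 2 * x)"
    proof (rule e_mod_cong[OF N_pos])
      \<comment> \<open>Both \<open>half N\<close> and the modular inverse invert 2, so they agree
        modulo \<open>N\<close>.\<close>
      have "coprime 2 (int N)" using oddN by simp
      then have "[2 * half N * 1 = 2 * modular_inverse (int N) 2] (mod int N)"
        using half_cong[OF oddN, of 1] cong_modular_inverse1 cong_trans cong_sym by blast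
      then have "[half N = modular_inverse (int N) 2] (mod int N)"
        using \<open>coprime 2 (int N)\<close> by (simp add: cong_mult_lcancel)
      then have "[Q_form A n * half N * x = Q_form A n * modular_inverse (int N) 2 * x] (mod int N)"
        by (intro cong_mult cong_refl)
      then show "[- (half N * (- x) * Q_form A n) = Q_form A n * modular_inverse (int N) 2 * x] (mod int N)"
        by (simp add: mult_ac)
    qed
    finally show "\<theta> (cayley \<alpha> N x) * ?G (inv\<^bsub>C\<^esub> (cayley \<alpha> N x))
      = of_int sgn_D * (e_mod N (Q_form A n * modular_inverse (int N) 2 * x)
      * (\<theta> (cayley \<alpha> N x) * cnj (\<theta>' (cayley \<alpha> N x))))" by (simp only: mult_ac)
  qed
  also have "\<dots> = of_int sgn_D * E_sum A \<alpha> p k (Q_form A n * modular_inverse (int (p ^ k)) 2) (\<lambda>\<beta>. \<theta> \<beta> * cnj (\<theta>' \<beta>))"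
    by (simp only: E_sum_def N_eq sum_distrib_left)
  finally show ?thesis by (simp add: char_coeff_def)
qed

text \<open>The factor \<open>(-1) powi (n $ 1 * n $ 2)\<close> is what separates
  \<open>T_op\<close>, the quantisation of the elementary observable, from
  \<open>T_tilde\<close>.\<close>

lemma matrix_element_formula:
  assumes th: "\<theta> \<in> simple_chars" and ch: "\<theta>' \<in> characters C"
    and F: "\<And>\<beta>. \<beta> \<in> carrier C - H \<Longrightarrow> F \<beta> = of_int sgn_D * \<theta>' \<beta>"
    and e: "hecke_eigenfunction A \<alpha> N \<rho> \<theta> \<psi>" and nrm: "state_inner N \<psi> \<psi> = 1"
    and Q: "\<not> int p dvd Q_form A n"
  shows "state_inner N (Op N (elementary_observable n) *\<^sub>v \<psi>) \<psi> =
    of_int sgn_D * ((-1) powi (n $ 1 * n $ 2) / of_nat (card (carrier C)))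
      * E_sum A \<alpha> p k (Q_form A n * modular_inverse (int (p ^ k)) 2) (\<lambda>\<beta>. \<theta> \<beta> * cnj (\<theta>' \<beta>))"
proof -
  let ?s = "(-1) powi (n $ 1 * n $ 2) :: complex"
  have ss: "?s * ?s = 1" by (cases "even (n $ 1 * n $ 2)") (auto simp: power_int_minus_left)
  have "?s \<cdot>\<^sub>m TT n = T_op N n"
    unfolding T_tilde_def by (rule eq_matI) (auto simp: ss mult.assoc[symmetric])
  then have T: "Op N (elementary_observable n) = ?s \<cdot>\<^sub>m TT n" by (simp add: Op_elementary)
  have th': "\<theta> \<in> characters C" "char_coeff C (\<lambda>x. mtr (\<pi> x)) \<theta> = 1"
    using th F_eq by (auto simp: simple_chars_def)
  have e': "rep.eigen \<theta> \<psi>" using e hecke_eigenfunction_iff by blast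
  have "state_inner N (Op N (elementary_observable n) *\<^sub>v \<psi>) \<psi> = char_coeff C (\<lambda>x. mtr (?s \<cdot>\<^sub>m TT n * \<pi> x)) \<theta>"
    unfolding T by (rule rep.simple_matrix_element[OF th' e' nrm]) simp
  also have "\<dots> = ?s * char_coeff C (\<lambda>x. mtr (TT n * \<pi> x)) \<theta>"
    unfolding char_coeff_def times_divide_eq_right sum_distrib_left
    by (intro arg_cong2[of _ _ _ _ "(/)"] sum.cong refl) (simp add: mtr_smult_mult rep.pi_carrier)
  also have "char_coeff C (\<lambda>x. mtr (TT n * \<pi> x)) \<theta> = of_int sgn_D / of_nat (card (carrier C))
    * E_sum A \<alpha> p k (Q_form A n * modular_inverse (int (p ^ k)) 2) (\<lambda>\<beta>. \<theta> \<beta> * cnj (\<theta>' \<beta>))"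
    by (rule char_coeff_T_tilde[OF th'(1) ch _ Q]) (rule F)
  finally show ?thesis by simp
qed

lemma existence_uniqueness:
  assumes th: "\<theta> \<in> simple_chars"
  shows "\<exists>\<psi>. hecke_eigenfunction A \<alpha> N \<rho> \<theta> \<psi> \<and> state_inner N \<psi> \<psi> = 1 \<and>
    (\<forall>\<phi>. hecke_eigenfunction A \<alpha> N \<rho> \<theta> \<phi> \<longrightarrow> state_inner N \<phi> \<phi> = 1 \<longrightarrow> (\<exists>c. cmod c = 1 \<and> \<phi> = c \<cdot>\<^sub>v \<psi>))"
proof -
  have th': "\<theta> \<in> characters C" "char_coeff C (\<lambda>x. mtr (\<pi> x)) \<theta> = 1"
    using th F_eq by (auto simp: simple_chars_def)
  obtain \<psi> where psi: "rep.eigen \<theta> \<psi>" "state_inner N \<psi> \<psi> = 1" using rep.simple_eigenvector[OF th'] by blast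
  then have "hecke_eigenfunction A \<alpha> N \<rho> \<theta> \<psi>" using hecke_eigenfunction_iff eigen_normalized_nonzero by blast
  moreover have "\<exists>c. cmod c = 1 \<and> \<phi> = c \<cdot>\<^sub>v \<psi>"
    if "hecke_eigenfunction A \<alpha> N \<rho> \<theta> \<phi>" "state_inner N \<phi> \<phi> = 1" for \<phi>
    using rep.simple_eigenvector_unique[OF th' psi] that hecke_eigenfunction_iff by blast
  ultimately show ?thesis using psi(2) by blast
qed
end

section \<open>Spectral data of a level\<close>

text \<open>Everything the theorem asserts at a single level, gathered into one predicate so that
  the sign, the set of characters and the fixed character can be chosen together.\<close>

definition spectral_data ::
  "int^2^2 \<Rightarrow> real \<Rightarrow> (int^2^2 \<Rightarrow> complex Matrix.mat) \<Rightarrow> nat \<Rightarrow> nat \<Rightarrow> nat \<Rightarrow> int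
     \<Rightarrow> (real set \<Rightarrow> complex) set \<Rightarrow> (real set \<Rightarrow> complex) \<Rightarrow> bool" where
  "spectral_data A \<alpha> \<rho> N p k \<epsilon> C\<^sub>0 \<theta>\<^sub>0 \<longleftrightarrow>
     \<epsilon> \<in> {1, -1} \<and>
     C\<^sub>0 \<subseteq> characters (hecke_group \<alpha> N) \<and>
     \<theta>\<^sub>0 \<in> characters (hecke_group \<alpha> N) \<and>
     (\<forall>\<theta>\<in>C\<^sub>0.
       (\<exists>\<psi>. hecke_eigenfunction A \<alpha> N \<rho> \<theta> \<psi> \<and>
          state_inner N \<psi> \<psi> = 1 \<and>
          (\<forall>\<phi>. hecke_eigenfunction A \<alpha> N \<rho> \<theta> \<phi> \<longrightarrow>
             state_inner N \<phi> \<phi> = 1 \<longrightarrow>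
             (\<exists>c. cmod c = 1 \<and> \<phi> = c \<cdot>\<^sub>v \<psi>))) \<and>
       (\<forall>\<psi>. hecke_eigenfunction A \<alpha> N \<rho> \<theta> \<psi> \<longrightarrow>
          state_inner N \<psi> \<psi> = 1 \<longrightarrow>
          (\<forall>n :: int^2. \<not> int p dvd Q_form A n \<longrightarrow>
             state_inner N (Op N (elementary_observable n) *\<^sub>v \<psi>) \<psi> =
             of_int \<epsilon>
               * ((-1) powi (n $ 1 * n $ 2)
                  / of_nat (card (carrier (hecke_group \<alpha> N))))
               * E_sum A \<alpha> p k (Q_form A n * modular_inverse (int (p ^ k)) 2)
                   (\<lambda>\<beta>. \<theta> \<beta> * \<theta>\<^sub>0 \<beta>))))"

text \<open>The extensional \<open>\<theta>\<^sub>0\<close> agrees with the conjugated character on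
  the group only, and the sum evaluates characters nowhere else.\<close>

lemma (in hecke_level) E_sum_cong:
  assumes "\<And>\<beta>. \<beta> \<in> carrier C \<Longrightarrow> \<theta> \<beta> = \<theta>' \<beta>"
  shows "E_sum A \<alpha> p k \<nu> \<theta> = E_sum A \<alpha> p k \<nu> \<theta>'"
proof -
  have "cayley \<alpha> N x \<in> carrier C" if "x \<in> X_set A p k" for x
    using bij_cayley that by (auto simp: bij_betw_def)
  then show ?thesis unfolding E_sum_def N_eq[symmetric] by (intro sum.cong refl) (simp add: assms)
qed

text \<open>For \<open>p < 7\<close> the index of \<open>H\<close> may be too small to define \<open>\<theta>\<^sub>0\<close>, but the limit
  allows the empty set of characters there.\<close>

lemma (in hecke_level) spectral_data_exists:
  "\<exists>\<epsilon> C\<^sub>0 \<theta>\<^sub>0. spectral_data A \<alpha> \<rho> N p k \<epsilon> C\<^sub>0 \<theta>\<^sub>0 \<and>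
     (p \<ge> 7 \<longrightarrow> \<bar>real (card C\<^sub>0) / real N - 1\<bar> \<le> (2 * real k + 6) / real p)"
proof (cases "p \<ge> 7")
  case False
  then have "spectral_data A \<alpha> \<rho> N p k 1 {} (\<lambda>_\<in>carrier C. 1)"
    using restrict_one_character[OF comm_group_C] by (simp add: spectral_data_def)
  then show ?thesis using False by blast
next
  case True
  obtain \<theta>' where th': "\<theta>' \<in> characters C" "\<And>\<beta>. \<beta> \<in> carrier C - H \<Longrightarrow> F \<beta> = of_int sgn_D * \<theta>' \<beta>"
    using exists_sign_character[OF True] by blast
  define \<theta>\<^sub>0 where "\<theta>\<^sub>0 = (\<lambda>\<beta>\<in>carrier C. cnj (\<theta>' \<beta>))"
  have "spectral_data A \<alpha> \<rho> N p k sgn_D simple_chars \<theta>\<^sub>0"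
    unfolding spectral_data_def
  proof (intro conjI ballI allI impI)
    show "sgn_D \<in> {1, -1}" using sgn_D by auto
    show "simple_chars \<subseteq> characters C" by (auto simp: simple_chars_def)
    show "\<theta>\<^sub>0 \<in> characters C" unfolding \<theta>\<^sub>0_def by (rule character_mult_closed(2)[OF comm_group_C th'(1) th'(1)])
    fix \<theta> assume th: "\<theta> \<in> simple_chars"
    show "\<exists>\<psi>. hecke_eigenfunction A \<alpha> N \<rho> \<theta> \<psi> \<and> state_inner N \<psi> \<psi> = 1 \<and>
      (\<forall>\<phi>. hecke_eigenfunction A \<alpha> N \<rho> \<theta> \<phi> \<longrightarrow> state_inner N \<phi> \<phi> = 1 \<longrightarrow> (\<exists>c. cmod c = 1 \<and> \<phi> = c \<cdot>\<^sub>v \<psi>))"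
      by (rule existence_uniqueness[OF th])
    fix \<psi> and n :: "int^2"
    assume psi: "hecke_eigenfunction A \<alpha> N \<rho> \<theta> \<psi>" "state_inner N \<psi> \<psi> = 1" and Q: "\<not> int p dvd Q_form A n"
    have "E_sum A \<alpha> p k \<nu> (\<lambda>\<beta>. \<theta> \<beta> * cnj (\<theta>' \<beta>)) = E_sum A \<alpha> p k \<nu> (\<lambda>\<beta>. \<theta> \<beta> * \<theta>\<^sub>0 \<beta>)" for \<nu>
      by (rule E_sum_cong) (simp add: \<theta>\<^sub>0_def)
    moreover have "state_inner N (Op N (elementary_observable n) *\<^sub>v \<psi>) \<psi> =
      of_int sgn_D * ((-1) powi (n $ 1 * n $ 2) / of_nat (card (carrier C)))
        * E_sum A \<alpha> p k (Q_form A n * modular_inverse (int (p ^ k)) 2) (\<lambda>\<beta>. \<theta> \<beta> * cnj (\<theta>' \<beta>))"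
      by (rule matrix_element_formula[OF th th'(1) _ psi Q]) (rule th'(2))
    ultimately show "state_inner N (Op N (elementary_observable n) *\<^sub>v \<psi>) \<psi> =
      of_int sgn_D * ((-1) powi (n $ 1 * n $ 2) / of_nat (card (carrier C)))
        * E_sum A \<alpha> p k (Q_form A n * modular_inverse (int (p ^ k)) 2) (\<lambda>\<beta>. \<theta> \<beta> * \<theta>\<^sub>0 \<beta>)" by simp
  qed
  then show ?thesis using card_simple_chars by blast
qed

theorem theorem1:
  fixes A :: "int^2^2" and \<alpha> :: real
    and U :: "nat \<Rightarrow> int^2^2 \<Rightarrow> complex Matrix.mat"
  assumes "Determinants.det A = 1"
    and "\<bar>trace A\<bar> > 2"
    and "eigenvalue_of A \<alpha>"
    and "\<And>N. odd N \<Longrightarrow> quantum_propagator N (U N)"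
  shows "\<exists>(\<epsilon> :: nat \<Rightarrow> nat \<Rightarrow> int)
      (C\<^sub>0 :: nat \<Rightarrow> nat \<Rightarrow> (real set \<Rightarrow> complex) set)
      (\<theta>\<^sub>0 :: nat \<Rightarrow> nat \<Rightarrow> real set \<Rightarrow> complex).
    (\<forall>k\<ge>1. ((\<lambda>p. real (card (C\<^sub>0 p k)) / real (p ^ k)) \<longlongrightarrow> 1)
        (inf at_top (principal {p. Factorial_Ring.prime p \<and> odd p \<and> \<not> int p dvd discr A}))) \<and>
    (\<forall>p k. Factorial_Ring.prime p \<longrightarrow> odd p \<longrightarrow> \<not> int p dvd discr A \<longrightarrow> k \<ge> 1 \<longrightarrow>
      \<epsilon> p k \<in> {1, -1} \<and>
      C\<^sub>0 p k \<subseteq> characters (hecke_group \<alpha> (p ^ k)) \<and>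
      \<theta>\<^sub>0 p k \<in> characters (hecke_group \<alpha> (p ^ k)) \<and>
      (\<forall>\<theta>\<in>C\<^sub>0 p k.
        (\<exists>\<psi>. hecke_eigenfunction A \<alpha> (p ^ k) (U (p ^ k)) \<theta> \<psi> \<and>
           state_inner (p ^ k) \<psi> \<psi> = 1 \<and>
           (\<forall>\<phi>. hecke_eigenfunction A \<alpha> (p ^ k) (U (p ^ k)) \<theta> \<phi> \<longrightarrow>
              state_inner (p ^ k) \<phi> \<phi> = 1 \<longrightarrow>
              (\<exists>c. cmod c = 1 \<and> \<phi> = c \<cdot>\<^sub>v \<psi>))) \<and>
        (\<forall>\<psi>. hecke_eigenfunction A \<alpha> (p ^ k) (U (p ^ k)) \<theta> \<psi> \<longrightarrow>
           state_inner (p ^ k) \<psi> \<psi> = 1 \<longrightarrow>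
           (\<forall>n :: int^2. \<not> int p dvd Q_form A n \<longrightarrow>
              state_inner (p ^ k)
                (Op (p ^ k) (elementary_observable n) *\<^sub>v \<psi>) \<psi> =
              of_int (\<epsilon> p k)
                * ((-1) powi (n $ 1 * n $ 2)
                   / of_nat (card (carrier (hecke_group \<alpha> (p ^ k)))))
                * E_sum A \<alpha> p k (Q_form A n * modular_inverse (int (p ^ k)) 2)
                    (\<lambda>\<beta>. \<theta> \<beta> * \<theta>\<^sub>0 p k \<beta>)))))"
proof -
  let ?S = "{p. Factorial_Ring.prime p \<and> odd p \<and> \<not> int p dvd discr A}"
  \<comment> \<open>Vacuous for inadmissible p and k, so that total choice functions exist.\<close>
  define P where "P p k x \<longleftrightarrow> (p \<in> ?S \<longrightarrow> k \<ge> 1 \<longrightarrow>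
      spectral_data A \<alpha> (U (p ^ k)) (p ^ k) p k (fst x) (fst (snd x)) (snd (snd x)) \<and>
      (p \<ge> 7 \<longrightarrow> \<bar>real (card (fst (snd x))) / real (p ^ k) - 1\<bar> \<le> (2 * real k + 6) / real p))"
    for p k and x :: "int \<times> (real set \<Rightarrow> complex) set \<times> (real set \<Rightarrow> complex)"
  have "\<exists>x. P p k x" for p k
  proof (cases "p \<in> ?S \<and> k \<ge> 1")
    case True
    then have "hecke_level (p ^ k) A (U (p ^ k)) \<alpha> p k"
      using assms by (intro hecke_level.intro propagator.intro hecke_level_axioms.intro) auto
    then obtain \<epsilon> C\<^sub>0 \<theta>\<^sub>0 where "spectral_data A \<alpha> (U (p ^ k)) (p ^ k) p k \<epsilon> C\<^sub>0 \<theta>\<^sub>0"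
      "p \<ge> 7 \<longrightarrow> \<bar>real (card C\<^sub>0) / real (p ^ k) - 1\<bar> \<le> (2 * real k + 6) / real p"
      using hecke_level.spectral_data_exists by blast
    then have "P p k (\<epsilon>, C\<^sub>0, \<theta>\<^sub>0)" unfolding P_def by simp
    then show ?thesis by blast
  qed (auto simp: P_def)
  then have "\<forall>p k. \<exists>x. P p k x" by blast
  then obtain T where T: "\<And>p k. P p k (T p k)" by metis
  have lim: "((\<lambda>p. real (card (fst (snd (T p k)))) / real (p ^ k)) \<longlongrightarrow> 1) (inf at_top (principal ?S))"
    if k: "k \<ge> 1" for k
  proof (rule LIM_zero_cancel, rule Lim_null_comparison)
    \<comment> \<open>The cardinality bound is available from 7 on, which is enough for a limit
      along the admissible primes.\<close>
    have "\<forall>\<^sub>F p in at_top. p \<in> ?S \<longrightarrow>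
        norm (real (card (fst (snd (T p k)))) / real (p ^ k) - 1) \<le> (2 * real k + 6) / real p"
      using eventually_ge_at_top[of "7::nat"]
    proof eventually_elim
      case (elim p)
      then show ?case using T[of p k] k unfolding P_def real_norm_def by blast
    qed
    then show "\<forall>\<^sub>F p in inf at_top (principal ?S).
        norm (real (card (fst (snd (T p k)))) / real (p ^ k) - 1) \<le> (2 * real k + 6) / real p"
      unfolding eventually_inf_principal .
    have "((\<lambda>p. (2 * real k + 6) / real p) \<longlongrightarrow> 0) at_top"
      by (rule lim_const_over_n)
    then show "((\<lambda>p. (2 * real k + 6) / real p) \<longlongrightarrow> 0) (inf at_top (principal ?S))"
      by (rule tendsto_mono[OF inf_le1])
  qed
  show ?thesis
  proof (intro exI[of _ "\<lambda>p k. fst (T p k)"] exI[of _ "\<lambda>p k. fst (snd (T p k))"]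
      exI[of _ "\<lambda>p k. snd (snd (T p k))"] conjI[OF _ allI[OF allI[OF impI[OF impI[OF impI[OF impI]]]]]] allI impI)
    fix k :: nat assume "k \<ge> 1"
    then show "((\<lambda>p. real (card (fst (snd (T p k)))) / real (p ^ k)) \<longlongrightarrow> 1) (inf at_top (principal ?S))"
      by (rule lim)
  next
    fix p k :: nat
    assume "Factorial_Ring.prime p" "odd p" "\<not> int p dvd discr A" "k \<ge> 1"
    then have "spectral_data A \<alpha> (U (p ^ k)) (p ^ k) p k (fst (T p k)) (fst (snd (T p k))) (snd (snd (T p k)))"
      using T[of p k] unfolding P_def by blast
    then show "fst (T p k) \<in> {1, -1} \<and>
      fst (snd (T p k)) \<subseteq> characters (hecke_group \<alpha> (p ^ k)) \<and>
      snd (snd (T p k)) \<in> characters (hecke_group \<alpha> (p ^ k)) \<and>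
      (\<forall>\<theta>\<in>fst (snd (T p k)).
        (\<exists>\<psi>. hecke_eigenfunction A \<alpha> (p ^ k) (U (p ^ k)) \<theta> \<psi> \<and>
           state_inner (p ^ k) \<psi> \<psi> = 1 \<and>
           (\<forall>\<phi>. hecke_eigenfunction A \<alpha> (p ^ k) (U (p ^ k)) \<theta> \<phi> \<longrightarrow>
              state_inner (p ^ k) \<phi> \<phi> = 1 \<longrightarrow>
              (\<exists>c. cmod c = 1 \<and> \<phi> = c \<cdot>\<^sub>v \<psi>))) \<and>
        (\<forall>\<psi>. hecke_eigenfunction A \<alpha> (p ^ k) (U (p ^ k)) \<theta> \<psi> \<longrightarrow>
           state_inner (p ^ k) \<psi> \<psi> = 1 \<longrightarrow>
           (\<forall>n :: int^2. \<not> int p dvd Q_form A n \<longrightarrow>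
              state_inner (p ^ k)
                (Op (p ^ k) (elementary_observable n) *\<^sub>v \<psi>) \<psi> =
              of_int (fst (T p k))
                * ((-1) powi (n $ 1 * n $ 2)
                   / of_nat (card (carrier (hecke_group \<alpha> (p ^ k)))))
                * E_sum A \<alpha> p k (Q_form A n * modular_inverse (int (p ^ k)) 2)
                    (\<lambda>\<beta>. \<theta> \<beta> * snd (snd (T p k)) \<beta>))))"
      unfolding spectral_data_def .
  qed
qed

end
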